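(* Let $d\in\mathbb{N}$ and let $X$ and $Y$ be Banach spaces. Let $p\in(1,2]$, $q\in[2,\infty)$ and $r\in(1,\infty]$ be such that $\frac1r=\frac1p-\frac1q$. Assume that for all $X$-strongly measurable $m:\mathbb{R}^d\to\mathcal{L}(X,Y)$ such that $\{|\xi|^{\frac dr}m(\xi)\mid\xi\in\mathbb{R}^d\}$ is $\gamma$-bounded, the operator $T_m:L^p(\mathbb{R}^d;X)\to L^q(\mathbb{R}^d;Y)$ is bounded. Then the following assertions hold: (1) If $X$ has cotype $2$, $Y=\mathbb{C}$, and $q=2$, then $X$ has type $p$. (2) If $Y$ has type $2$, $X=\mathbb{C}$, and $p=2$, then $Y$ has cotype $q$. (3) If $Y=X^*$ has type $2$, and $q=p'$, then $X$ has type $p$.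
   Context: Banach spaces are nonzero and over $\mathbb{C}$; $p'$ is the Hölder conjugate of $p$. With $(\gamma_n)$ independent standard complex Gaussians: a Banach space $E$ has type $s\in[1,2]$ if $(\mathbb{E}\|\sum_n\gamma_nx_n\|^2)^{1/2}\le C(\sum_n\|x_n\|^s)^{1/s}$ for some $C$ and all finite families; cotype $s\in[2,\infty)$ if $(\sum_n\|x_n\|^s)^{1/s}\le C(\mathbb{E}\|\sum_n\gamma_nx_n\|^2)^{1/2}$ for some $C$ and all finite families. $\mathcal{T}\subseteq\mathcal{L}(X,Y)$ is $\gamma$-bounded if there is $C\ge0$ with $(\mathbb{E}\|\sum_{k=1}^n\gamma_kT_kx_k\|_Y^2)^{1/2}\le C(\mathbb{E}\|\sum_{k=1}^n\gamma_kx_k\|_X^2)^{1/2}$ for all $n$, $T_k\in\mathcal{T}$, $x_k\in X$. $m$ is $X$-strongly measurable if $m(\cdot)x$ is strongly measurable for every $x\in X$. $\widehat f(\xi)=\int_{\mathbb{R}^d}e^{-2\pi i\xi\cdot t}f(t)\,dt$; $T_m(f):=\mathcal{F}^{-1}(m\widehat f\,)\in\mathcal{S}'(\mathbb{R}^d;Y)$ for $f\in\mathcal{S}(\mathbb{R}^d;X)$ (Schwartz functions); "$T_m:L^p(\mathbb{R}^d;X)\to L^q(\mathbb{R}^d;Y)$ is bounded" means there is $C_m$ with $T_m(f)\in L^q(\mathbb{R}^d;Y)$ and $\|T_m(f)\|_{L^q}\le C_m\|f\|_{L^p}$ for all $f\in\mathcal{S}(\mathbb{R}^d;X)$. Convention: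 $\frac1\infty=0$. *)

theory Defs
  imports "HOL-Probability.Probability"
begin

section \<open>Complex Banach spaces\<close>

class scaleC =
  fixes scaleC :: "complex \<Rightarrow> 'a \<Rightarrow> 'a"  (infixr "*\<^sub>C" 75)

class complex_normed_vector = real_normed_vector + scaleC +
  assumes scaleC_add_right: "c *\<^sub>C (x + y) = c *\<^sub>C x + c *\<^sub>C y"
    and scaleC_add_left: "(b + c) *\<^sub>C x = b *\<^sub>C x + c *\<^sub>C x"
    and scaleC_scaleC: "b *\<^sub>C (c *\<^sub>C x) = (b * c) *\<^sub>C x"
    and scaleC_of_real: "complex_of_real r *\<^sub>C x = r *\<^sub>R x"
    and norm_scaleC: "norm (c *\<^sub>C x) = cmod c * norm x"

class complex_banach = complex_normed_vector + banach

instantiation complex :: complex_banach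
begin

definition scaleC_complex :: "complex \<Rightarrow> complex \<Rightarrow> complex"
  where "scaleC_complex c z = c * z"

instance
  by standard (auto simp: scaleC_complex_def algebra_simps norm_mult scaleR_conv_of_real)

end

lemma bounded_linear_scaleC: "bounded_linear (\<lambda>x::'a::complex_normed_vector. c *\<^sub>C x)"
proof
  show "c *\<^sub>C (x + y) = c *\<^sub>C x + c *\<^sub>C y" for x y :: 'a
    by (rule scaleC_add_right)
  show "c *\<^sub>C (r *\<^sub>R x) = r *\<^sub>R (c *\<^sub>C x)" for r and x :: 'a
    by (metis scaleC_of_real scaleC_scaleC mult.commute)
  show "\<exists>K. \<forall>x::'a. norm (c *\<^sub>C x) \<le> norm x * K"
    by (rule exI[of _ "cmod c"]) (simp add: norm_scaleC mult.commute)
qed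

lemma scaleC_zero: "c *\<^sub>C (0::'a::complex_normed_vector) = 0"
  using norm_scaleC[of c "0::'a"] by simp


section \<open>Bounded complex-linear operators\<close>

text \<open>The space of bounded complex-linear operators, as the complex-linear elements of the library's
  space of bounded real-linear operators. It inherits the operator norm.\<close>

typedef (overloaded) ('a::complex_normed_vector, 'b::complex_normed_vector) cblinfun =
  "{f :: 'a \<Rightarrow>\<^sub>L 'b. \<forall>c x. blinfun_apply f (c *\<^sub>C x) = c *\<^sub>C blinfun_apply f x}"
  morphisms blinfun_of_cblinfun CBlinfun
  by (rule exI[of _ 0]) (simp add: scaleC_zero)

setup_lifting type_definition_cblinfun

lift_definition cblinfun_apply :: "('a::complex_normed_vector, 'b::complex_normed_vector) cblinfun \<Rightarrow> 'a \<Rightarrow> 'b"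
  is blinfun_apply .

lemma scaleC_minus_right: "c *\<^sub>C (- x) = - (c *\<^sub>C (x::'a::complex_normed_vector))"
  by (rule linear_simps(4)[OF bounded_linear_scaleC])

lemma scaleC_diff_right: "c *\<^sub>C (x - y) = c *\<^sub>C x - c *\<^sub>C (y::'a::complex_normed_vector)"
  by (rule linear_simps(2)[OF bounded_linear_scaleC])

lemma scaleC_scaleR: "c *\<^sub>C (r *\<^sub>R x) = r *\<^sub>R (c *\<^sub>C (x::'a::complex_normed_vector))"
  by (rule linear_simps(5)[OF bounded_linear_scaleC])

instantiation cblinfun :: (complex_normed_vector, complex_normed_vector) complex_normed_vector
begin

lift_definition norm_cblinfun :: "('a, 'b) cblinfun \<Rightarrow> real" is norm .

lift_definition zero_cblinfun :: "('a, 'b) cblinfun" is 0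
  by (simp add: scaleC_zero)

lift_definition plus_cblinfun :: "('a, 'b) cblinfun \<Rightarrow> ('a, 'b) cblinfun \<Rightarrow> ('a, 'b) cblinfun"
  is "(+)" by (simp add: blinfun.add_left scaleC_add_right)

lift_definition minus_cblinfun :: "('a, 'b) cblinfun \<Rightarrow> ('a, 'b) cblinfun \<Rightarrow> ('a, 'b) cblinfun"
  is "(-)" by (simp add: blinfun.diff_left scaleC_diff_right)

lift_definition uminus_cblinfun :: "('a, 'b) cblinfun \<Rightarrow> ('a, 'b) cblinfun"
  is uminus by (simp add: blinfun.minus_left scaleC_minus_right)

lift_definition scaleR_cblinfun :: "real \<Rightarrow> ('a, 'b) cblinfun \<Rightarrow> ('a, 'b) cblinfun"
  is "(*\<^sub>R)" by (simp add: blinfun.scaleR_left scaleC_scaleR)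

lift_definition scaleC_cblinfun :: "complex \<Rightarrow> ('a, 'b) cblinfun \<Rightarrow> ('a, 'b) cblinfun"
  is "\<lambda>c f. blinfun_compose (Blinfun (\<lambda>x. c *\<^sub>C x)) f"
  by (simp add: bounded_linear_Blinfun_apply[OF bounded_linear_scaleC] scaleC_scaleC mult.commute)

definition dist_cblinfun :: "('a, 'b) cblinfun \<Rightarrow> ('a, 'b) cblinfun \<Rightarrow> real"
  where "dist_cblinfun S T = norm (S - T)"

definition sgn_cblinfun :: "('a, 'b) cblinfun \<Rightarrow> ('a, 'b) cblinfun"
  where "sgn_cblinfun T = inverse (norm T) *\<^sub>R T"

definition uniformity_cblinfun :: "(('a, 'b) cblinfun \<times> ('a, 'b) cblinfun) filter"
  where [code del]: "uniformity_cblinfun = (INF e\<in>{0 <..}. principal {(S, T). dist S T < e})"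

definition open_cblinfun :: "('a, 'b) cblinfun set \<Rightarrow> bool"
  where [code del]: "open_cblinfun U = (\<forall>S\<in>U. \<forall>\<^sub>F (S', T) in uniformity. S' = S \<longrightarrow> T \<in> U)"

instance
proof
  fix a b c :: "('a, 'b) cblinfun" and r s :: real and z w :: complex and U :: "('a, 'b) cblinfun set"
  show "a + b + c = a + (b + c)" by transfer (rule add.assoc)
  show "a + b = b + a" by transfer (rule add.commute)
  show "0 + a = a" by transfer simp
  show "- a + a = 0" by transfer simp
  show "a - b = a + - b" by transfer simp
  show "r *\<^sub>R (a + b) = r *\<^sub>R a + r *\<^sub>R b" by transfer (rule scaleR_add_right)
  show "(r + s) *\<^sub>R a = r *\<^sub>R a + s *\<^sub>R a" by transfer (rule scaleR_add_left)
  show "r *\<^sub>R s *\<^sub>R a = (r * s) *\<^sub>R a" by transfer simp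
  show "1 *\<^sub>R a = a" by transfer simp
  show "dist a b = norm (a - b)" by (rule dist_cblinfun_def)
  show "sgn a = inverse (norm a) *\<^sub>R a" by (rule sgn_cblinfun_def)
  show "uniformity = (INF e\<in>{0 <..}. principal {(S, T :: ('a, 'b) cblinfun). dist S T < e})"
    by (rule uniformity_cblinfun_def)
  show "open U = (\<forall>S\<in>U. \<forall>\<^sub>F (S', T) in uniformity. S' = S \<longrightarrow> T \<in> U)"
    by (rule open_cblinfun_def)
  show "(norm a = 0) = (a = 0)" by transfer simp
  show "norm (a + b) \<le> norm a + norm b" by transfer (rule norm_triangle_ineq)
  show "norm (r *\<^sub>R a) = \<bar>r\<bar> * norm a" by transfer simp
  note bl = bounded_linear_Blinfun_apply[OF bounded_linear_scaleC]
  show "z *\<^sub>C (a + b) = z *\<^sub>C a + z *\<^sub>C b"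
    by transfer (rule blinfun_eqI, simp add: bl blinfun.add_left scaleC_add_right)
  show "(z + w) *\<^sub>C a = z *\<^sub>C a + w *\<^sub>C a"
    by transfer (rule blinfun_eqI, simp add: bl blinfun.add_left scaleC_add_left)
  show "z *\<^sub>C w *\<^sub>C a = (z * w) *\<^sub>C a"
    by transfer (rule blinfun_eqI, simp add: bl scaleC_scaleC)
  show "complex_of_real r *\<^sub>C a = r *\<^sub>R a"
    by transfer (rule blinfun_eqI, simp add: bl blinfun.scaleR_left scaleC_of_real)
  show "norm (z *\<^sub>C a) = cmod z * norm a"
  proof (transfer fixing: z)
    fix f :: "'a \<Rightarrow>\<^sub>L 'b"
    show "norm (Blinfun ((*\<^sub>C) z) o\<^sub>L f) = cmod z * norm f"
    proof (cases "z = 0")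
      case True
      have "Blinfun ((*\<^sub>C) z) o\<^sub>L f = 0"
        by (rule blinfun_eqI) (metis True bl blinfun_apply_blinfun_compose norm_eq_zero norm_scaleC
            mult_eq_0_iff zero_blinfun.rep_eq norm_zero)
      then show ?thesis using True by simp
    next
      case False
      show ?thesis
      proof (rule antisym)
        show "norm (Blinfun ((*\<^sub>C) z) o\<^sub>L f) \<le> cmod z * norm f"
          by (rule norm_blinfun_bound)
            (simp_all add: bl norm_scaleC norm_blinfun mult_left_mono mult.assoc)
        have "norm f \<le> norm (Blinfun ((*\<^sub>C) z) o\<^sub>L f) / cmod z"
        proof (rule norm_blinfun_bound)
          fix x
          have "cmod z * norm (f x) \<le> norm (Blinfun ((*\<^sub>C) z) o\<^sub>L f) * norm x"
            using norm_blinfun[of "Blinfun ((*\<^sub>C) z) o\<^sub>L f" x] by (simp add: bl norm_scaleC)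
          then show "norm (f x) \<le> norm (Blinfun ((*\<^sub>C) z) o\<^sub>L f) / cmod z * norm x"
            using False by (simp add: field_simps)
        qed simp
        then show "cmod z * norm f \<le> norm (Blinfun ((*\<^sub>C) z) o\<^sub>L f)"
          using False by (simp add: field_simps)
      qed
    qed
  qed
qed

end

instance cblinfun :: (complex_normed_vector, complex_banach) complex_banach
proof
  fix X :: "nat \<Rightarrow> ('a, 'b) cblinfun"
  assume X: "Cauchy X"
  define F where "F n = blinfun_of_cblinfun (X n)" for n
  have dist_F: "dist (F m) (F n) = dist (X m) (X n)" for m n
    unfolding F_def dist_norm by transfer simp
  have "Cauchy F"
    using X unfolding Cauchy_def dist_F .
  then obtain G where G: "F \<longlonglongrightarrow> G"
    using Cauchy_convergent convergent_def by blast
  have Fx: "(\<lambda>n. F n x) \<longlonglongrightarrow> G x" for x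
    by (intro tendsto_intros G)
  have Gc: "G (c *\<^sub>C x) = c *\<^sub>C G x" for c x
  proof (rule LIMSEQ_unique[OF Fx])
    have "F n (c *\<^sub>C x) = c *\<^sub>C F n x" for n
      using blinfun_of_cblinfun[of "X n"] by (simp add: F_def)
    then show "(\<lambda>n. F n (c *\<^sub>C x)) \<longlonglongrightarrow> c *\<^sub>C G x"
      using bounded_linear.tendsto[OF bounded_linear_scaleC Fx] by simp
  qed
  have G': "blinfun_of_cblinfun (CBlinfun G) = G"
    using Gc by (simp add: CBlinfun_inverse)
  have "dist (X n) (CBlinfun G) = dist (F n) G" for n
    unfolding F_def dist_norm by (simp add: norm_cblinfun.rep_eq minus_cblinfun.rep_eq G')
  then have "X \<longlonglongrightarrow> CBlinfun G"
    using G by (simp add: tendsto_dist_iff[of X] tendsto_dist_iff[of F])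
  then show "convergent X"
    unfolding convergent_def by blast
qed


section \<open>Strong measurability and the Bochner integral\<close>

text \<open>The library's Bochner integral is restricted to second countable spaces. The following
  versions for arbitrary Banach spaces only replace Borel measurability by strong measurability.\<close>

definition strongly_measurable :: "'a measure \<Rightarrow> ('a \<Rightarrow> 'b::real_normed_vector) \<Rightarrow> bool" where
  "strongly_measurable M f \<longleftrightarrow>
     (\<exists>s. (\<forall>i. simple_function M (s i)) \<and> (\<forall>x\<in>space M. (\<lambda>i::nat. s i x) \<longlonglongrightarrow> f x))"

definition has_Bochner_integral :: "'a measure \<Rightarrow> ('a \<Rightarrow> 'b::real_normed_vector) \<Rightarrow> 'b \<Rightarrow> bool" where
  "has_Bochner_integral M f I \<longleftrightarrow>
     strongly_measurable M f \<and>
     (\<exists>s. (\<forall>i::nat. Bochner_Integration.simple_bochner_integrable M (s i)) \<and>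
          (\<lambda>i. \<integral>\<^sup>+x. ennreal (norm (f x - s i x)) \<partial>M) \<longlonglongrightarrow> 0 \<and>
          (\<lambda>i. Bochner_Integration.simple_bochner_integral M (s i)) \<longlonglongrightarrow> I)"

definition Bochner_integral :: "'a measure \<Rightarrow> ('a \<Rightarrow> 'b::real_normed_vector) \<Rightarrow> 'b" where
  "Bochner_integral M f =
     (if \<exists>I. has_Bochner_integral M f I then THE I. has_Bochner_integral M f I else 0)"

lemma strongly_measurable_norm_diff_simple:
  assumes "strongly_measurable M f" "simple_function M t"
  shows "(\<lambda>x. norm (f x - t x)) \<in> borel_measurable M"
proof -
  from assms(1) obtain s where s: "\<And>i. simple_function M (s i)"
    "\<And>x. x \<in> space M \<Longrightarrow> (\<lambda>i::nat. s i x) \<longlonglongrightarrow> f x"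
    unfolding strongly_measurable_def by blast
  show ?thesis
  proof (rule borel_measurable_LIMSEQ_real)
    show "(\<lambda>i. norm (s i x - t x)) \<longlonglongrightarrow> norm (f x - t x)" if "x \<in> space M" for x
      by (intro tendsto_intros s that)
    show "(\<lambda>x. norm (s i x - t x)) \<in> borel_measurable M" for i
      using simple_function_compose2[OF s(1)[of i] assms(2), of "\<lambda>a b. norm (a - b)"]
      by (rule borel_measurable_simple_function)
  qed
qed

lemma has_Bochner_integral_unique:
  assumes "has_Bochner_integral M f I" "has_Bochner_integral M f J"
  shows "I = J"
proof -
  from assms(1) obtain s where f: "strongly_measurable M f"
    and s: "\<And>i::nat. Bochner_Integration.simple_bochner_integrable M (s i)"
    and s0: "(\<lambda>i. \<integral>\<^sup>+x. ennreal (norm (f x - s i x)) \<partial>M) \<longlonglongrightarrow> 0"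
    and sI: "(\<lambda>i. Bochner_Integration.simple_bochner_integral M (s i)) \<longlonglongrightarrow> I"
    unfolding has_Bochner_integral_def by blast
  from assms(2) obtain t where t: "\<And>i::nat. Bochner_Integration.simple_bochner_integrable M (t i)"
    and t0: "(\<lambda>i. \<integral>\<^sup>+x. ennreal (norm (f x - t i x)) \<partial>M) \<longlonglongrightarrow> 0"
    and tJ: "(\<lambda>i. Bochner_Integration.simple_bochner_integral M (t i)) \<longlonglongrightarrow> J"
    unfolding has_Bochner_integral_def by blast
  let ?D = "\<lambda>i. norm (Bochner_Integration.simple_bochner_integral M (s i) - Bochner_Integration.simple_bochner_integral M (t i))"
  have meas: "(\<lambda>x. norm (f x - s i x)) \<in> borel_measurable M"
    "(\<lambda>x. norm (f x - t i x)) \<in> borel_measurable M" for i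
    using s[of i] t[of i]
    by (auto intro: strongly_measurable_norm_diff_simple[OF f]
        elim: Bochner_Integration.simple_bochner_integrable.cases)
  have "ennreal (?D i) \<le> (\<integral>\<^sup>+x. ennreal (norm (f x - s i x)) \<partial>M) + (\<integral>\<^sup>+x. ennreal (norm (f x - t i x)) \<partial>M)" for i
  proof -
    have "ennreal (?D i) = norm (Bochner_Integration.simple_bochner_integral M (\<lambda>x. s i x - t i x))"
      using s t by (subst simple_bochner_integral_diff) auto
    also have "\<dots> \<le> Bochner_Integration.simple_bochner_integral M (\<lambda>x. norm (s i x - t i x))"
      using simple_bochner_integrable_compose2[of "(-)" M "s i" "t i"] s t
      by (auto intro!: simple_bochner_integral_norm_bound)
    also have "\<dots> = (\<integral>\<^sup>+x. norm (s i x - t i x) \<partial>M)"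
      using simple_bochner_integrable_compose2[of "\<lambda>x y. norm (x - y)" M "s i" "t i"] s t
      by (auto intro!: simple_bochner_integral_eq_nn_integral)
    also have "\<dots> \<le> (\<integral>\<^sup>+x. ennreal (norm (f x - s i x)) + ennreal (norm (f x - t i x)) \<partial>M)"
    proof (rule nn_integral_mono)
      fix x
      have "norm (s i x - t i x) \<le> norm (f x - s i x) + norm (f x - t i x)"
        by (metis dual_order.refl norm_diff_triangle_le norm_minus_commute)
      then show "ennreal (norm (s i x - t i x)) \<le> ennreal (norm (f x - s i x)) + ennreal (norm (f x - t i x))"
        by (metis ennreal_leI ennreal_plus norm_ge_zero)
    qed
    also have "\<dots> = (\<integral>\<^sup>+x. ennreal (norm (f x - s i x)) \<partial>M) + (\<integral>\<^sup>+x. ennreal (norm (f x - t i x)) \<partial>M)"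
      using meas by (intro nn_integral_add) auto
    finally show ?thesis .
  qed
  then have *: "\<forall>\<^sub>F i in sequentially. ennreal (?D i) \<le>
      (\<integral>\<^sup>+x. ennreal (norm (f x - s i x)) \<partial>M) + (\<integral>\<^sup>+x. ennreal (norm (f x - t i x)) \<partial>M)"
    by (intro always_eventually allI)
  have "(\<lambda>i. ennreal (?D i)) \<longlonglongrightarrow> 0"
  proof (rule tendsto_sandwich[OF _ *])
    show "\<forall>\<^sub>F i in sequentially. 0 \<le> ennreal (?D i)" "(\<lambda>_. 0::ennreal) \<longlonglongrightarrow> 0"
      by simp_all
    show "(\<lambda>i. (\<integral>\<^sup>+x. ennreal (norm (f x - s i x)) \<partial>M) + (\<integral>\<^sup>+x. ennreal (norm (f x - t i x)) \<partial>M))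
        \<longlonglongrightarrow> 0"
      using tendsto_add[OF s0 t0] by simp
  qed
  then have "?D \<longlonglongrightarrow> 0"
    by (simp flip: ennreal_0)
  moreover have "?D \<longlonglongrightarrow> norm (I - J)"
    by (intro tendsto_intros sI tJ)
  ultimately have "norm (I - J) = 0"
    by (rule LIMSEQ_unique[symmetric])
  then show ?thesis
    by simp
qed

lemma Bochner_integral_eq: "has_Bochner_integral M f I \<Longrightarrow> Bochner_integral M f = I"
  unfolding Bochner_integral_def using has_Bochner_integral_unique by (metis the_equality)

definition X_strongly_measurable ::
    "('d::euclidean_space \<Rightarrow> ('x::complex_normed_vector, 'y::complex_normed_vector) cblinfun) \<Rightarrow> bool" where
  "X_strongly_measurable m \<longleftrightarrow> (\<forall>x. strongly_measurable lborel (\<lambda>\<xi>. cblinfun_apply (m \<xi>) x))"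

definition in_Lp :: "real \<Rightarrow> ('d::euclidean_space \<Rightarrow> 'x::real_normed_vector) \<Rightarrow> bool" where
  "in_Lp p f \<longleftrightarrow> strongly_measurable lborel f \<and> integrable lborel (\<lambda>t. norm (f t) powr p)"

definition Lp_norm :: "real \<Rightarrow> ('d::euclidean_space \<Rightarrow> 'x::real_normed_vector) \<Rightarrow> real" where
  "Lp_norm p f = (\<integral>t. norm (f t) powr p \<partial>lborel) powr (1 / p)"


section \<open>Gaussian sums, type, cotype and gamma-boundedness\<close>

text \<open>Real and imaginary part of a standard complex Gaussian are independent, centred and Gaussian with
  variance \<open>1/2\<close>, that is, with standard deviation \<open>1 / sqrt 2\<close>.\<close>

definition std_complex_gaussian :: "complex measure" where
  "std_complex_gaussian =
     distr (density lborel (\<lambda>x. ennreal (normal_density 0 (1 / sqrt 2) x)) \<Otimes>\<^sub>M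
            density lborel (\<lambda>x. ennreal (normal_density 0 (1 / sqrt 2) x)))
       borel (\<lambda>(x, y). Complex x y)"

lemma prob_space_std_complex_gaussian: "prob_space std_complex_gaussian"
proof -
  let ?N = "density lborel (\<lambda>x. ennreal (normal_density 0 (1 / sqrt 2) x))"
  interpret N: prob_space ?N
    by (rule prob_space_normal_density) simp
  interpret NN: pair_prob_space ?N ?N ..
  have "(\<lambda>(x, y). Complex x y) \<in> ?N \<Otimes>\<^sub>M ?N \<rightarrow>\<^sub>M borel"
    unfolding Complex_eq by measurable
  then show ?thesis
    unfolding std_complex_gaussian_def by (rule NN.prob_space_distr)
qed

text \<open>The coordinates of the product space are a sequence of independent standard complex Gaussians.\<close>

definition gaussian_space :: "(nat \<Rightarrow> complex) measure" where
  "gaussian_space = PiM UNIV (\<lambda>_. std_complex_gaussian)"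

definition gaussian_norm :: "nat \<Rightarrow> (nat \<Rightarrow> 'a::complex_normed_vector) \<Rightarrow> real" where
  "gaussian_norm n x =
     sqrt (\<integral>\<gamma>. (norm (\<Sum>k<n. \<gamma> k *\<^sub>C x k))\<^sup>2 \<partial>gaussian_space)"

definition has_type :: "'a::complex_banach itself \<Rightarrow> real \<Rightarrow> bool" where
  "has_type TYPE('a) s \<longleftrightarrow> 1 \<le> s \<and> s \<le> 2 \<and>
     (\<exists>C. \<forall>n. \<forall>x :: nat \<Rightarrow> 'a. gaussian_norm n x \<le> C * (\<Sum>k<n. norm (x k) powr s) powr (1 / s))"

definition has_cotype :: "'a::complex_banach itself \<Rightarrow> real \<Rightarrow> bool" where
  "has_cotype TYPE('a) s \<longleftrightarrow> 2 \<le> s \<and>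
     (\<exists>C. \<forall>n. \<forall>x :: nat \<Rightarrow> 'a. (\<Sum>k<n. norm (x k) powr s) powr (1 / s) \<le> C * gaussian_norm n x)"

definition gamma_bounded ::
    "('x::complex_banach, 'y::complex_banach) cblinfun set \<Rightarrow> bool" where
  "gamma_bounded \<T> \<longleftrightarrow>
     (\<exists>C\<ge>0. \<forall>n T x. (\<forall>k<n. T k \<in> \<T>) \<longrightarrow>
        gaussian_norm n (\<lambda>k. cblinfun_apply (T k) (x k)) \<le> C * gaussian_norm n x)"


section \<open>Schwartz functions and Fourier multipliers\<close>

primrec iterated_partial ::
    "'d::finite list \<Rightarrow> (real ^ 'd \<Rightarrow> 'x::real_normed_vector) \<Rightarrow> real ^ 'd \<Rightarrow> 'x" where
  "iterated_partial [] f = f"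
| "iterated_partial (j # js) f =
     (\<lambda>t. frechet_derivative (iterated_partial js f) (at t) (axis j 1))"

definition schwartz :: "(real ^ 'd::finite \<Rightarrow> 'x::real_normed_vector) \<Rightarrow> bool" where
  "schwartz f \<longleftrightarrow>
     (\<forall>js. (\<forall>t. iterated_partial js f differentiable (at t)) \<and>
           (\<forall>N::nat. \<exists>C. \<forall>t. norm t ^ N * norm (iterated_partial js f t) \<le> C))"

definition fourier :: "(real ^ 'd::finite \<Rightarrow> 'x::complex_banach) \<Rightarrow> real ^ 'd \<Rightarrow> 'x" where
  "fourier f \<xi> = Bochner_integral lborel (\<lambda>t. exp (- 2 * pi * \<i> * complex_of_real (\<xi> \<bullet> t)) *\<^sub>C f t)"

definition inv_fourier :: "(real ^ 'd::finite \<Rightarrow> 'x::complex_banach) \<Rightarrow> real ^ 'd \<Rightarrow> 'x" where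
  "inv_fourier f t = Bochner_integral lborel (\<lambda>\<xi>. exp (2 * pi * \<i> * complex_of_real (t \<bullet> \<xi>)) *\<^sub>C f \<xi>)"

text \<open>A vector-valued tempered distribution is given by its values on scalar Schwartz functions;
  its values elsewhere are irrelevant.\<close>

type_synonym ('d, 'y) distribution = "(real ^ 'd \<Rightarrow> complex) \<Rightarrow> 'y"

definition distribution_of :: "(real ^ 'd::finite \<Rightarrow> 'y::complex_banach) \<Rightarrow> ('d, 'y) distribution" where
  "distribution_of g \<phi> = Bochner_integral lborel (\<lambda>t. \<phi> t *\<^sub>C g t)"

definition inv_fourier_distribution :: "('d::finite, 'y::complex_banach) distribution \<Rightarrow> ('d, 'y) distribution" where
  "inv_fourier_distribution u \<phi> = u (inv_fourier \<phi>)"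

definition fourier_multiplier ::
    "(real ^ 'd::finite \<Rightarrow> ('x::complex_banach, 'y::complex_banach) cblinfun) \<Rightarrow>
      (real ^ 'd \<Rightarrow> 'x) \<Rightarrow> ('d, 'y) distribution" where
  "fourier_multiplier m f =
     inv_fourier_distribution (distribution_of (\<lambda>\<xi>. cblinfun_apply (m \<xi>) (fourier f \<xi>)))"

definition multiplier_bounded ::
    "real \<Rightarrow> real \<Rightarrow> (real ^ 'd::finite \<Rightarrow> ('x::complex_banach, 'y::complex_banach) cblinfun) \<Rightarrow> bool" where
  "multiplier_bounded p q m \<longleftrightarrow>
     (\<exists>C. \<forall>f. schwartz f \<longrightarrow>
        (\<exists>g. in_Lp q g \<and>
             (\<forall>\<phi>. schwartz \<phi> \<longrightarrow> fourier_multiplier m f \<phi> = distribution_of g \<phi>) \<and>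
             Lp_norm q g \<le> C * Lp_norm p f))"

text \<open>Powers of nonnegative reals with \<open>0\<^sup>0 = 1\<close>, whereas \<open>0 powr 0 = 0\<close>.\<close>

definition rpow :: "real \<Rightarrow> real \<Rightarrow> real" where
  "rpow a e = (if e = 0 then 1 else a powr e)"

end

theory Submission
  imports Defs
begin

text \<open>Gaussian test functions transfer the multiplier problem to the torus: if \<open>m\<close> equals \<open>\<mu>\<close>, up to a
  Gaussian factor, on a period cell away from the origin and vanishes elsewhere, then boundedness of \<open>T\<^sub>m\<close>
  bounds the discrete multiplier \<open>x \<mapsto> (\<integral> e\<^sub>j \<mu> (\<Sum>k. e\<^sub>k x\<^sub>k))\<^sub>j\<close> from \<open>\<ell>\<^sup>p(X)\<close> to \<open>\<ell>\<^sup>q(Y)\<close>. In each of the three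
  cases \<open>X\<close> has cotype 2 and \<open>Y\<close> has type 2, so every bounded set of operators is \<open>\<gamma>\<close>-bounded, \<open>\<mu>\<close> may be
  any bounded function, and by uniform boundedness the bound depends only on the supremum of \<open>\<mu>\<close>.
  Let \<open>F = \<Sum>k. e\<^sub>k x\<^sub>k\<close>. A \<open>\<mu>\<close> that norms \<open>F\<close> pointwise (in (1), paired with a trigonometric polynomial
  close to the norm of \<open>F\<close>; in (3), of the form \<open>\<nu> \<otimes> \<nu>\<close>) estimates the \<open>L\<^sup>2\<close>-norm of \<open>F\<close> by the \<open>\<ell>\<^sup>p\<close>-norm of \<open>x\<close>.
  In (2), \<open>\<mu> = F / \<parallel>F\<parallel>\<close>, applied to a polynomial close to \<open>\<parallel>F\<parallel>\<close>, gives the reverse estimate with \<open>q\<close>.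
  Replacing \<open>x\<^sub>k\<close> by \<open>\<gamma>\<^sub>k x\<^sub>k\<close> and averaging turns the \<open>L\<^sup>2\<close>-norm into the Gaussian norm, because the law of \<open>\<gamma>\<^sub>k\<close>
  is invariant under rotations.\<close>

section \<open>Norming functionals\<close>

text \<open>Two obstacles shape the argument. The hypothesis gives one constant for each multiplier
  and says nothing about how it depends on the multiplier; only a uniform boundedness argument makes
  the constants comparable. And the spaces need not be separable, so a pointwise choice of norming
  functionals may fail to be measurable. The character sum F depends on the frequency only through a
  point of the circle, so its range is compact and it lies within \<delta> of a simple function S.
  Functionals are chosen for the values of S, and \<delta> tends to zero at the end. This is why the
  uniform bound is stated for simple multipliers. Gaussians serve as test functions because their
  transform is explicit and has no zeros, so it can be divided out on the cell, and because their
  integer translates along an axis have a uniformly bounded sum, so that L^p norms are controlled by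
  ell^p norms. In the averaging step p \<le> 2 \<le> q enters through Jensen's inequality with
  exponents 2/p and q/2, which leaves only second moments of the Gaussians.\<close>

definition sublinear :: "('a::real_vector \<Rightarrow> real) \<Rightarrow> bool" where
  "sublinear p \<longleftrightarrow> (\<forall>x y. p (x + y) \<le> p x + p y) \<and> (\<forall>x. \<forall>c>0. p (c *\<^sub>R x) = c * p x)"

lemma sublinear_add: "sublinear p \<Longrightarrow> p (x + y) \<le> p x + p y"
  and sublinear_scale_pos: "sublinear p \<Longrightarrow> c > 0 \<Longrightarrow> p (c *\<^sub>R x) = c * p x"
  by (auto simp: sublinear_def)

lemma sublinear_0: "sublinear p \<Longrightarrow> p 0 = 0"
  using sublinear_scale_pos[of p 2 0] by simp

lemma sublinear_scale: "sublinear p \<Longrightarrow> c \<ge> 0 \<Longrightarrow> p (c *\<^sub>R x) = c * p x"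
  by (cases "c = 0") (auto simp: sublinear_0 sublinear_scale_pos)

lemma sublinear_minus: "sublinear p \<Longrightarrow> - p (- x) \<le> p x"
  using sublinear_add[of p x "- x"] sublinear_0[of p] by simp

text \<open>The Hahn--Banach theorem without partially defined functionals: a minimal sublinear functional \<open>p\<close>
  agrees with its sublinear minorant \<open>ray_reduct p y\<close> for every \<open>y\<close>, and this makes \<open>p\<close> additive.\<close>

definition ray_reduct :: "('a::real_vector \<Rightarrow> real) \<Rightarrow> 'a \<Rightarrow> 'a \<Rightarrow> real" where
  "ray_reduct p y x = (INF t\<in>{0..}. p (x + t *\<^sub>R y) - t * p y)"

lemma ray_reduct_le:
  assumes "sublinear p" "t \<ge> 0"
  shows "ray_reduct p y x \<le> p (x + t *\<^sub>R y) - t * p y"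
proof -
  \<comment> \<open>Subadditivity for s y = (x + s y) + (- x) bounds the family from below, so the
    infimum is a genuine one.\<close>
  have "- p (- x) \<le> p (x + s *\<^sub>R y) - s * p y" if "s \<ge> 0" for s
    using sublinear_add[OF assms(1), of "x + s *\<^sub>R y" "- x"] sublinear_scale[OF assms(1) that, of y]
    by simp
  then have "bdd_below ((\<lambda>t. p (x + t *\<^sub>R y) - t * p y) ` {0..})"
    by (intro bdd_belowI2) auto
  then show ?thesis
    unfolding ray_reduct_def using assms(2) by (intro cINF_lower) auto
qed

lemma ray_reduct_greatest:
  assumes "\<And>t. t \<ge> 0 \<Longrightarrow> c \<le> p (x + t *\<^sub>R y) - t * p y"
  shows "c \<le> ray_reduct p y x"
  unfolding ray_reduct_def by (rule cINF_greatest) (use assms in auto)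

text \<open>Parameters \<open>s\<close> for \<open>a\<close> and \<open>t\<close> for
  \<open>b\<close> combine to \<open>s + t\<close> for \<open>a + b\<close>. Rescaling
  \<open>t\<close> to \<open>t / d\<close> gives one half of homogeneity, and applying that half to
  \<open>inverse c\<close> gives the other.\<close>

lemma sublinear_ray_reduct:
  assumes p: "sublinear p"
  shows "sublinear (ray_reduct p y)"
proof -
  have "ray_reduct p y (a + b) \<le> ray_reduct p y a + ray_reduct p y b" for a b
  proof -
    have *: "ray_reduct p y (a + b) \<le> (p (a + s *\<^sub>R y) - s * p y) + (p (b + t *\<^sub>R y) - t * p y)"
      if "s \<ge> 0" "t \<ge> 0" for s t
      using ray_reduct_le[OF p, of "s + t" y "a + b"] that
        sublinear_add[OF p, of "a + s *\<^sub>R y" "b + t *\<^sub>R y"]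
      by (simp add: algebra_simps)
    have "ray_reduct p y (a + b) - (p (b + t *\<^sub>R y) - t * p y) \<le> ray_reduct p y a" if "t \<ge> 0" for t
      by (rule ray_reduct_greatest) (use *[OF _ that] in \<open>simp add: algebra_simps\<close>)
    then have "ray_reduct p y (a + b) - ray_reduct p y a \<le> ray_reduct p y b"
      by (intro ray_reduct_greatest) (simp add: algebra_simps)
    then show ?thesis by simp
  qed
  moreover have "ray_reduct p y (c *\<^sub>R a) = c * ray_reduct p y a" if c: "c > 0" for c a
  proof -
    have le: "d * ray_reduct p y a \<le> ray_reduct p y (d *\<^sub>R a)" if d: "d > 0" for d a
    proof (rule ray_reduct_greatest)
      fix t :: real assume t: "t \<ge> 0"
      have "d * ray_reduct p y a \<le> d * (p (a + (t / d) *\<^sub>R y) - (t / d) * p y)"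
        using d t by (intro mult_left_mono ray_reduct_le[OF p]) auto
      also have "\<dots> = p (d *\<^sub>R (a + (t / d) *\<^sub>R y)) - t * p y"
        using d by (simp add: sublinear_scale_pos[OF p] right_diff_distrib)
      finally show "d * ray_reduct p y a \<le> p (d *\<^sub>R a + t *\<^sub>R y) - t * p y"
        using d by (simp add: scaleR_add_right)
    qed
    have "inverse c * ray_reduct p y (c *\<^sub>R a) \<le> ray_reduct p y a"
      using le[of "inverse c" "c *\<^sub>R a"] c by simp
    then show ?thesis
      using le[OF c, of a] c by (simp add: field_simps)
  qed
  ultimately show ?thesis by (auto simp: sublinear_def)
qed

lemma ray_reduct_le_self: "sublinear p \<Longrightarrow> ray_reduct p y x \<le> p x"
  using ray_reduct_le[of p 0 y x] by simp

lemma exists_linear_below_sublinear: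
  assumes q: "sublinear (q :: 'a::real_vector \<Rightarrow> real)"
  shows "\<exists>f. linear f \<and> (\<forall>x. f x \<le> q x)"
proof -
  define A where "A = {p. sublinear p \<and> p \<le> q}"
  have "\<exists>p\<in>A. \<forall>p'\<in>A. p' \<le> p \<longrightarrow> p' = p"
  \<comment> \<open>The order is reversed, so the maximal element from Zorn's lemma is a minimal
    sublinear functional below \<open>q\<close>.\<close>
  proof (rule predicate_Zorn[of A "\<lambda>f g. g \<le> f"])
    show "partial_order_on A (relation_of (\<lambda>f g. g \<le> f) A)"
      by (rule partial_order_on_relation_ofI) auto
    fix C assume C: "C \<in> Chains (relation_of (\<lambda>f g. g \<le> f) A)"
    then have CA: "C \<subseteq> A"
      by (auto simp: Chains_def relation_of_def)
    have tot: "f \<le> g \<or> g \<le> f" if "f \<in> C" "g \<in> C" for f g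
      using C that by (auto simp: Chains_def relation_of_def)
    show "\<exists>u\<in>A. \<forall>a\<in>C. u \<le> a"
    proof (cases "C = {}")
      case True
      then show ?thesis using q by (auto simp: A_def)
    next
      case False
      \<comment> \<open>The infimum is finite because every member is at least
        \<open>- q (- x)\<close>, and subadditive because of any two members of a chain the smaller
        one serves for both summands.\<close>
      define u where "u x = (INF f\<in>C. f x)" for x
      have bdd: "bdd_below ((\<lambda>f. f x) ` C)" for x
      proof (rule bdd_belowI2)
        fix f assume "f \<in> C"
        then have f: "sublinear f" "f \<le> q" using CA by (auto simp: A_def)
        show "- q (- x) \<le> f x"
          using sublinear_minus[OF f(1), of x] le_funD[OF f(2), of "- x"] by simp
      qed
      have lower: "u x \<le> f x" if "f \<in> C" for f x
        unfolding u_def by (rule cINF_lower[OF bdd that])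
      have greatest: "c \<le> u x" if "\<And>f. f \<in> C \<Longrightarrow> c \<le> f x" for c x
        unfolding u_def by (rule cINF_greatest[OF False that])
      have "u (x + y) \<le> u x + u y" for x y
      proof -
        have *: "u (x + y) \<le> f x + g y" if fg: "f \<in> C" "g \<in> C" for f g
        proof -
          obtain h where h: "h \<in> C" "h \<le> f" "h \<le> g"
            using tot[OF fg] fg by blast
          then have "sublinear h" using CA by (auto simp: A_def)
          then show ?thesis
            using lower[OF h(1), of "x + y"] sublinear_add[of h x y] le_funD[OF h(2), of x] le_funD[OF h(3), of y]
            by linarith
        qed
        have "u (x + y) - g y \<le> u x" if "g \<in> C" for g
          by (rule greatest) (use *[OF _ that] in \<open>simp add: algebra_simps\<close>)
        then have "u (x + y) - u x \<le> u y"
          by (intro greatest) (simp add: algebra_simps)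
        then show ?thesis by simp
      qed
      moreover have "u (c *\<^sub>R x) = c * u x" if c: "c > 0" for c x
      proof -
        have le: "d * u x \<le> u (d *\<^sub>R x)" if d: "d > 0" for d x
        proof (rule greatest)
          fix f assume f: "f \<in> C"
          then have "sublinear f" using CA by (auto simp: A_def)
          then show "d * u x \<le> f (d *\<^sub>R x)"
            using lower[OF f, of x] d by (simp add: sublinear_scale_pos)
        qed
        have "inverse c * u (c *\<^sub>R x) \<le> u x"
          using le[of "inverse c" "c *\<^sub>R x"] c by simp
        then show ?thesis using le[OF c, of x] c by (simp add: field_simps)
      qed
      ultimately have "sublinear u" by (auto simp: sublinear_def)
      moreover have "u \<le> q"
      proof -
        obtain f where f: "f \<in> C" using False by blast
        then have "f \<le> q" using CA by (auto simp: A_def)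
        then show ?thesis using lower[OF f] by (auto simp: le_fun_def intro: order_trans)
      qed
      ultimately show ?thesis using lower by (auto simp: A_def le_fun_def)
    qed
  qed
  then obtain p where p: "sublinear p" "p \<le> q"
    and min: "\<And>p'. sublinear p' \<Longrightarrow> p' \<le> q \<Longrightarrow> p' \<le> p \<Longrightarrow> p' = p"
    by (auto simp: A_def)
  have "p x + p y \<le> p (x + y)" for x y
  proof -
    \<comment> \<open>Minimality identifies the minorant with \<open>p\<close>; \<open>t = 1\<close>
      in its defining infimum is then the missing superadditivity.\<close>
    have "ray_reduct p y = p"
      using ray_reduct_le_self[OF p(1)] p(2)
      by (intro min sublinear_ray_reduct p) (auto simp: le_fun_def intro: order_trans)
    then show ?thesis using ray_reduct_le[OF p(1), of 1 y x] by simp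
  qed
  then have add: "p (x + y) = p x + p y" for x y
    using sublinear_add[OF p(1), of x y] by (simp add: antisym)
  have minus: "p (- x) = - p x" for x
    using add[of x "- x"] sublinear_0[OF p(1)] by simp
  have "p (c *\<^sub>R x) = c *\<^sub>R p x" for c x
  proof (cases "c \<ge> 0")
    case False
    then have "p (- c *\<^sub>R x) = - c * p x" by (intro sublinear_scale[OF p(1)]) simp
    then show ?thesis using minus[of "c *\<^sub>R x"] by simp
  qed (simp add: sublinear_scale[OF p(1)])
  then have "linear p" by (intro linearI add)
  then show ?thesis using p(2) by (auto simp: le_fun_def)
qed

section \<open>Complex-linear functionals and operators\<close>

lemma scaleC_one: "1 *\<^sub>C x = (x :: 'a::complex_normed_vector)"
  using scaleC_of_real[of 1 x] by simp

lemma scaleC_zero_left: "0 *\<^sub>C x = (0 :: 'a::complex_normed_vector)"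
  using scaleC_of_real[of 0 x] by simp

lemma scaleC_Complex: "c *\<^sub>C x = Re c *\<^sub>R x + Im c *\<^sub>R (\<i> *\<^sub>C (x :: 'a::complex_normed_vector))"
proof -
  have "c *\<^sub>C x = (complex_of_real (Re c) + complex_of_real (Im c) * \<i>) *\<^sub>C x"
    by (metis complex_eq mult.commute)
  also have "\<dots> = complex_of_real (Re c) *\<^sub>C x + complex_of_real (Im c) *\<^sub>C (\<i> *\<^sub>C x)"
    by (simp only: scaleC_add_left scaleC_scaleC)
  finally show ?thesis by (simp only: scaleC_of_real)
qed

lemma cblinfun_apply_scaleC: "cblinfun_apply T (c *\<^sub>C x) = c *\<^sub>C cblinfun_apply T x"
  by transfer simp

lemma norm_cblinfun_apply: "norm (cblinfun_apply T x) \<le> norm T * norm x"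
  by transfer (rule norm_blinfun)

lemma cblinfun_apply_CBlinfun:
  assumes "bounded_linear f" "\<And>c x. f (c *\<^sub>C x) = c *\<^sub>C f x"
  shows "cblinfun_apply (CBlinfun (Blinfun f)) = f"
  using assms by (simp add: cblinfun_apply.rep_eq CBlinfun_inverse bounded_linear_Blinfun_apply)

lemma norm_CBlinfun_le:
  assumes "bounded_linear f" "\<And>c x. f (c *\<^sub>C x) = c *\<^sub>C f x" "\<And>x. norm (f x) \<le> K * norm x" "K \<ge> 0"
  shows "norm (CBlinfun (Blinfun f)) \<le> K"
  using assms
  by (auto simp: norm_cblinfun.rep_eq CBlinfun_inverse bounded_linear_Blinfun_apply intro!: norm_blinfun_bound)

text \<open>Dominating by \<open>ray_reduct norm (- a)\<close> instead of \<open>norm\<close> builds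
  the norming condition into the real Hahn--Banach step: at \<open>t = 1\<close> its value at
  \<open>a\<close> is at most \<open>- norm a\<close>, so minus the functional attains the norm
  there.\<close>

lemma exists_norming_functional:
  fixes a :: "'a::complex_normed_vector"
  shows "\<exists>\<nu> :: ('a, complex) cblinfun. norm \<nu> \<le> 1 \<and> cblinfun_apply \<nu> a = of_real (norm a)"
proof -
  have norm_sub: "sublinear (norm :: 'a \<Rightarrow> real)"
    by (auto simp: sublinear_def norm_triangle_ineq)
  obtain f :: "'a \<Rightarrow> real" where f: "linear f" and f_le: "\<And>x. f x \<le> ray_reduct norm (- a) x"
    using exists_linear_below_sublinear[OF sublinear_ray_reduct[OF norm_sub]] by blast
  interpret f: linear f by fact
  have f_norm: "f x \<le> norm x" for x
    using f_le[of x] ray_reduct_le_self[OF norm_sub, of "- a" x] by simp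
  have "f a \<le> - norm a + norm (a - a)"
    using f_le[of a] ray_reduct_le[OF norm_sub, of 1 "- a" a] by simp
  then have *: "f a \<le> - norm a" by simp
  define g where "g x = - f x" for x
  have g_norm: "g x \<le> norm x" for x
    using f_norm[of "- x"] by (simp add: g_def f.neg)
  have g_add: "g (x + y) = g x + g y" and g_scale: "g (c *\<^sub>R x) = c * g x" for x y c
    by (auto simp: g_def f.add f.scale)
  have ga: "g a = norm a"
    using * g_norm[of a] by (simp add: g_def)
  \<comment> \<open>The complex functional whose real part is \<open>g\<close>.\<close>
  define h where "h x = Complex (g x) (- g (\<i> *\<^sub>C x))" for x
  have h_add: "h (x + y) = h x + h y" for x y
    by (simp add: h_def scaleC_add_right g_add complex_eq_iff)
  have h_scaleR: "h (r *\<^sub>R x) = r *\<^sub>R h x" for r x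
    by (simp add: h_def scaleC_scaleR g_scale complex_eq_iff)
  have h_ii: "h (\<i> *\<^sub>C x) = \<i> * h x" for x
  proof -
    have "\<i> *\<^sub>C (\<i> *\<^sub>C x) = (-1) *\<^sub>R x"
      using scaleC_of_real[of "-1" x] by (simp add: scaleC_scaleC)
    then show ?thesis by (simp only: h_def g_scale) (simp add: complex_eq_iff)
  qed
  have h_scaleC: "h (c *\<^sub>C x) = c *\<^sub>C h x" for c x
  proof -
    have "h (c *\<^sub>C x) = Re c *\<^sub>R h x + Im c *\<^sub>R (\<i> * h x)"
      by (subst scaleC_Complex) (simp only: h_add h_scaleR h_ii)
    also have "\<dots> = c * h x" by (simp add: complex_eq_iff)
    finally show ?thesis by (simp add: scaleC_complex_def)
  qed
  have h_norm: "norm (h x) \<le> norm x" for x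
  proof (cases "h x = 0")
    case False
    \<comment> \<open>Rotating by this phase makes the value real and nonnegative, so the bound on
      the real part \<open>g\<close> carries over to the modulus.\<close>
    define c where "c = cnj (h x) / of_real (norm (h x))"
    have c: "cmod c = 1" using False by (simp add: c_def norm_divide)
    have "h (c *\<^sub>C x) = of_real (norm (h x))"
      using False by (simp add: h_scaleC scaleC_complex_def c_def field_simps complex_norm_square[symmetric] power2_eq_square)
    then have "norm (h x) = Re (h (c *\<^sub>C x))" by simp
    also have "\<dots> = g (c *\<^sub>C x)" by (simp add: h_def)
    also have "\<dots> \<le> norm x" using g_norm[of "c *\<^sub>C x"] by (simp add: norm_scaleC c)
    finally show ?thesis .
  qed simp
  have bl: "bounded_linear h"
    by (rule bounded_linear_intro[of h 1]) (auto simp: h_add h_scaleR h_norm)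
  have Re_ha: "Re (h a) = norm a" by (simp add: h_def ga)
  \<comment> \<open>The real part already exhausts the norm, which leaves no room for an imaginary
    part.\<close>
  have "(Re (h a))\<^sup>2 + (Im (h a))\<^sup>2 \<le> (norm a)\<^sup>2"
    using power_mono[OF h_norm[of a], of 2] by (simp add: cmod_power2)
  then have "h a = of_real (norm a)"
    using Re_ha by (simp add: complex_eq_iff)
  then show ?thesis
    using cblinfun_apply_CBlinfun[OF bl h_scaleC] norm_CBlinfun_le[OF bl h_scaleC, of 1] h_norm
    by (intro exI[of _ "CBlinfun (Blinfun h)"]) auto
qed

section \<open>The Bochner integral\<close>

lemma bounded_bilinear_scaleC:
  "bounded_bilinear (\<lambda>c (x :: 'a::complex_normed_vector). c *\<^sub>C x)"
proof
  show "(r *\<^sub>R c) *\<^sub>C x = r *\<^sub>R (c *\<^sub>C x)" for r c and x :: 'a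
    by (metis scaleC_of_real scaleC_scaleC scaleR_conv_of_real)
  show "\<exists>K. \<forall>c (x :: 'a). norm (c *\<^sub>C x) \<le> norm c * norm x * K"
    by (intro exI[of _ 1]) (simp add: norm_scaleC)
qed (simp_all add: scaleC_add_left scaleC_add_right scaleC_scaleR)

lemma bounded_bilinear_cblinfun_apply:
  "bounded_bilinear (cblinfun_apply :: ('a::complex_normed_vector, 'b::complex_normed_vector) cblinfun \<Rightarrow> _)"
proof
  fix S T :: "('a, 'b) cblinfun" and r :: real and x y :: 'a
  show "cblinfun_apply (S + T) x = cblinfun_apply S x + cblinfun_apply T x"
    by transfer (simp add: blinfun.add_left)
  show "cblinfun_apply (r *\<^sub>R S) x = r *\<^sub>R cblinfun_apply S x"
    by transfer (simp add: blinfun.scaleR_left)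
  show "cblinfun_apply S (x + y) = cblinfun_apply S x + cblinfun_apply S y"
    by transfer (simp add: blinfun.add_right)
  show "cblinfun_apply S (r *\<^sub>R x) = r *\<^sub>R cblinfun_apply S x"
    by transfer (simp add: blinfun.scaleR_right)
  show "\<exists>K. \<forall>(S :: ('a, 'b) cblinfun) x. norm (cblinfun_apply S x) \<le> norm S * norm x * K"
    by (intro exI[of _ 1]) (simp add: norm_cblinfun_apply)
qed

interpretation scaleC: bounded_bilinear "\<lambda>c (x :: 'a::complex_normed_vector). c *\<^sub>C x"
  by (rule bounded_bilinear_scaleC)

interpretation cblinfun: bounded_bilinear "cblinfun_apply :: ('a::complex_normed_vector, 'b::complex_normed_vector) cblinfun \<Rightarrow> _"
  by (rule bounded_bilinear_cblinfun_apply)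

section \<open>Strongly measurable functions\<close>

lemma strongly_measurable_norm:
  "strongly_measurable M f \<Longrightarrow> (\<lambda>x. norm (f x)) \<in> borel_measurable M"
  using strongly_measurable_norm_diff_simple[of M f "\<lambda>_. 0"] by simp

lemma strongly_measurable_simple: "simple_function M f \<Longrightarrow> strongly_measurable M f"
  unfolding strongly_measurable_def by (intro exI[of _ "\<lambda>_. f"]) simp

lemma strongly_measurable_const: "strongly_measurable M (\<lambda>_. c)"
  by (rule strongly_measurable_simple) simp

lemma strongly_measurable_borel:
  fixes f :: "'a \<Rightarrow> 'b::{real_normed_vector, second_countable_topology}"
  assumes "f \<in> borel_measurable M"
  shows "strongly_measurable M f"
  using borel_measurable_implies_sequence_metric[OF assms, of 0]
  unfolding strongly_measurable_def by blast

text \<open>Approximating simple functions are combined pointwise, so sequential joint continuity of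
  \<open>h\<close> suffices; this avoids a sigma-algebra on a product of nonseparable
  spaces.\<close>

lemma strongly_measurable_compose2:
  assumes f: "strongly_measurable M f" and g: "strongly_measurable M g"
    and h: "\<And>u v a b. u \<longlonglongrightarrow> a \<Longrightarrow> v \<longlonglongrightarrow> b \<Longrightarrow> (\<lambda>i. h (u i) (v i)) \<longlonglongrightarrow> h a b"
  shows "strongly_measurable M (\<lambda>x. h (f x) (g x))"
proof -
  obtain s t where st: "\<And>i. simple_function M (s i)" "\<And>i. simple_function M (t i)"
    "\<And>x. x \<in> space M \<Longrightarrow> (\<lambda>i. s i x) \<longlonglongrightarrow> f x" "\<And>x. x \<in> space M \<Longrightarrow> (\<lambda>i. t i x) \<longlonglongrightarrow> g x"
    using f g unfolding strongly_measurable_def by metis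
  then show ?thesis
    unfolding strongly_measurable_def
    by (intro exI[of _ "\<lambda>i x. h (s i x) (t i x)"]) (auto intro: simple_function_compose2 h)
qed

lemmas strongly_measurable_add = strongly_measurable_compose2[where h = "(+)", OF _ _ tendsto_add]
  and strongly_measurable_scaleR = strongly_measurable_compose2[where h = "(*\<^sub>R)", OF _ _ tendsto_scaleR]
  and strongly_measurable_scaleC = strongly_measurable_compose2[where h = "(*\<^sub>C)", OF _ _ scaleC.tendsto]
  and strongly_measurable_cblinfun = strongly_measurable_compose2[where h = cblinfun_apply, OF _ _ cblinfun.tendsto]

lemma strongly_measurable_sum:
  "(\<And>k. k \<in> I \<Longrightarrow> strongly_measurable M (f k)) \<Longrightarrow> strongly_measurable M (\<lambda>x. \<Sum>k\<in>I. f k x)"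
  by (induction I rule: infinite_finite_induct) (auto intro: strongly_measurable_add strongly_measurable_const)

lemma strongly_measurable_bounded_linear:
  assumes "bounded_linear T" "strongly_measurable M f"
  shows "strongly_measurable M (\<lambda>x. T (f x))"
  using strongly_measurable_compose2[OF assms(2) assms(2), of "\<lambda>x _. T x"] bounded_linear.tendsto[OF assms(1)]
  by blast

section \<open>Existence and calculus of the Bochner integral\<close>

lemma tendsto_0_ennreal_le:
  fixes a b :: "nat \<Rightarrow> ennreal"
  assumes "\<And>i. a i \<le> b i" "b \<longlonglongrightarrow> 0"
  shows "a \<longlonglongrightarrow> 0"
  by (rule tendsto_sandwich[of "\<lambda>_. 0" a _ b]) (use assms in \<open>simp_all add: always_eventually\<close>)

abbreviation (input) "step_integrable \<equiv> Bochner_Integration.simple_bochner_integrable"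
abbreviation (input) "step_integral \<equiv> Bochner_Integration.simple_bochner_integral"

lemma simple_function_of_integrable: "step_integrable M s \<Longrightarrow> simple_function M s"
  by (auto elim: Bochner_Integration.simple_bochner_integrable.cases)

lemma step_integral_zero:
  "step_integrable M (\<lambda>_. 0 :: 'b::real_normed_vector)" "step_integral M (\<lambda>_. 0 :: 'b) = 0"
  by (auto simp: simple_bochner_integral_def intro!: sum.neutral simple_bochner_integrable.intros)

text \<open>The triangle inequality through \<open>f\<close>. It makes the integrals of
  approximating step functions a Cauchy sequence, and with the zero step function it compares one
  integral with the mean of \<open>norm (f x)\<close>.\<close>

lemma step_integral_diff_le:
  assumes f: "strongly_measurable M f" and s: "step_integrable M s" and t: "step_integrable M t"
  shows "ennreal (norm (step_integral M s - step_integral M t)) \<le>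
    (\<integral>\<^sup>+x. norm (f x - s x) \<partial>M) + (\<integral>\<^sup>+x. norm (f x - t x) \<partial>M)"
proof -
  have "ennreal (norm (step_integral M s - step_integral M t)) = norm (step_integral M (\<lambda>x. s x - t x))"
    using s t by (subst simple_bochner_integral_diff) auto
  also have "\<dots> \<le> step_integral M (\<lambda>x. norm (s x - t x))"
    using simple_bochner_integrable_compose2[of "(-)" M s t] s t
    by (auto intro!: simple_bochner_integral_norm_bound)
  also have "\<dots> = (\<integral>\<^sup>+x. norm (s x - t x) \<partial>M)"
    using simple_bochner_integrable_compose2[of "\<lambda>x y. norm (x - y)" M s t] s t
    by (auto intro!: simple_bochner_integral_eq_nn_integral)
  also have "\<dots> \<le> (\<integral>\<^sup>+x. ennreal (norm (f x - s x)) + ennreal (norm (f x - t x)) \<partial>M)"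
  proof (rule nn_integral_mono)
    fix x
    have "norm (s x - t x) \<le> norm (f x - s x) + norm (f x - t x)"
      by (metis dual_order.refl norm_diff_triangle_le norm_minus_commute)
    then show "ennreal (norm (s x - t x)) \<le> ennreal (norm (f x - s x)) + ennreal (norm (f x - t x))"
      by (metis ennreal_leI ennreal_plus norm_ge_zero)
  qed
  also have "\<dots> = (\<integral>\<^sup>+x. norm (f x - s x) \<partial>M) + (\<integral>\<^sup>+x. norm (f x - t x) \<partial>M)"
    using strongly_measurable_norm_diff_simple[OF f simple_function_of_integrable[OF s]]
      strongly_measurable_norm_diff_simple[OF f simple_function_of_integrable[OF t]]
    by (intro nn_integral_add) auto
  finally show ?thesis .
qed

lemma has_Bochner_integralI:
  assumes "strongly_measurable M f"
    and "\<And>i::nat. step_integrable M (s i)"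
    and "(\<lambda>i. \<integral>\<^sup>+x. ennreal (norm (f x - s i x)) \<partial>M) \<longlonglongrightarrow> 0"
    and "(\<lambda>i. step_integral M (s i)) \<longlonglongrightarrow> I"
  shows "has_Bochner_integral M f I"
  unfolding has_Bochner_integral_def using assms by blast

text \<open>Pointwise approximants need not converge in mean. Cutting \<open>s i\<close> off where
  its norm exceeds \<open>2 * norm (f x)\<close> preserves the pointwise limit and yields the
  majorant \<open>3 * norm (f x)\<close> for dominated convergence.\<close>

lemma has_Bochner_integral_exists:
  fixes f :: "'a \<Rightarrow> 'b::banach"
  assumes f: "strongly_measurable M f" and fin: "(\<integral>\<^sup>+x. norm (f x) \<partial>M) < \<infinity>"
  shows "\<exists>I. has_Bochner_integral M f I"
proof -
  from f obtain s where s: "\<And>i. simple_function M (s i)"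
    and lim: "\<And>x. x \<in> space M \<Longrightarrow> (\<lambda>i::nat. s i x) \<longlonglongrightarrow> f x"
    unfolding strongly_measurable_def by blast
  have [measurable]: "(\<lambda>x. norm (f x)) \<in> borel_measurable M"
    by (rule strongly_measurable_norm[OF f])
  have [measurable]: "(\<lambda>x. norm (s i x)) \<in> borel_measurable M" for i
    by (rule strongly_measurable_norm[OF strongly_measurable_simple[OF s]])
  define A where "A i = {x\<in>space M. norm (s i x) \<le> 2 * norm (f x)}" for i
  have A: "A i \<in> sets M" for i unfolding A_def by measurable
  define t where "t i x = indicat_real (A i) x *\<^sub>R s i x" for i x
  have t: "simple_function M (t i)" for i
    unfolding t_def by (rule simple_function_compose2[OF simple_function_indicator[OF A] s])
  have t_le: "norm (t i x) \<le> 2 * norm (f x)" for i x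
    by (auto simp: t_def A_def indicator_def)
  have t_lim: "(\<lambda>i. t i x) \<longlonglongrightarrow> f x" if x: "x \<in> space M" for x
  \<comment> \<open>Where \<open>f\<close> vanishes the cutoff forces the value zero; elsewhere it
    is eventually inactive.\<close>
  proof (cases "f x = 0")
    case True
    then have "t i x = 0" for i using t_le[of i x] by simp
    then show ?thesis using True by simp
  next
    case False
    have "(\<lambda>i. norm (s i x)) \<longlonglongrightarrow> norm (f x)"
      by (intro tendsto_intros lim x)
    then have "\<forall>\<^sub>F i in sequentially. norm (s i x) < 2 * norm (f x)"
      using False by (intro order_tendstoD) auto
    then have "\<forall>\<^sub>F i in sequentially. t i x = s i x"
      by eventually_elim (use x in \<open>auto simp: t_def A_def\<close>)
    then show ?thesis using lim[OF x] by (simp add: tendsto_cong)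
  qed
  have int_t: "step_integrable M (t i)" for i
  proof (rule simple_bochner_integrableI_bounded[OF t])
    have "(\<integral>\<^sup>+x. norm (t i x) \<partial>M) \<le> (\<integral>\<^sup>+x. 2 * ennreal (norm (f x)) \<partial>M)"
      using ennreal_leI[OF t_le] by (intro nn_integral_mono) (simp add: ennreal_mult)
    also have "\<dots> = 2 * (\<integral>\<^sup>+x. norm (f x) \<partial>M)"
      by (intro nn_integral_cmult) auto
    also have "\<dots> < \<infinity>" using fin by (simp add: ennreal_mult_less_top)
    finally show "(\<integral>\<^sup>+x. norm (t i x) \<partial>M) < \<infinity>" .
  qed
  have meas: "(\<lambda>x. norm (f x - t i x)) \<in> borel_measurable M" for i
    by (rule strongly_measurable_norm_diff_simple[OF f t])
  have "(\<lambda>i. \<integral>\<^sup>+x. ennreal (norm (f x - t i x)) \<partial>M) \<longlonglongrightarrow> (\<integral>\<^sup>+x. 0 \<partial>M)"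
  proof (rule nn_integral_dominated_convergence[where w = "\<lambda>x. 3 * ennreal (norm (f x))"])
    show "(\<integral>\<^sup>+x. 3 * ennreal (norm (f x)) \<partial>M) < \<infinity>"
      using fin by (subst nn_integral_cmult) (auto simp: ennreal_mult_less_top)
    show "AE x in M. ennreal (norm (f x - t i x)) \<le> 3 * ennreal (norm (f x))" for i
    proof (rule AE_I2)
      fix x
      have "norm (f x - t i x) \<le> 3 * norm (f x)"
        using norm_triangle_ineq4[of "f x" "t i x"] t_le[of i x] by linarith
      then show "ennreal (norm (f x - t i x)) \<le> 3 * ennreal (norm (f x))"
        by (drule_tac ennreal_leI) (simp add: ennreal_mult)
    qed
    show "AE x in M. (\<lambda>i. ennreal (norm (f x - t i x))) \<longlonglongrightarrow> 0"
    proof (rule AE_I2)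
      fix x assume "x \<in> space M"
      then have "(\<lambda>i. norm (f x - t i x)) \<longlonglongrightarrow> norm (f x - f x)"
        by (intro tendsto_intros t_lim)
      then show "(\<lambda>i. ennreal (norm (f x - t i x))) \<longlonglongrightarrow> 0"
        by (simp add: tendsto_ennrealI[where x = 0, simplified])
    qed
  qed (use meas in auto)
  then have lim0: "(\<lambda>i. \<integral>\<^sup>+x. ennreal (norm (f x - t i x)) \<partial>M) \<longlonglongrightarrow> 0" by simp
  let ?I = "\<lambda>i. step_integral M (t i)"
  have "Cauchy ?I"
  proof (rule CauchyI)
    fix e :: real assume e: "e > 0"
    have "\<forall>\<^sub>F i in sequentially. (\<integral>\<^sup>+x. ennreal (norm (f x - t i x)) \<partial>M) < ennreal (e / 2)"
      using e by (intro order_tendstoD[OF lim0]) auto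
    then obtain N where N: "\<And>i. i \<ge> N \<Longrightarrow> (\<integral>\<^sup>+x. ennreal (norm (f x - t i x)) \<partial>M) < ennreal (e / 2)"
      by (auto simp: eventually_sequentially)
    have "norm (?I i - ?I j) < e" if "i \<ge> N" "j \<ge> N" for i j
    proof -
      have "ennreal (norm (?I i - ?I j)) < ennreal (e / 2) + ennreal (e / 2)"
        by (rule le_less_trans[OF step_integral_diff_le[OF f int_t int_t]]) (intro add_strict_mono N that)
      also have "\<dots> = ennreal e" using e by (simp flip: ennreal_plus)
      finally show ?thesis using e by (simp add: ennreal_less_iff)
    qed
    then show "\<exists>N. \<forall>i\<ge>N. \<forall>j\<ge>N. norm (?I i - ?I j) < e" by blast
  qed
  then obtain I where "?I \<longlonglongrightarrow> I"
    using Cauchy_convergent convergent_def by blast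
  then show ?thesis
    unfolding has_Bochner_integral_def using f int_t lim0 by blast
qed

lemma has_Bochner_integral_norm_bound:
  assumes "has_Bochner_integral M f I"
  shows "ennreal (norm I) \<le> (\<integral>\<^sup>+x. norm (f x) \<partial>M)"
proof -
  from assms obtain s where f: "strongly_measurable M f"
    and s: "\<And>i::nat. step_integrable M (s i)"
    and lim: "(\<lambda>i. \<integral>\<^sup>+x. ennreal (norm (f x - s i x)) \<partial>M) \<longlonglongrightarrow> 0"
    and sI: "(\<lambda>i. step_integral M (s i)) \<longlonglongrightarrow> I"
    unfolding has_Bochner_integral_def by blast
  have *: "ennreal (norm (step_integral M (s i))) \<le> (\<integral>\<^sup>+x. norm (f x - s i x) \<partial>M) + (\<integral>\<^sup>+x. norm (f x) \<partial>M)" for i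
    using step_integral_diff_le[OF f s step_integral_zero(1)] by (simp add: step_integral_zero)
  have "(\<lambda>i. ennreal (norm (step_integral M (s i)))) \<longlonglongrightarrow> ennreal (norm I)"
    by (intro tendsto_intros sI)
  moreover have "(\<lambda>i. (\<integral>\<^sup>+x. norm (f x - s i x) \<partial>M) + (\<integral>\<^sup>+x. norm (f x) \<partial>M)) \<longlonglongrightarrow> 0 + (\<integral>\<^sup>+x. norm (f x) \<partial>M)"
    by (intro tendsto_intros lim)
  ultimately show ?thesis
    using * by (auto intro: LIMSEQ_le)
qed

lemma Bochner_integral_norm_bound:
  "ennreal (norm (Bochner_integral M f)) \<le> (\<integral>\<^sup>+x. norm (f x) \<partial>M)"
proof (cases "\<exists>I. has_Bochner_integral M f I")
  case True
  then show ?thesis using has_Bochner_integral_norm_bound Bochner_integral_eq by metis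
qed (simp add: Bochner_integral_def)

lemma has_Bochner_integral_add:
  assumes "has_Bochner_integral M f I" "has_Bochner_integral M g J"
  shows "has_Bochner_integral M (\<lambda>x. f x + g x) (I + J)"
proof -
  from assms obtain s t where f: "strongly_measurable M f" and g: "strongly_measurable M g"
    and s: "\<And>i::nat. step_integrable M (s i)"
    and s0: "(\<lambda>i. \<integral>\<^sup>+x. ennreal (norm (f x - s i x)) \<partial>M) \<longlonglongrightarrow> 0"
    and sI: "(\<lambda>i. step_integral M (s i)) \<longlonglongrightarrow> I"
    and t: "\<And>i::nat. step_integrable M (t i)"
    and t0: "(\<lambda>i. \<integral>\<^sup>+x. ennreal (norm (g x - t i x)) \<partial>M) \<longlonglongrightarrow> 0"
    and tJ: "(\<lambda>i. step_integral M (t i)) \<longlonglongrightarrow> J"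
    unfolding has_Bochner_integral_def by blast
  note simple = simple_function_of_integrable[OF s] simple_function_of_integrable[OF t]
  have "(\<integral>\<^sup>+x. ennreal (norm (f x + g x - (s i x + t i x))) \<partial>M) \<le>
      (\<integral>\<^sup>+x. ennreal (norm (f x - s i x)) \<partial>M) + (\<integral>\<^sup>+x. ennreal (norm (g x - t i x)) \<partial>M)" for i
  proof -
    have "(\<integral>\<^sup>+x. ennreal (norm (f x + g x - (s i x + t i x))) \<partial>M)
        \<le> (\<integral>\<^sup>+x. ennreal (norm (f x - s i x)) + ennreal (norm (g x - t i x)) \<partial>M)"
      by (intro nn_integral_mono)
        (simp add: norm_diff_triangle_ineq ennreal_leI flip: ennreal_plus)
    also have "\<dots> = (\<integral>\<^sup>+x. ennreal (norm (f x - s i x)) \<partial>M) + (\<integral>\<^sup>+x. ennreal (norm (g x - t i x)) \<partial>M)"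
      using strongly_measurable_norm_diff_simple[OF f simple(1)] strongly_measurable_norm_diff_simple[OF g simple(2)]
      by (intro nn_integral_add) auto
    finally show ?thesis .
  qed
  moreover have "(\<lambda>i. (\<integral>\<^sup>+x. ennreal (norm (f x - s i x)) \<partial>M) + (\<integral>\<^sup>+x. ennreal (norm (g x - t i x)) \<partial>M)) \<longlonglongrightarrow> 0"
    using tendsto_add[OF s0 t0] by simp
  ultimately have "(\<lambda>i. \<integral>\<^sup>+x. ennreal (norm (f x + g x - (s i x + t i x))) \<partial>M) \<longlonglongrightarrow> 0"
    by (rule tendsto_0_ennreal_le)
  moreover have "(\<lambda>i. step_integral M (\<lambda>x. s i x + t i x)) \<longlonglongrightarrow> I + J"
    using tendsto_add[OF sI tJ] by (simp add: simple_bochner_integral_add s t)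
  moreover have "step_integrable M (\<lambda>x. s i x + t i x)" for i
    using simple_bochner_integrable_compose2[of "(+)" M "s i" "t i"] s t by simp
  ultimately show ?thesis
    by (intro has_Bochner_integralI[where s = "\<lambda>i x. s i x + t i x"] strongly_measurable_add f g)
qed

lemma has_Bochner_integral_zero: "has_Bochner_integral M (\<lambda>_. 0 :: 'b::real_normed_vector) 0"
  by (rule has_Bochner_integralI[where s = "\<lambda>_ _. 0"])
    (simp_all add: strongly_measurable_const step_integral_zero)

lemma has_Bochner_integral_sum:
  "(\<And>k. k \<in> A \<Longrightarrow> has_Bochner_integral M (f k) (I k)) \<Longrightarrow>
    has_Bochner_integral M (\<lambda>x. \<Sum>k\<in>A. f k x) (\<Sum>k\<in>A. I k)"
  by (induction A rule: infinite_finite_induct) (auto intro: has_Bochner_integral_zero has_Bochner_integral_add)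

lemma has_Bochner_integral_bounded_linear:
  assumes T: "bounded_linear T" and f: "has_Bochner_integral M f I"
  shows "has_Bochner_integral M (\<lambda>x. T (f x)) (T I)"
proof -
  interpret T: bounded_linear T by fact
  from f obtain s where sm: "strongly_measurable M f"
    and s: "\<And>i::nat. step_integrable M (s i)"
    and lim: "(\<lambda>i. \<integral>\<^sup>+x. ennreal (norm (f x - s i x)) \<partial>M) \<longlonglongrightarrow> 0"
    and sI: "(\<lambda>i. step_integral M (s i)) \<longlonglongrightarrow> I"
    unfolding has_Bochner_integral_def by blast
  obtain K where K: "K > 0" "\<And>x. norm (T x) \<le> norm x * K"
    using T.pos_bounded by blast
  note simple = simple_function_of_integrable[OF s]
  have "(\<integral>\<^sup>+x. ennreal (norm (T (f x) - T (s i x))) \<partial>M)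
      \<le> ennreal K * (\<integral>\<^sup>+x. ennreal (norm (f x - s i x)) \<partial>M)" for i
  proof -
    have "(\<integral>\<^sup>+x. ennreal (norm (T (f x) - T (s i x))) \<partial>M) \<le> (\<integral>\<^sup>+x. ennreal K * ennreal (norm (f x - s i x)) \<partial>M)"
      using K(2)[of "f _ - s i _"] K(1)
      by (intro nn_integral_mono) (simp add: T.diff ennreal_leI mult.commute flip: ennreal_mult'')
    also have "\<dots> = ennreal K * (\<integral>\<^sup>+x. ennreal (norm (f x - s i x)) \<partial>M)"
      using strongly_measurable_norm_diff_simple[OF sm simple] by (intro nn_integral_cmult) auto
    finally show ?thesis .
  qed
  moreover have "(\<lambda>i. ennreal K * (\<integral>\<^sup>+x. ennreal (norm (f x - s i x)) \<partial>M)) \<longlonglongrightarrow> 0"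
    using ennreal_tendsto_cmult[OF _ lim, of "ennreal K"] by simp
  ultimately have "(\<lambda>i. \<integral>\<^sup>+x. ennreal (norm (T (f x) - T (s i x))) \<partial>M) \<longlonglongrightarrow> 0"
    by (rule tendsto_0_ennreal_le)
  then show ?thesis
  proof (rule has_Bochner_integralI[OF strongly_measurable_bounded_linear[OF T sm], rotated])
    show "(\<lambda>i. step_integral M (\<lambda>x. T (s i x))) \<longlonglongrightarrow> T I"
      using T.tendsto[OF sI] simple_bochner_integral_linear[OF T.linear_axioms s] by simp
    show "step_integrable M (\<lambda>x. T (s i x))" for i
      using simple_bochner_integrable_compose2[of "\<lambda>x y. T x" M "s i" "s i"] s T.zero by simp
  qed
qed

text \<open>Scalar integrals can thus be evaluated by Lebesgue theory and then moved into a Banach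
  space by a bounded linear map.\<close>

lemma has_Bochner_integral_lebesgue:
  fixes f :: "'a \<Rightarrow> 'b::{banach, second_countable_topology}"
  assumes "integrable M f"
  shows "has_Bochner_integral M f (integral\<^sup>L M f)"
proof -
  have "has_bochner_integral M f (integral\<^sup>L M f)"
    using assms by (rule has_bochner_integral_integrable)
  then show ?thesis
    by cases (auto simp: has_Bochner_integral_def intro!: strongly_measurable_borel)
qed

lemma Bochner_integral_bounded_linear:
  assumes "bounded_linear T" "strongly_measurable M f" "(\<integral>\<^sup>+x. norm (f x) \<partial>M) < \<infinity>"
  shows "Bochner_integral M (\<lambda>x. T (f x)) = T (Bochner_integral M (f :: _ \<Rightarrow> _::banach))"
proof -
  obtain I where I: "has_Bochner_integral M f I"
    using has_Bochner_integral_exists[OF assms(2,3)] by blast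
  show ?thesis
    using Bochner_integral_eq[OF I] Bochner_integral_eq[OF has_Bochner_integral_bounded_linear[OF assms(1) I]]
    by simp
qed

lemma Bochner_integral_add:
  assumes "strongly_measurable M f" "(\<integral>\<^sup>+x. norm (f x) \<partial>M) < \<infinity>"
    and "strongly_measurable M g" "(\<integral>\<^sup>+x. norm (g x) \<partial>M) < \<infinity>"
  shows "Bochner_integral M (\<lambda>x. f x + g x) = Bochner_integral M f + Bochner_integral M (g :: _ \<Rightarrow> _::banach)"
proof -
  obtain I J where I: "has_Bochner_integral M f I" and J: "has_Bochner_integral M g J"
    using has_Bochner_integral_exists[OF assms(1,2)] has_Bochner_integral_exists[OF assms(3,4)] by blast
  show ?thesis
    using Bochner_integral_eq[OF I] Bochner_integral_eq[OF J] Bochner_integral_eq[OF has_Bochner_integral_add[OF I J]]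
    by simp
qed

section \<open>Power means and Hoelder's inequality\<close>

text \<open>Convexity: the tangent to \<open>x powr s\<close> at \<open>c\<close> lies below the
  graph. Young's inequality with exponents \<open>s\<close> and \<open>s / (s - 1)\<close> is this
  statement.\<close>

lemma powr_tangent:
  fixes s x c :: real
  assumes "s \<ge> 1" "x \<ge> 0" "c \<ge> 0"
  shows "s * c powr (s - 1) * x \<le> x powr s + (s - 1) * c powr s"
proof (cases "s = 1")
  case True
  then show ?thesis using assms by (auto simp: powr_def)
next
  case False
  then have s: "s > 1" using assms by simp
  have "x * c powr (s - 1) \<le> x powr s / s + (c powr (s - 1)) powr (s / (s - 1)) / (s / (s - 1))"
    using s assms by (intro Youngs_inequality) (auto simp: field_simps)
  also have "(c powr (s - 1)) powr (s / (s - 1)) = c powr s"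
    using s by (simp add: powr_powr)
  finally have "s * (x * c powr (s - 1)) \<le> s * (x powr s / s + c powr s / (s / (s - 1)))"
    using s by (intro mult_left_mono) auto
  also have "\<dots> = x powr s + (s - 1) * c powr s"
    using s by (simp add: field_simps)
  finally show ?thesis by (simp add: ac_simps)
qed

text \<open>Jensen's inequality for weights that are not normalized. \<open>W\<close> is merely an
  upper bound for the total weight, since the total of the bump weights varies from point to
  point.\<close>

lemma weighted_power_mean:
  fixes g a :: "'i \<Rightarrow> real"
  assumes fin: "finite I" and s: "s \<ge> 1" and g: "\<And>k. k \<in> I \<Longrightarrow> g k \<ge> 0" and a: "\<And>k. k \<in> I \<Longrightarrow> a k \<ge> 0"
    and W: "(\<Sum>k\<in>I. g k) \<le> W"
  shows "(\<Sum>k\<in>I. g k * a k) powr s \<le> W powr (s - 1) * (\<Sum>k\<in>I. g k * a k powr s)"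
proof (cases "(\<Sum>k\<in>I. g k) = 0")
  case True
  then have "\<And>k. k \<in> I \<Longrightarrow> g k = 0" using fin g by (simp add: sum_nonneg_eq_0_iff)
  then show ?thesis by simp
next
  case False
  define V where "V = (\<Sum>k\<in>I. g k)"
  have V: "V > 0" using False g by (auto simp: V_def less_le intro: sum_nonneg)
  \<comment> \<open>With tangents taken at the weighted mean, the linear terms add up to
    \<open>s * V * c powr s\<close>; subtracting the constant terms leaves
    \<open>V * c powr s\<close>.\<close>
  define c where "c = (\<Sum>k\<in>I. g k * a k) / V"
  have c: "c \<ge> 0" unfolding c_def using V g a by (intro divide_nonneg_pos sum_nonneg) auto
  have Vc: "(\<Sum>k\<in>I. g k * a k) = V * c" using V by (simp add: c_def)
  have cs: "c powr (s - 1) * c = c powr s"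
    using c by (cases "c = 0") (auto simp: powr_diff)
  have "(\<Sum>k\<in>I. g k * (s * c powr (s - 1) * a k)) \<le> (\<Sum>k\<in>I. g k * (a k powr s + (s - 1) * c powr s))"
    using g a c s by (intro sum_mono mult_left_mono powr_tangent) auto
  also have "(\<Sum>k\<in>I. g k * (s * c powr (s - 1) * a k)) = s * c powr (s - 1) * (\<Sum>k\<in>I. g k * a k)"
    by (simp add: sum_distrib_left ac_simps)
  also have "\<dots> = s * V * c powr s"
    using cs by (simp add: Vc)
  also have "(\<Sum>k\<in>I. g k * (a k powr s + (s - 1) * c powr s)) = (\<Sum>k\<in>I. g k * a k powr s) + V * (s - 1) * c powr s"
    by (simp add: distrib_left sum.distrib V_def sum_distrib_right sum_distrib_left ac_simps)
  finally have *: "V * c powr s \<le> (\<Sum>k\<in>I. g k * a k powr s)"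
    by (simp add: algebra_simps)
  have "(\<Sum>k\<in>I. g k * a k) powr s = V powr s * c powr s"
    using V c by (simp add: Vc powr_mult)
  also have "\<dots> = V powr (s - 1) * (V * c powr s)"
    using V by (simp add: powr_diff)
  also have "\<dots> \<le> W powr (s - 1) * (\<Sum>k\<in>I. g k * a k powr s)"
    using * V c s W by (intro mult_mono powr_mono2) (auto simp: V_def)
  finally show ?thesis .
qed

lemma nn_integral_Hoelder_pos:
  fixes u v :: "'a \<Rightarrow> real"
  assumes ab: "a > 1" "b > 1" "1 / a + 1 / b = 1"
    and [measurable]: "u \<in> borel_measurable M" "v \<in> borel_measurable M"
    and nonneg: "\<And>x. u x \<ge> 0" "\<And>x. v x \<ge> 0"
    and U: "(\<integral>\<^sup>+x. ennreal (u x powr a) \<partial>M) \<le> ennreal (A powr a)"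
    and V: "(\<integral>\<^sup>+x. ennreal (v x powr b) \<partial>M) \<le> ennreal (B powr b)"
    and AB: "A > 0" "B > 0"
  shows "(\<integral>\<^sup>+x. ennreal (u x * v x) \<partial>M) \<le> ennreal (A * B)"
proof -
  \<comment> \<open>Young's inequality is applied to \<open>u x / A\<close> and
    \<open>v x / B\<close>; these factors undo the normalization, and the two terms total
    \<open>A * B * (1 / a + 1 / b)\<close>.\<close>
  define \<alpha> \<beta> where "\<alpha> = A * B / (a * A powr a)" and "\<beta> = A * B / (b * B powr b)"
  have pos: "\<alpha> \<ge> 0" "\<beta> \<ge> 0" using ab AB by (auto simp: \<alpha>_def \<beta>_def)
  have "u x * v x \<le> \<alpha> * u x powr a + \<beta> * v x powr b" for x
  proof -
    have "(u x / A) * (v x / B) \<le> (u x / A) powr a / a + (v x / B) powr b / b"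
      using ab AB nonneg by (intro Youngs_inequality) auto
    then have "A * B * ((u x / A) * (v x / B)) \<le> A * B * ((u x / A) powr a / a + (v x / B) powr b / b)"
      using AB by (intro mult_left_mono) auto
    also have "\<dots> = \<alpha> * u x powr a + \<beta> * v x powr b"
      using AB nonneg by (simp add: powr_divide \<alpha>_def \<beta>_def distrib_left mult.commute)
    finally show ?thesis using AB by simp
  qed
  then have "(\<integral>\<^sup>+x. ennreal (u x * v x) \<partial>M) \<le> (\<integral>\<^sup>+x. ennreal \<alpha> * ennreal (u x powr a) + ennreal \<beta> * ennreal (v x powr b) \<partial>M)"
    using pos by (intro nn_integral_mono) (simp add: ennreal_leI flip: ennreal_mult ennreal_plus)
  also have "\<dots> = ennreal \<alpha> * (\<integral>\<^sup>+x. ennreal (u x powr a) \<partial>M) + ennreal \<beta> * (\<integral>\<^sup>+x. ennreal (v x powr b) \<partial>M)"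
    by (subst nn_integral_add) (auto simp: nn_integral_cmult)
  also have "\<dots> \<le> ennreal \<alpha> * ennreal (A powr a) + ennreal \<beta> * ennreal (B powr b)"
    by (intro add_mono mult_left_mono U V) auto
  also have "\<dots> = ennreal (\<alpha> * A powr a + \<beta> * B powr b)"
    using pos by (simp add: ennreal_mult)
  also have "\<alpha> * A powr a + \<beta> * B powr b = A * B * (1 / a + 1 / b)"
    using AB ab(1,2) by (simp add: \<alpha>_def \<beta>_def distrib_left)
  finally show ?thesis using ab by simp
qed

text \<open>A zero bound is reached from positive ones: enlarge \<open>A\<close> and
  \<open>B\<close> by \<open>1 / Suc n\<close> and let \<open>n\<close> grow.\<close>

lemma nn_integral_Hoelder:
  fixes u v :: "'a \<Rightarrow> real"
  assumes ab: "a > 1" "b > 1" "1 / a + 1 / b = 1"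
    and meas: "u \<in> borel_measurable M" "v \<in> borel_measurable M"
    and nonneg: "\<And>x. u x \<ge> 0" "\<And>x. v x \<ge> 0"
    and U: "(\<integral>\<^sup>+x. ennreal (u x powr a) \<partial>M) \<le> ennreal (A powr a)"
    and V: "(\<integral>\<^sup>+x. ennreal (v x powr b) \<partial>M) \<le> ennreal (B powr b)"
    and AB: "A \<ge> 0" "B \<ge> 0"
  shows "(\<integral>\<^sup>+x. ennreal (u x * v x) \<partial>M) \<le> ennreal (A * B)"
proof -
  have *: "(\<integral>\<^sup>+x. ennreal (u x * v x) \<partial>M) \<le> ennreal ((A + 1 / Suc n) * (B + 1 / Suc n))" for n
  proof (rule nn_integral_Hoelder_pos[OF ab meas nonneg])
    show "(\<integral>\<^sup>+x. ennreal (u x powr a) \<partial>M) \<le> ennreal ((A + 1 / Suc n) powr a)"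
      using AB ab by (intro order_trans[OF U] ennreal_leI powr_mono2) auto
    show "(\<integral>\<^sup>+x. ennreal (v x powr b) \<partial>M) \<le> ennreal ((B + 1 / Suc n) powr b)"
      using AB ab by (intro order_trans[OF V] ennreal_leI powr_mono2) auto
  qed (use AB in \<open>auto intro: add_nonneg_pos\<close>)
  have "(\<lambda>n. ennreal ((A + 1 / Suc n) * (B + 1 / Suc n))) \<longlonglongrightarrow> ennreal ((A + 0) * (B + 0))"
    by (intro tendsto_intros LIMSEQ_Suc[OF lim_1_over_n])
  then show ?thesis
    using * by (intro LIMSEQ_le_const[where X = "\<lambda>n. ennreal ((A + 1 / Suc n) * (B + 1 / Suc n))"]) auto
qed

section \<open>Gaussian sums\<close>

lemma sets_std_complex_gaussian [simp, measurable_cong]: "sets std_complex_gaussian = sets borel"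
  and space_std_complex_gaussian [simp]: "space std_complex_gaussian = UNIV"
  by (simp_all add: std_complex_gaussian_def)

lemma measurable_std_complex_gaussian [simp]: "measurable std_complex_gaussian M = measurable borel M"
  by (rule measurable_cong_sets) simp_all

interpretation scg: prob_space std_complex_gaussian
  by (rule prob_space_std_complex_gaussian)

interpretation gaussian: product_prob_space "\<lambda>_::nat. std_complex_gaussian" UNIV
  by unfold_locales

lemma prob_space_gaussian_space: "prob_space gaussian_space"
  unfolding gaussian_space_def by (rule gaussian.P.prob_space_axioms)

lemma space_gaussian_space [simp]: "space gaussian_space = UNIV"
  by (simp add: gaussian_space_def space_PiM)

lemma measurable_gaussian_coordinate [measurable]: "(\<lambda>\<gamma>. \<gamma> k) \<in> borel_measurable gaussian_space"
proof -
  have "(\<lambda>\<gamma>. \<gamma> k) \<in> gaussian_space \<rightarrow>\<^sub>M std_complex_gaussian"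
    unfolding gaussian_space_def by measurable
  then show ?thesis by (simp cong: measurable_cong_sets)
qed

lemma measurable_Complex [measurable (raw)]:
  assumes [measurable]: "f \<in> borel_measurable M" "g \<in> borel_measurable M"
  shows "(\<lambda>x. Complex (f x) (g x)) \<in> borel_measurable M"
  unfolding Complex_eq by measurable

text \<open>Two real Gaussian densities of variance 1/2 multiply to a radial density on the plane;
  rotation invariance is read off from this form.\<close>

lemma nn_integral_std_complex_gaussian:
  assumes [measurable]: "h \<in> borel_measurable borel"
  shows "(\<integral>\<^sup>+z. h z \<partial>std_complex_gaussian) =
    (\<integral>\<^sup>+x. \<integral>\<^sup>+y. ennreal (exp (- (x\<^sup>2 + y\<^sup>2)) / pi) * h (Complex x y) \<partial>lborel \<partial>lborel)"
proof -
  let ?n = "normal_density 0 (1 / sqrt 2)"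
  let ?N = "density lborel (\<lambda>x. ennreal (?n x))"
  interpret N: prob_space ?N
    by (rule prob_space_normal_density) simp
  interpret NN: pair_prob_space ?N ?N ..
  have "?n x = exp (- x\<^sup>2) / sqrt pi" for x
    by (simp add: normal_density_def power_divide)
  then have n: "?n x * ?n y = exp (- (x\<^sup>2 + y\<^sup>2)) / pi" for x y
    by (simp add: mult_exp_exp)
  have "(\<integral>\<^sup>+z. h z \<partial>std_complex_gaussian) = (\<integral>\<^sup>+(x, y). h (Complex x y) \<partial>(?N \<Otimes>\<^sub>M ?N))"
    unfolding std_complex_gaussian_def by (subst nn_integral_distr) (simp_all add: case_prod_unfold)
  also have "\<dots> = (\<integral>\<^sup>+x. \<integral>\<^sup>+y. h (Complex x y) \<partial>?N \<partial>?N)"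
    by (subst N.nn_integral_fst[symmetric]) auto
  also have "\<dots> = (\<integral>\<^sup>+x. ennreal (?n x) * (\<integral>\<^sup>+y. ennreal (?n y) * h (Complex x y) \<partial>lborel) \<partial>lborel)"
    by (subst nn_integral_density; simp add: nn_integral_density)
  also have "\<dots> = (\<integral>\<^sup>+x. \<integral>\<^sup>+y. ennreal (?n x * ?n y) * h (Complex x y) \<partial>lborel \<partial>lborel)"
    by (simp add: nn_integral_cmult[symmetric] ennreal_mult mult.assoc)
  finally show ?thesis by (simp only: n)
qed

section \<open>Rotation invariance of the complex Gaussian law\<close>

lemma nn_integral_shear_fst:
  assumes [measurable]: "g \<in> borel_measurable (lborel \<Otimes>\<^sub>M lborel)"
  shows "(\<integral>\<^sup>+x. \<integral>\<^sup>+y. g (x + a * y, y) \<partial>lborel \<partial>lborel) = (\<integral>\<^sup>+x. \<integral>\<^sup>+y. g (x, y) \<partial>lborel \<partial>(lborel :: real measure))"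
proof -
  have "(\<integral>\<^sup>+x. \<integral>\<^sup>+y. g (x + a * y, y) \<partial>lborel \<partial>lborel) = (\<integral>\<^sup>+y. \<integral>\<^sup>+x. g (x + a * y, y) \<partial>lborel \<partial>lborel)"
    by (rule lborel_pair.Fubini'[symmetric]) simp
  also have "\<dots> = (\<integral>\<^sup>+y. \<integral>\<^sup>+x. g (x, y) \<partial>lborel \<partial>lborel)"
  proof (rule nn_integral_cong)
    fix y
    show "(\<integral>\<^sup>+x. g (x + a * y, y) \<partial>lborel) = (\<integral>\<^sup>+x. g (x, y) \<partial>lborel)"
      using nn_integral_real_affine[of "\<lambda>x. g (x, y)" 1 "a * y"] by (simp add: add.commute)
  qed
  also have "\<dots> = (\<integral>\<^sup>+x. \<integral>\<^sup>+y. g (x, y) \<partial>lborel \<partial>lborel)"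
    by (rule lborel_pair.Fubini') simp
  finally show ?thesis .
qed

lemma nn_integral_shear_snd:
  assumes [measurable]: "g \<in> borel_measurable (lborel \<Otimes>\<^sub>M lborel)"
  shows "(\<integral>\<^sup>+x. \<integral>\<^sup>+y. g (x, y + a * x) \<partial>lborel \<partial>lborel) = (\<integral>\<^sup>+x. \<integral>\<^sup>+y. g (x, y) \<partial>lborel \<partial>(lborel :: real measure))"
proof (rule nn_integral_cong)
  fix x :: real
  show "(\<integral>\<^sup>+y. g (x, y + a * x) \<partial>lborel) = (\<integral>\<^sup>+y. g (x, y) \<partial>lborel)"
    using nn_integral_real_affine[of "\<lambda>y. g (x, y)" 1 "a * x"] by (simp add: add.commute)
qed

text \<open>A rotation by an angle that is not a multiple of \<open>\<pi>\<close> is a product of three shears, and these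
  preserve Lebesgue measure by Fubini's theorem.\<close>

lemma nn_integral_rotate:
  fixes c s :: real
  assumes [measurable]: "g \<in> borel_measurable (lborel \<Otimes>\<^sub>M lborel)" and cs: "c\<^sup>2 + s\<^sup>2 = 1" and s: "s \<noteq> 0"
  shows "(\<integral>\<^sup>+x. \<integral>\<^sup>+y. g (c * x - s * y, s * x + c * y) \<partial>lborel \<partial>lborel) = (\<integral>\<^sup>+x. \<integral>\<^sup>+y. g (x, y) \<partial>lborel \<partial>lborel)"
proof -
  \<comment> \<open>For an angle \<theta> with cosine \<open>c\<close> and sine \<open>s\<close>
    this is minus the tangent of \<theta>/2. The shears use the coefficients \<open>a\<close>,
    \<open>s\<close>, \<open>a\<close> in turn, and the matrix identity reduces to \<open>as\<close>
    and \<open>ac\<close>.\<close>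
  define a where "a = (c - 1) / s"
  have as: "a * s = c - 1" using s by (simp add: a_def)
  have "a * (1 + c) * s = (c - 1) * (1 + c)" using as by (metis mult.assoc mult.commute)
  also have "\<dots> = (- s) * s" using cs by (simp add: algebra_simps power2_eq_square)
  finally have ac: "a * (1 + c) = - s" using s mult_right_cancel by blast
  have "g (c * x - s * y, s * x + c * y) =
      g ((x + a * y) + a * (y + s * (x + a * y)), y + s * (x + a * y))" for x y
  proof -
    have "(x + a * y) + a * (y + s * (x + a * y)) = (1 + a * s) * x + a * (2 + a * s) * y"
      by (simp add: algebra_simps)
    also have "\<dots> = c * x + a * (1 + c) * y" by (simp add: as)
    finally have 1: "(x + a * y) + a * (y + s * (x + a * y)) = c * x - s * y" by (simp add: ac)
    have "y + s * (x + a * y) = s * x + (1 + a * s) * y" by (simp add: algebra_simps)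
    then have 2: "y + s * (x + a * y) = s * x + c * y" by (simp add: as)
    show ?thesis by (metis 1 2)
  qed
  then have "(\<integral>\<^sup>+x. \<integral>\<^sup>+y. g (c * x - s * y, s * x + c * y) \<partial>lborel \<partial>lborel) =
      (\<integral>\<^sup>+x. \<integral>\<^sup>+y. g ((x + a * y) + a * (y + s * (x + a * y)), y + s * (x + a * y)) \<partial>lborel \<partial>lborel)"
    by simp
  also have "\<dots> = (\<integral>\<^sup>+x. \<integral>\<^sup>+y. g (x + a * (y + s * x), y + s * x) \<partial>lborel \<partial>lborel)"
    by (rule nn_integral_shear_fst[of "\<lambda>(x, y). g (x + a * (y + s * x), y + s * x)", simplified]) measurable
  also have "\<dots> = (\<integral>\<^sup>+x. \<integral>\<^sup>+y. g (x + a * y, y) \<partial>lborel \<partial>lborel)"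
    by (rule nn_integral_shear_snd[of "\<lambda>(x, y). g (x + a * y, y)", simplified]) measurable
  also have "\<dots> = (\<integral>\<^sup>+x. \<integral>\<^sup>+y. g (x, y) \<partial>lborel \<partial>lborel)"
    by (rule nn_integral_shear_fst) measurable
  finally show ?thesis .
qed

definition gaussian_invariant :: "(complex \<Rightarrow> complex) \<Rightarrow> bool" where
  "gaussian_invariant \<phi> \<longleftrightarrow> \<phi> \<in> borel_measurable borel \<and> distr std_complex_gaussian borel \<phi> = std_complex_gaussian"

lemma gaussian_invariantI:
  assumes meas: "\<phi> \<in> borel_measurable borel"
    and inv: "\<And>h :: complex \<Rightarrow> ennreal. h \<in> borel_measurable borel \<Longrightarrow>
      (\<integral>\<^sup>+z. h (\<phi> z) \<partial>std_complex_gaussian) = (\<integral>\<^sup>+z. h z \<partial>std_complex_gaussian)"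
  shows "gaussian_invariant \<phi>"
proof -
  note meas[measurable]
  have "distr std_complex_gaussian borel \<phi> = std_complex_gaussian"
  proof (rule measure_eqI)
    fix A assume "A \<in> sets (distr std_complex_gaussian borel \<phi>)"
    then have [measurable]: "A \<in> sets borel" by simp
    have "emeasure (distr std_complex_gaussian borel \<phi>) A = (\<integral>\<^sup>+z. indicator A z \<partial>distr std_complex_gaussian borel \<phi>)"
      by simp
    also have "\<dots> = (\<integral>\<^sup>+z. indicator A (\<phi> z) \<partial>std_complex_gaussian)"
      by (rule nn_integral_distr) simp_all
    also have "\<dots> = (\<integral>\<^sup>+z. indicator A z \<partial>std_complex_gaussian)"
      by (rule inv) simp
    finally show "emeasure (distr std_complex_gaussian borel \<phi>) A = emeasure std_complex_gaussian A"
      by simp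
  qed simp
  then show ?thesis using meas by (simp add: gaussian_invariant_def)
qed

lemma gaussian_invariant_comp:
  assumes "gaussian_invariant \<phi>" "gaussian_invariant \<psi>"
  shows "gaussian_invariant (\<lambda>z. \<psi> (\<phi> z))"
proof -
  have [measurable]: "\<phi> \<in> borel_measurable borel" "\<psi> \<in> borel_measurable borel"
    using assms by (auto simp: gaussian_invariant_def)
  have "distr std_complex_gaussian borel (\<lambda>z. \<psi> (\<phi> z)) = distr (distr std_complex_gaussian borel \<phi>) borel \<psi>"
    by (subst distr_distr) (simp_all add: comp_def)
  then show ?thesis using assms by (simp add: gaussian_invariant_def)
qed

lemma gaussian_invariant_id: "gaussian_invariant (\<lambda>z. z)"
  by (rule gaussian_invariantI) auto

lemma measurable_cnj [measurable]: "cnj \<in> borel_measurable borel"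
  by (simp add: borel_measurable_continuous_onI continuous_on_cnj)

lemma gaussian_invariant_cnj: "gaussian_invariant cnj"
proof (rule gaussian_invariantI)
  fix h :: "complex \<Rightarrow> ennreal" assume [measurable]: "h \<in> borel_measurable borel"
  have "(\<integral>\<^sup>+z. h (cnj z) \<partial>std_complex_gaussian) =
      (\<integral>\<^sup>+x. \<integral>\<^sup>+y. ennreal (exp (- (x\<^sup>2 + y\<^sup>2)) / pi) * h (Complex x (- y)) \<partial>lborel \<partial>lborel)"
    by (subst nn_integral_std_complex_gaussian) (auto simp: complex_cnj)
  also have "\<dots> = (\<integral>\<^sup>+x. \<integral>\<^sup>+y. ennreal (exp (- (x\<^sup>2 + y\<^sup>2)) / pi) * h (Complex x y) \<partial>lborel \<partial>lborel)"
  proof (rule nn_integral_cong)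
    fix x :: real
    show "(\<integral>\<^sup>+y. ennreal (exp (- (x\<^sup>2 + y\<^sup>2)) / pi) * h (Complex x (- y)) \<partial>lborel) =
        (\<integral>\<^sup>+y. ennreal (exp (- (x\<^sup>2 + y\<^sup>2)) / pi) * h (Complex x y) \<partial>lborel)"
      using nn_integral_real_affine[of "\<lambda>y. ennreal (exp (- (x\<^sup>2 + y\<^sup>2)) / pi) * h (Complex x y)" "-1" 0] by simp
  qed
  finally show "(\<integral>\<^sup>+z. h (cnj z) \<partial>std_complex_gaussian) = (\<integral>\<^sup>+z. h z \<partial>std_complex_gaussian)"
    by (subst (2) nn_integral_std_complex_gaussian) auto
qed measurable

lemma gaussian_invariant_mult:
  assumes u: "cmod u = 1"
  shows "gaussian_invariant (\<lambda>z. u * z)"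
proof -
  have rot: "gaussian_invariant (\<lambda>z. w * z)" if w: "cmod w = 1" "Im w \<noteq> 0" for w
  proof (rule gaussian_invariantI)
    fix h :: "complex \<Rightarrow> ennreal" assume [measurable]: "h \<in> borel_measurable borel"
    let ?g = "\<lambda>(x, y). ennreal (exp (- (x\<^sup>2 + y\<^sup>2)) / pi) * h (Complex x y)"
    have cs: "(Re w)\<^sup>2 + (Im w)\<^sup>2 = 1" using w(1) by (simp add: cmod_def)
    have eq: "x\<^sup>2 + y\<^sup>2 = (Re w * x - Im w * y)\<^sup>2 + (Im w * x + Re w * y)\<^sup>2" for x y
    proof -
      have "(Re w * x - Im w * y)\<^sup>2 + (Im w * x + Re w * y)\<^sup>2 = ((Re w)\<^sup>2 + (Im w)\<^sup>2) * (x\<^sup>2 + y\<^sup>2)"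
        by (simp add: power2_eq_square algebra_simps)
      then show ?thesis by (simp add: cs)
    qed
    have "(\<integral>\<^sup>+z. h (w * z) \<partial>std_complex_gaussian) =
        (\<integral>\<^sup>+x. \<integral>\<^sup>+y. ?g (Re w * x - Im w * y, Im w * x + Re w * y) \<partial>lborel \<partial>lborel)"
    proof (subst nn_integral_std_complex_gaussian)
      have "w * Complex x y = Complex (Re w * x - Im w * y) (Im w * x + Re w * y)" for x y
        by (simp add: complex_eq_iff)
      then show "(\<integral>\<^sup>+x. \<integral>\<^sup>+y. ennreal (exp (- (x\<^sup>2 + y\<^sup>2)) / pi) * h (w * Complex x y) \<partial>lborel \<partial>lborel) =
        (\<integral>\<^sup>+x. \<integral>\<^sup>+y. ?g (Re w * x - Im w * y, Im w * x + Re w * y) \<partial>lborel \<partial>lborel)"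
        by (simp only: eq[symmetric] prod.case)
    qed measurable
    also have "\<dots> = (\<integral>\<^sup>+x. \<integral>\<^sup>+y. ?g (x, y) \<partial>lborel \<partial>lborel)"
      using w by (intro nn_integral_rotate cs) auto
    finally show "(\<integral>\<^sup>+z. h (w * z) \<partial>std_complex_gaussian) = (\<integral>\<^sup>+z. h z \<partial>std_complex_gaussian)"
      by (subst (2) nn_integral_std_complex_gaussian) auto
  qed measurable
  show ?thesis
  proof (cases "Im u = 0")
    case False
    then show ?thesis by (rule rot[OF u])
  next
    case True
    \<comment> \<open>A real unimodular number is 1 or -1; the half turn, which the shears cannot
      produce directly, is two quarter turns.\<close>
    then have "u = 1 \<or> u = \<i> * \<i>" using u by (auto simp: cmod_def complex_eq_iff abs_if split: if_splits)
    then show ?thesis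
    proof
      assume "u = \<i> * \<i>"
      then show ?thesis using gaussian_invariant_comp[OF rot[of \<i>] rot[of \<i>]] by (simp add: mult.assoc)
    qed (simp add: gaussian_invariant_id)
  qed
qed

text \<open>A product measure is determined by its values on finite cylinders, which are finite
  products there. Each factor is preserved by its own map, so the maps may differ between
  coordinates.\<close>

lemma distr_gaussian_space:
  assumes "\<And>k. gaussian_invariant (\<phi> k)"
  shows "distr gaussian_space gaussian_space (\<lambda>\<gamma> k. \<phi> k (\<gamma> k)) = gaussian_space"
proof -
  have \<phi>[measurable]: "\<phi> k \<in> borel_measurable borel" for k
    using assms by (auto simp: gaussian_invariant_def)
  have \<phi>'[measurable]: "\<phi> k \<in> std_complex_gaussian \<rightarrow>\<^sub>M std_complex_gaussian" for k
    using \<phi>[of k] by (simp cong: measurable_cong_sets)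
  have meas: "(\<lambda>\<gamma> k. \<phi> k (\<gamma> k)) \<in> gaussian_space \<rightarrow>\<^sub>M gaussian_space"
    unfolding gaussian_space_def by (rule measurable_PiM_single') (auto simp: space_PiM)
  show ?thesis
    unfolding gaussian_space_def
  proof (rule gaussian.PiM_eq)
    fix J :: "nat set" and F assume J: "finite J" and F: "\<And>j. j \<in> J \<Longrightarrow> F j \<in> sets std_complex_gaussian"
    let ?P = "\<lambda>_::nat. std_complex_gaussian"
    have F': "\<phi> j -` F j \<in> sets std_complex_gaussian" if "j \<in> J" for j
      using measurable_sets[OF \<phi>' F[OF that]] by simp
    have "emeasure (distr (PiM UNIV ?P) (PiM UNIV ?P) (\<lambda>\<gamma> k. \<phi> k (\<gamma> k))) (prod_emb UNIV ?P J (\<Pi>\<^sub>E j\<in>J. F j)) =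
        emeasure (PiM UNIV ?P) (prod_emb UNIV ?P J (\<Pi>\<^sub>E j\<in>J. \<phi> j -` F j))"
    proof (subst emeasure_distr[OF meas[unfolded gaussian_space_def]])
      show "prod_emb UNIV ?P J (\<Pi>\<^sub>E j\<in>J. F j) \<in> sets (PiM UNIV ?P)"
        using J F by (intro sets_PiM_I) auto
      have "(\<lambda>\<gamma> k. \<phi> k (\<gamma> k)) -` prod_emb UNIV ?P J (\<Pi>\<^sub>E j\<in>J. F j) \<inter> space (PiM UNIV ?P) =
          prod_emb UNIV ?P J (\<Pi>\<^sub>E j\<in>J. \<phi> j -` F j)"
        by (auto simp: prod_emb_def space_PiM PiE_iff)
      then show "emeasure (PiM UNIV ?P) ((\<lambda>\<gamma> k. \<phi> k (\<gamma> k)) -` prod_emb UNIV ?P J (\<Pi>\<^sub>E j\<in>J. F j) \<inter> space (PiM UNIV ?P)) =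
          emeasure (PiM UNIV ?P) (prod_emb UNIV ?P J (\<Pi>\<^sub>E j\<in>J. \<phi> j -` F j))"
        by simp
    qed
    also have "\<dots> = (\<Prod>j\<in>J. emeasure std_complex_gaussian (\<phi> j -` F j))"
      using J F' by (intro gaussian.emeasure_PiM_emb) auto
    also have "\<dots> = (\<Prod>j\<in>J. emeasure std_complex_gaussian (F j))"
    proof (rule prod.cong[OF refl])
      fix j assume j: "j \<in> J"
      have "emeasure (distr std_complex_gaussian borel (\<phi> j)) (F j) = emeasure std_complex_gaussian (\<phi> j -` F j)"
        using F[OF j] by (subst emeasure_distr) simp_all
      then show "emeasure std_complex_gaussian (\<phi> j -` F j) = emeasure std_complex_gaussian (F j)"
        using assms[of j] by (simp add: gaussian_invariant_def)
    qed
    finally show "emeasure (distr (PiM UNIV ?P) (PiM UNIV ?P) (\<lambda>\<gamma> k. \<phi> k (\<gamma> k))) (prod_emb UNIV ?P J (\<Pi>\<^sub>E j\<in>J. F j)) =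
      (\<Prod>j\<in>J. emeasure std_complex_gaussian (F j))" .
  qed simp
qed

lemma nn_integral_gaussian_space_invariant:
  assumes \<phi>: "\<And>k. gaussian_invariant (\<phi> k)" and h: "h \<in> borel_measurable gaussian_space"
  shows "(\<integral>\<^sup>+\<gamma>. h (\<lambda>k. \<phi> k (\<gamma> k)) \<partial>gaussian_space) = (\<integral>\<^sup>+\<gamma>. h \<gamma> \<partial>gaussian_space)"
proof -
  have [measurable]: "\<phi> k \<in> borel_measurable borel" for k
    using \<phi> by (auto simp: gaussian_invariant_def)
  have [measurable]: "\<phi> k \<in> std_complex_gaussian \<rightarrow>\<^sub>M std_complex_gaussian" for k
    using \<phi>[of k] by (simp add: gaussian_invariant_def cong: measurable_cong_sets)
  have "(\<lambda>\<gamma> k. \<phi> k (\<gamma> k)) \<in> gaussian_space \<rightarrow>\<^sub>M gaussian_space"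
    unfolding gaussian_space_def by (rule measurable_PiM_single') (auto simp: space_PiM)
  then have "(\<integral>\<^sup>+\<gamma>. h \<gamma> \<partial>distr gaussian_space gaussian_space (\<lambda>\<gamma> k. \<phi> k (\<gamma> k))) = (\<integral>\<^sup>+\<gamma>. h (\<lambda>k. \<phi> k (\<gamma> k)) \<partial>gaussian_space)"
    using h by (intro nn_integral_distr) simp_all
  then show ?thesis by (simp add: distr_gaussian_space[OF \<phi>])
qed

text \<open>Real and imaginary part contribute 1/2 each. With this normalization the averaging over
  Gaussians costs no constants.\<close>

lemma nn_integral_std_complex_gaussian_square:
  "(\<integral>\<^sup>+z. ennreal ((cmod z)\<^sup>2) \<partial>std_complex_gaussian) = 1"
proof -
  let ?n = "normal_density 0 (1 / sqrt 2)"
  have 0: "(\<integral>\<^sup>+x. ennreal (?n x) \<partial>lborel) = 1"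
    by (subst nn_integral_eq_integral) auto
  have 2: "(\<integral>\<^sup>+x. ennreal (?n x * x\<^sup>2) \<partial>lborel) = ennreal (1 / 2)"
  proof (subst nn_integral_eq_integral)
    show "integrable lborel (\<lambda>x. ?n x * x\<^sup>2)"
      using integrable_normal_moment[of "1 / sqrt 2" 0 2] by simp
    have "integral\<^sup>L lborel (\<lambda>x. ?n x * x\<^sup>2) = 1 / 2"
      using integral_normal_moment_even[of "1 / sqrt 2" 0 1] by (simp add: power_divide fact_numeral)
    then show "ennreal (integral\<^sup>L lborel (\<lambda>x. ?n x * x\<^sup>2)) = ennreal (1 / 2)"
      by (simp only:)
  qed auto
  have "?n x = exp (- x\<^sup>2) / sqrt pi" for x
    by (simp add: normal_density_def power_divide)
  then have n: "exp (- (x\<^sup>2 + y\<^sup>2)) / pi = ?n x * ?n y" for x y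
    by (simp add: mult_exp_exp)
  have "ennreal (?n x * ?n y) * ennreal ((cmod (Complex x y))\<^sup>2) =
      ennreal (?n x * x\<^sup>2) * ennreal (?n y) + ennreal (?n x) * ennreal (?n y * y\<^sup>2)" for x y
  proof -
    have "(?n x * ?n y) * (cmod (Complex x y))\<^sup>2 = (?n x * x\<^sup>2) * ?n y + ?n x * (?n y * y\<^sup>2)"
      by (simp add: cmod_power2 algebra_simps)
    then have "ennreal ((?n x * ?n y) * (cmod (Complex x y))\<^sup>2) = ennreal ((?n x * x\<^sup>2) * ?n y + ?n x * (?n y * y\<^sup>2))"
      by simp
    also have "\<dots> = ennreal (?n x * x\<^sup>2) * ennreal (?n y) + ennreal (?n x) * ennreal (?n y * y\<^sup>2)"
      by (simp add: ennreal_mult ennreal_plus)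
    finally show ?thesis by (simp add: ennreal_mult)
  qed
  then have "(\<integral>\<^sup>+z. ennreal ((cmod z)\<^sup>2) \<partial>std_complex_gaussian) =
      (\<integral>\<^sup>+x. \<integral>\<^sup>+y. ennreal (?n x * x\<^sup>2) * ennreal (?n y) + ennreal (?n x) * ennreal (?n y * y\<^sup>2) \<partial>lborel \<partial>lborel)"
    by (subst nn_integral_std_complex_gaussian) (simp_all only: n, measurable)
  also have "\<dots> = (\<integral>\<^sup>+x. ennreal (?n x * x\<^sup>2) + ennreal (?n x) * ennreal (1 / 2) \<partial>lborel)"
    by (subst nn_integral_add; simp add: nn_integral_cmult 0 2)
  also have "\<dots> = ennreal (1 / 2) + ennreal (1 / 2)"
    by (subst nn_integral_add; simp add: nn_integral_multc 0 2)
  also have "\<dots> = ennreal 1" by (subst ennreal_plus[symmetric]) auto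
  finally show ?thesis by simp
qed

lemma nn_integral_gaussian_space_square:
  "(\<integral>\<^sup>+\<gamma>. ennreal ((cmod (\<gamma> k))\<^sup>2) \<partial>gaussian_space) = 1"
proof -
  have "(\<integral>\<^sup>+z. ennreal ((cmod z)\<^sup>2) \<partial>std_complex_gaussian) =
      (\<integral>\<^sup>+z. ennreal ((cmod z)\<^sup>2) \<partial>distr gaussian_space std_complex_gaussian (\<lambda>\<gamma>. \<gamma> k))"
    unfolding gaussian_space_def by (subst gaussian.PiM_component) auto
  also have "\<dots> = (\<integral>\<^sup>+\<gamma>. ennreal ((cmod (\<gamma> k))\<^sup>2) \<partial>gaussian_space)"
    unfolding gaussian_space_def by (subst nn_integral_distr) simp_all
  finally show ?thesis by (simp add: nn_integral_std_complex_gaussian_square)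
qed

section \<open>Second moments of Gaussian sums\<close>

lemma strongly_measurable_gaussian_sum:
  "strongly_measurable gaussian_space (\<lambda>\<gamma>. \<Sum>k<n. \<gamma> k *\<^sub>C (x k :: 'a::complex_normed_vector))"
  by (intro strongly_measurable_sum strongly_measurable_scaleC strongly_measurable_borel
      strongly_measurable_const measurable_gaussian_coordinate)

lemma measurable_norm_gaussian_sum [measurable]:
  "(\<lambda>\<gamma>. norm (\<Sum>k<n. \<gamma> k *\<^sub>C (x k :: 'a::complex_normed_vector))) \<in> borel_measurable gaussian_space"
  by (rule strongly_measurable_norm[OF strongly_measurable_gaussian_sum])

lemma norm_gaussian_sum_le:
  "(norm (\<Sum>k<n. \<gamma> k *\<^sub>C (x k :: 'a::complex_normed_vector)))\<^sup>2 \<le> (\<Sum>k<n. (cmod (\<gamma> k))\<^sup>2) * (\<Sum>k<n. (norm (x k))\<^sup>2)"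
proof -
  have "norm (\<Sum>k<n. \<gamma> k *\<^sub>C x k) \<le> (\<Sum>k<n. cmod (\<gamma> k) * norm (x k))"
    by (rule order_trans[OF norm_sum]) (simp add: norm_scaleC)
  then have "(norm (\<Sum>k<n. \<gamma> k *\<^sub>C x k))\<^sup>2 \<le> (\<Sum>k<n. cmod (\<gamma> k) * norm (x k))\<^sup>2"
    by (intro power_mono) auto
  also have "\<dots> \<le> (\<Sum>k<n. (cmod (\<gamma> k))\<^sup>2) * (\<Sum>k<n. (norm (x k))\<^sup>2)"
    by (rule Cauchy_Schwarz_ineq_sum)
  finally show ?thesis .
qed

lemma gaussian_norm_nonneg: "gaussian_norm n x \<ge> 0"
  by (simp add: gaussian_norm_def)

text \<open>\<open>gaussian_norm\<close> is defined by a Lebesgue integral, which is zero by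
  convention for a nonintegrable function. Cauchy--Schwarz gives integrability, and from here on
  second moments are handled as nonnegative integrals.\<close>

lemma nn_integral_gaussian_norm:
  "(\<integral>\<^sup>+\<gamma>. ennreal ((norm (\<Sum>k<n. \<gamma> k *\<^sub>C x k))\<^sup>2) \<partial>gaussian_space) = ennreal ((gaussian_norm n x)\<^sup>2)"
proof -
  let ?f = "\<lambda>\<gamma>. (norm (\<Sum>k<n. \<gamma> k *\<^sub>C x k))\<^sup>2"
  let ?X = "\<Sum>k<n. (norm (x k))\<^sup>2"
  have X: "?X \<ge> 0" by (intro sum_nonneg) auto
  have "(\<integral>\<^sup>+\<gamma>. ennreal (?f \<gamma>) \<partial>gaussian_space) \<le> (\<integral>\<^sup>+\<gamma>. (\<Sum>k<n. ennreal ((cmod (\<gamma> k))\<^sup>2)) * ennreal ?X \<partial>gaussian_space)"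
    using ennreal_leI[OF norm_gaussian_sum_le] X
    by (intro nn_integral_mono) (simp add: ennreal_mult sum_nonneg)
  also have "\<dots> = of_nat n * ennreal ?X"
    by (simp add: nn_integral_multc nn_integral_sum nn_integral_gaussian_space_square del: sum_ennreal)
  also have "\<dots> < \<infinity>" by (simp add: ennreal_mult_less_top of_nat_less_top)
  finally have "integrable gaussian_space ?f"
    by (intro integrableI_nonneg) auto
  then show ?thesis
    unfolding gaussian_norm_def by (subst nn_integral_eq_integral) (auto simp: integral_nonneg_AE)
qed

lemma gaussian_norm_invariant:
  assumes "\<And>k. gaussian_invariant (\<phi> k)"
  shows "(\<integral>\<^sup>+\<gamma>. ennreal ((norm (\<Sum>k<n. \<phi> k (\<gamma> k) *\<^sub>C x k))\<^sup>2) \<partial>gaussian_space) = ennreal ((gaussian_norm n x)\<^sup>2)"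
  unfolding nn_integral_gaussian_norm[symmetric]
  by (rule nn_integral_gaussian_space_invariant[OF assms, of "\<lambda>\<gamma>. ennreal ((norm (\<Sum>k<n. \<gamma> k *\<^sub>C x k))\<^sup>2)"]) measurable

text \<open>Orthogonality by symmetry: negating the last Gaussian preserves the second moment, and
  the parallelogram identity removes the cross term from the sum of the two moments.\<close>

lemma gaussian_norm_complex: "(gaussian_norm n (a :: nat \<Rightarrow> complex))\<^sup>2 = (\<Sum>k<n. (cmod (a k))\<^sup>2)"
proof -
  have "(\<integral>\<^sup>+\<gamma>. ennreal ((norm (\<Sum>k<n. \<gamma> k *\<^sub>C a k))\<^sup>2) \<partial>gaussian_space) = ennreal (\<Sum>k<n. (cmod (a k))\<^sup>2)"
  proof (induction n)
    case 0
    show ?case by simp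
  next
    case (Suc n)
    define \<phi> :: "nat \<Rightarrow> complex \<Rightarrow> complex" where "\<phi> k z = (if k = n then - 1 else 1) * z" for k z
    have \<phi>: "gaussian_invariant (\<phi> k)" for k
      unfolding \<phi>_def by (rule gaussian_invariant_mult) auto
    let ?S = "\<lambda>\<gamma>. \<Sum>k<n. \<gamma> k *\<^sub>C a k"
    let ?L = "\<integral>\<^sup>+\<gamma>. ennreal ((cmod (?S \<gamma> + \<gamma> n *\<^sub>C a n))\<^sup>2) \<partial>gaussian_space"
    have "(\<integral>\<^sup>+\<gamma>. ennreal ((norm (\<Sum>k<Suc n. \<phi> k (\<gamma> k) *\<^sub>C a k))\<^sup>2) \<partial>gaussian_space) =
        (\<integral>\<^sup>+\<gamma>. ennreal ((norm (\<Sum>k<Suc n. \<gamma> k *\<^sub>C a k))\<^sup>2) \<partial>gaussian_space)"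
      using gaussian_norm_invariant[where n = "Suc n" and x = a, OF \<phi>] nn_integral_gaussian_norm[where n = "Suc n" and x = a] by simp
    then have flip: "(\<integral>\<^sup>+\<gamma>. ennreal ((cmod (?S \<gamma> - \<gamma> n *\<^sub>C a n))\<^sup>2) \<partial>gaussian_space) = ?L"
      by (simp add: \<phi>_def scaleC_complex_def)
    have [measurable]: "(\<lambda>\<gamma>. ?S \<gamma>) \<in> borel_measurable gaussian_space" "(\<lambda>\<gamma>. \<gamma> n *\<^sub>C a n) \<in> borel_measurable gaussian_space"
      by (simp_all add: scaleC_complex_def)
    have para: "(cmod (s + w))\<^sup>2 + (cmod (s - w))\<^sup>2 = 2 * ((cmod s)\<^sup>2 + (cmod w)\<^sup>2)" for s w
      unfolding cmod_power2 by (simp add: power2_eq_square algebra_simps)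
    have "?L + ?L = (\<integral>\<^sup>+\<gamma>. ennreal ((cmod (?S \<gamma> + \<gamma> n *\<^sub>C a n))\<^sup>2) + ennreal ((cmod (?S \<gamma> - \<gamma> n *\<^sub>C a n))\<^sup>2) \<partial>gaussian_space)"
      by (subst nn_integral_add) (simp_all add: flip)
    also have "\<dots> = (\<integral>\<^sup>+\<gamma>. 2 * (ennreal ((cmod (?S \<gamma>))\<^sup>2) + ennreal ((cmod (\<gamma> n))\<^sup>2) * ennreal ((cmod (a n))\<^sup>2)) \<partial>gaussian_space)"
    proof (rule nn_integral_cong)
      fix \<gamma>
      show "ennreal ((cmod (?S \<gamma> + \<gamma> n *\<^sub>C a n))\<^sup>2) + ennreal ((cmod (?S \<gamma> - \<gamma> n *\<^sub>C a n))\<^sup>2) =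
          2 * (ennreal ((cmod (?S \<gamma>))\<^sup>2) + ennreal ((cmod (\<gamma> n))\<^sup>2) * ennreal ((cmod (a n))\<^sup>2))"
        using para[of "?S \<gamma>" "\<gamma> n *\<^sub>C a n"]
        by (subst ennreal_plus[symmetric]) (simp_all add: norm_scaleC power_mult_distrib ennreal_mult distrib_left)
    qed
    also have "\<dots> = 2 * (ennreal (\<Sum>k<n. (cmod (a k))\<^sup>2) + ennreal ((cmod (a n))\<^sup>2))"
      using Suc.IH by (simp add: nn_integral_cmult nn_integral_add nn_integral_multc nn_integral_gaussian_space_square)
    finally have "2 * ?L = 2 * ennreal (\<Sum>k<Suc n. (cmod (a k))\<^sup>2)"
      by (simp add: mult_2 sum_nonneg ennreal_plus)
    then have "?L = ennreal (\<Sum>k<Suc n. (cmod (a k))\<^sup>2)"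
      by (subst (asm) ennreal_mult_cancel_left) auto
    then show ?case by simp
  qed
  then show ?thesis
    by (simp add: nn_integral_gaussian_norm sum_nonneg)
qed

section \<open>Type, cotype and gamma-boundedness\<close>

lemma powr_sum_2: "(\<Sum>k<n. norm (x k) powr 2) powr (1 / 2) = sqrt (\<Sum>k<n. (norm (x k))\<^sup>2)"
  by (simp add: powr_half_sqrt sum_nonneg)

lemma has_typeD:
  assumes "has_type TYPE('a::complex_banach) s"
  obtains C where "C \<ge> 0" "\<And>n x :: nat \<Rightarrow> 'a. gaussian_norm n x \<le> C * (\<Sum>k<n. norm (x k) powr s) powr (1 / s)"
proof -
  obtain C where C: "\<And>n x :: nat \<Rightarrow> 'a. gaussian_norm n x \<le> C * (\<Sum>k<n. norm (x k) powr s) powr (1 / s)"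
    using assms unfolding has_type_def by blast
  show thesis
  proof (rule that[of "max C 0"])
    fix n and x :: "nat \<Rightarrow> 'a"
    show "gaussian_norm n x \<le> max C 0 * (\<Sum>k<n. norm (x k) powr s) powr (1 / s)"
      by (rule order_trans[OF C mult_right_mono]) auto
  qed simp
qed

lemma has_cotypeD:
  assumes "has_cotype TYPE('a::complex_banach) s"
  obtains C where "C \<ge> 0" "\<And>n x :: nat \<Rightarrow> 'a. (\<Sum>k<n. norm (x k) powr s) powr (1 / s) \<le> C * gaussian_norm n x"
proof -
  obtain C where C: "\<And>n x :: nat \<Rightarrow> 'a. (\<Sum>k<n. norm (x k) powr s) powr (1 / s) \<le> C * gaussian_norm n x"
    using assms unfolding has_cotype_def by blast
  show thesis
  proof (rule that[of "max C 0"])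
    fix n and x :: "nat \<Rightarrow> 'a"
    show "(\<Sum>k<n. norm (x k) powr s) powr (1 / s) \<le> max C 0 * gaussian_norm n x"
      by (rule order_trans[OF C mult_right_mono]) (auto simp: gaussian_norm_nonneg)
  qed simp
qed

lemma gaussian_norm_complex_sqrt: "gaussian_norm n (a :: nat \<Rightarrow> complex) = sqrt (\<Sum>k<n. (cmod (a k))\<^sup>2)"
  by (metis gaussian_norm_complex gaussian_norm_nonneg real_sqrt_unique)

lemma has_type_2_complex: "has_type TYPE(complex) 2"
  unfolding has_type_def powr_sum_2 by (auto simp: gaussian_norm_complex_sqrt intro!: exI[of _ 1])

lemma has_cotype_2_complex: "has_cotype TYPE(complex) 2"
  unfolding has_cotype_def powr_sum_2 by (auto simp: gaussian_norm_complex_sqrt intro!: exI[of _ 1])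

text \<open>Square sums mediate: type 2 of the target bounds the left side by a square sum, the
  operator bound acts on it term by term, and cotype 2 of the source leads back to a Gaussian
  norm.\<close>

lemma gamma_bounded_of_bounded:
  fixes \<T> :: "('x::complex_banach, 'y::complex_banach) cblinfun set"
  assumes "has_cotype TYPE('x) 2" "has_type TYPE('y) 2" and B: "\<And>T. T \<in> \<T> \<Longrightarrow> norm T \<le> B"
  shows "gamma_bounded \<T>"
proof -
  obtain C1 where C1: "C1 \<ge> 0" "\<And>n x :: nat \<Rightarrow> 'x. sqrt (\<Sum>k<n. (norm (x k))\<^sup>2) \<le> C1 * gaussian_norm n x"
    using assms(1) by (rule has_cotypeD) (simp only: powr_sum_2)
  obtain C2 where C2: "C2 \<ge> 0" "\<And>n y :: nat \<Rightarrow> 'y. gaussian_norm n y \<le> C2 * sqrt (\<Sum>k<n. (norm (y k))\<^sup>2)"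
    using assms(2) by (rule has_typeD) (simp only: powr_sum_2)
  define D where "D = max B 0"
  have D: "D \<ge> 0" "\<And>T. T \<in> \<T> \<Longrightarrow> norm T \<le> D"
    using B by (auto simp: D_def intro: max.coboundedI1)
  have "gaussian_norm n (\<lambda>k. cblinfun_apply (T k) (x k)) \<le> C2 * D * C1 * gaussian_norm n x"
    if T: "\<forall>k<n. T k \<in> \<T>" for n T x
  proof -
    have "(\<Sum>k<n. (norm (cblinfun_apply (T k) (x k)))\<^sup>2) \<le> (\<Sum>k<n. (D * norm (x k))\<^sup>2)"
      using T D by (intro sum_mono power_mono order_trans[OF norm_cblinfun_apply] mult_right_mono) auto
    also have "\<dots> = D\<^sup>2 * (\<Sum>k<n. (norm (x k))\<^sup>2)"
      by (simp add: power_mult_distrib sum_distrib_left)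
    finally have "sqrt (\<Sum>k<n. (norm (cblinfun_apply (T k) (x k)))\<^sup>2) \<le> sqrt (D\<^sup>2 * (\<Sum>k<n. (norm (x k))\<^sup>2))"
      by (rule real_sqrt_le_mono)
    also have "\<dots> = D * sqrt (\<Sum>k<n. (norm (x k))\<^sup>2)"
      using D(1) by (simp add: real_sqrt_mult)
    finally have *: "sqrt (\<Sum>k<n. (norm (cblinfun_apply (T k) (x k)))\<^sup>2) \<le> D * sqrt (\<Sum>k<n. (norm (x k))\<^sup>2)" .
    have "gaussian_norm n (\<lambda>k. cblinfun_apply (T k) (x k)) \<le> C2 * sqrt (\<Sum>k<n. (norm (cblinfun_apply (T k) (x k)))\<^sup>2)"
      by (rule C2)
    also have "\<dots> \<le> C2 * (D * (C1 * gaussian_norm n x))"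
      using C2(1) D(1) by (intro mult_left_mono order_trans[OF *] C1) auto
    finally show ?thesis by (simp add: mult.assoc)
  qed
  moreover have "C2 * D * C1 \<ge> 0" using C1 C2 D by simp
  ultimately show ?thesis unfolding gamma_bounded_def by blast
qed

lemma cblinfun_apply_scaleC_left: "cblinfun_apply (c *\<^sub>C T) x = c *\<^sub>C cblinfun_apply T x"
  by transfer (simp add: bounded_linear_Blinfun_apply[OF bounded_linear_scaleC])

lemma integrable_gaussian_product:
  "integrable gaussian_space (\<lambda>\<gamma>. cnj (\<gamma> k) * \<gamma> j)"
proof (rule integrableI_bounded)
  have "(\<integral>\<^sup>+\<gamma>. ennreal (norm (cnj (\<gamma> k) * \<gamma> j)) \<partial>gaussian_space) \<le>
      (\<integral>\<^sup>+\<gamma>. ennreal ((cmod (\<gamma> k))\<^sup>2) + ennreal ((cmod (\<gamma> j))\<^sup>2) \<partial>gaussian_space)"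
  proof (rule nn_integral_mono)
    fix \<gamma> :: "nat \<Rightarrow> complex"
    have "cmod (\<gamma> k) * cmod (\<gamma> j) \<le> (cmod (\<gamma> k))\<^sup>2 + (cmod (\<gamma> j))\<^sup>2"
      using sum_squares_bound[of "cmod (\<gamma> k)" "cmod (\<gamma> j)"]
        mult_nonneg_nonneg[OF norm_ge_zero[of "\<gamma> k"] norm_ge_zero[of "\<gamma> j"]]
      by linarith
    then show "ennreal (norm (cnj (\<gamma> k) * \<gamma> j)) \<le> ennreal ((cmod (\<gamma> k))\<^sup>2) + ennreal ((cmod (\<gamma> j))\<^sup>2)"
      by (simp add: norm_mult ennreal_leI flip: ennreal_plus)
  qed
  also have "\<dots> = 2"
    by (subst nn_integral_add) (simp_all add: nn_integral_gaussian_space_square)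
  finally show "(\<integral>\<^sup>+\<gamma>. ennreal (norm (cnj (\<gamma> k) * \<gamma> j)) \<partial>gaussian_space) < \<infinity>"
    by (rule le_less_trans) simp
qed measurable

text \<open>Off the diagonal, negating the coordinate \<open>j\<close> alone preserves the law and
  reverses the sign of the expectation.\<close>

lemma integral_gaussian_product:
  "integral\<^sup>L gaussian_space (\<lambda>\<gamma>. cnj (\<gamma> k) * \<gamma> j) = (if k = j then 1 else 0)"
proof (cases "k = j")
  case True
  have "integral\<^sup>L gaussian_space (\<lambda>\<gamma>. (cmod (\<gamma> k))\<^sup>2) = 1"
    by (subst integral_eq_nn_integral) (auto simp: nn_integral_gaussian_space_square)
  moreover have "cnj z * z = complex_of_real ((cmod z)\<^sup>2)" for z
    using complex_norm_square[of z] by (simp add: mult.commute)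
  ultimately have "integral\<^sup>L gaussian_space (\<lambda>\<gamma>. cnj (\<gamma> k) * \<gamma> k) = complex_of_real 1"
    by (simp only: integral_complex_of_real)
  then show ?thesis using True by simp
next
  case False
  define \<phi> :: "nat \<Rightarrow> complex \<Rightarrow> complex" where "\<phi> i z = (if i = j then - 1 else 1) * z" for i z
  have \<phi>: "gaussian_invariant (\<phi> i)" for i
    unfolding \<phi>_def by (rule gaussian_invariant_mult) auto
  have [measurable]: "\<phi> i \<in> borel_measurable borel" for i unfolding \<phi>_def by measurable
  have [measurable]: "(\<lambda>\<gamma> i. \<phi> i (\<gamma> i)) \<in> gaussian_space \<rightarrow>\<^sub>M gaussian_space"
    unfolding gaussian_space_def
    by (rule measurable_PiM_single')
      (auto simp: space_PiM intro!: measurable_compose[OF measurable_component_singleton] cong: measurable_cong_sets)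
  have "integral\<^sup>L gaussian_space (\<lambda>\<gamma>. cnj (\<gamma> k) * \<gamma> j) =
      integral\<^sup>L (distr gaussian_space gaussian_space (\<lambda>\<gamma> i. \<phi> i (\<gamma> i))) (\<lambda>\<gamma>. cnj (\<gamma> k) * \<gamma> j)"
    by (simp add: distr_gaussian_space[OF \<phi>])
  also have "\<dots> = integral\<^sup>L gaussian_space (\<lambda>\<gamma>. cnj (\<phi> k (\<gamma> k)) * \<phi> j (\<gamma> j))"
    by (rule integral_distr) measurable
  also have "\<dots> = - integral\<^sup>L gaussian_space (\<lambda>\<gamma>. cnj (\<gamma> k) * \<gamma> j)"
    using False by (simp add: \<phi>_def)
  finally show ?thesis using False by simp
qed

text \<open>Let \<open>y k\<close> be a norming functional of \<open>x k\<close>, scaled by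
  \<open>norm (x k)\<close>. The expected pairing of the Gaussian sum of \<open>x\<close> with the
  conjugate Gaussian sum of \<open>y\<close> is the square sum of the norms. Cauchy--Schwarz and
  type 2 of the dual bound it by its own square root times
  \<open>C * gaussian_norm n x\<close>.\<close>

lemma has_cotype_2_of_dual:
  assumes "has_type TYPE(('x::complex_banach, complex) cblinfun) 2"
  shows "has_cotype TYPE('x) 2"
proof -
  obtain C where C: "C \<ge> 0"
    "\<And>n y :: nat \<Rightarrow> ('x, complex) cblinfun. gaussian_norm n y \<le> C * sqrt (\<Sum>k<n. (norm (y k))\<^sup>2)"
    using assms by (rule has_typeD) (simp only: powr_sum_2)
  have "sqrt (\<Sum>k<n. (norm (x k))\<^sup>2) \<le> C * gaussian_norm n x" for n and x :: "nat \<Rightarrow> 'x"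
  proof -
    have "\<forall>k. \<exists>\<nu> :: ('x, complex) cblinfun. norm \<nu> \<le> 1 \<and> cblinfun_apply \<nu> (x k) = of_real (norm (x k))"
      using exists_norming_functional by blast
    then obtain \<nu> :: "nat \<Rightarrow> ('x, complex) cblinfun"
      where \<nu>: "\<And>k. norm (\<nu> k) \<le> 1" "\<And>k. cblinfun_apply (\<nu> k) (x k) = of_real (norm (x k))"
      by metis
    define y where "y k = norm (x k) *\<^sub>R \<nu> k" for k
    have y_norm: "norm (y k) \<le> norm (x k)" for k
      using mult_left_mono[OF \<nu>(1)[of k], of "norm (x k)"] by (simp add: y_def)
    have y_apply: "cblinfun_apply (y k) (x k) = of_real ((norm (x k))\<^sup>2)" for k
      by (simp add: y_def cblinfun.scaleR_left \<nu> power2_eq_square scaleR_conv_of_real)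
    let ?X = "\<lambda>\<gamma>. \<Sum>k<n. \<gamma> k *\<^sub>C x k" and ?Y = "\<lambda>\<gamma>. \<Sum>k<n. cnj (\<gamma> k) *\<^sub>C y k"
    have expand: "cblinfun_apply (?Y \<gamma>) (?X \<gamma>) = (\<Sum>j<n. \<Sum>k<n. cnj (\<gamma> k) * \<gamma> j * cblinfun_apply (y k) (x j))" for \<gamma>
      by (simp add: cblinfun.sum_left cblinfun.sum_right cblinfun_apply_scaleC cblinfun_apply_scaleC_left
          scaleC_complex_def sum_distrib_left ac_simps)
    have "integral\<^sup>L gaussian_space (\<lambda>\<gamma>. cblinfun_apply (?Y \<gamma>) (?X \<gamma>)) =
        (\<Sum>j<n. \<Sum>k<n. (if k = j then 1 else 0) * cblinfun_apply (y k) (x j))"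
      by (simp add: expand Bochner_Integration.integral_sum integrable_gaussian_product integral_gaussian_product)
    also have "\<dots> = (\<Sum>k<n. cblinfun_apply (y k) (x k))"
      by (intro sum.cong refl) (simp add: if_distrib[of "\<lambda>c. c * _"] cong: if_cong)
    also have "\<dots> = of_real (\<Sum>k<n. (norm (x k))\<^sup>2)" by (simp add: y_apply)
    finally have int: "integral\<^sup>L gaussian_space (\<lambda>\<gamma>. cblinfun_apply (?Y \<gamma>) (?X \<gamma>)) = of_real (\<Sum>k<n. (norm (x k))\<^sup>2)" .
    \<comment> \<open>Conjugate Gaussians are paired with Gaussians so that the diagonal survives;
      conjugation does not change their law.\<close>
    have Y: "(\<integral>\<^sup>+\<gamma>. ennreal ((norm (?Y \<gamma>))\<^sup>2) \<partial>gaussian_space) = ennreal ((gaussian_norm n y)\<^sup>2)"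
      by (rule gaussian_norm_invariant) (rule gaussian_invariant_cnj)
    have measY: "(\<lambda>\<gamma>. norm (?Y \<gamma>)) \<in> borel_measurable gaussian_space"
      by (intro strongly_measurable_norm strongly_measurable_sum strongly_measurable_scaleC
          strongly_measurable_borel strongly_measurable_const) measurable
    have "ennreal (\<Sum>k<n. (norm (x k))\<^sup>2) = ennreal (norm (integral\<^sup>L gaussian_space (\<lambda>\<gamma>. cblinfun_apply (?Y \<gamma>) (?X \<gamma>))))"
      unfolding int norm_of_real by (simp add: sum_nonneg)
    also have "\<dots> \<le> (\<integral>\<^sup>+\<gamma>. norm (cblinfun_apply (?Y \<gamma>) (?X \<gamma>)) \<partial>gaussian_space)"
      by (rule integral_norm_bound_ennreal) (simp add: expand integrable_gaussian_product)
    also have "\<dots> \<le> (\<integral>\<^sup>+\<gamma>. norm (?Y \<gamma>) * norm (?X \<gamma>) \<partial>gaussian_space)"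
      by (intro nn_integral_mono ennreal_leI norm_cblinfun_apply)
    also have "\<dots> \<le> ennreal (gaussian_norm n y * gaussian_norm n x)"
      using measY
      by (intro nn_integral_Hoelder[of 2 2])
        (simp_all add: gaussian_norm_nonneg Y nn_integral_gaussian_norm)
    finally have "(\<Sum>k<n. (norm (x k))\<^sup>2) \<le> gaussian_norm n y * gaussian_norm n x"
      by (simp add: gaussian_norm_nonneg)
    also have "gaussian_norm n y \<le> C * sqrt (\<Sum>k<n. (norm (x k))\<^sup>2)"
      using C(1) y_norm by (intro order_trans[OF C(2)] mult_left_mono real_sqrt_le_mono sum_mono power_mono) auto
    finally have *: "(\<Sum>k<n. (norm (x k))\<^sup>2) \<le> C * sqrt (\<Sum>k<n. (norm (x k))\<^sup>2) * gaussian_norm n x"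
      by (simp add: gaussian_norm_nonneg mult_right_mono)
    define S where "S = sqrt (\<Sum>k<n. (norm (x k))\<^sup>2)"
    have S: "S \<ge> 0" "S * S = (\<Sum>k<n. (norm (x k))\<^sup>2)" by (simp_all add: S_def sum_nonneg)
    have "S * S \<le> S * (C * gaussian_norm n x)" using * S by (simp add: S_def ac_simps)
    then have "S \<le> C * gaussian_norm n x"
      using S(1) C(1) gaussian_norm_nonneg[of n x] by (cases "S = 0") auto
    then show ?thesis by (simp add: S_def)
  qed
  then show ?thesis unfolding has_cotype_def powr_sum_2 by auto
qed

section \<open>Gaussian test functions\<close>

text \<open>Differentiating a Gaussian produces a coordinate factor, so Gaussians alone are not
  closed under derivatives; this class is. It serves to show by induction on the iterated
  derivatives that the bumps are Schwartz functions.\<close>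

inductive gaussian_poly :: "(real ^ 'd::finite \<Rightarrow> 'x::real_normed_vector) \<Rightarrow> bool" where
  gauss: "gaussian_poly (\<lambda>t. exp (- pi * (norm (t - a))\<^sup>2) *\<^sub>R x)"
| add: "gaussian_poly f \<Longrightarrow> gaussian_poly g \<Longrightarrow> gaussian_poly (\<lambda>t. f t + g t)"
| scale: "gaussian_poly f \<Longrightarrow> gaussian_poly (\<lambda>t. c *\<^sub>R f t)"
| coord: "gaussian_poly f \<Longrightarrow> gaussian_poly (\<lambda>t. (t $ j) *\<^sub>R f t)"

lemma gaussian_poly_derivative:
  fixes f :: "real ^ 'd::finite \<Rightarrow> 'x::real_normed_vector"
  assumes "gaussian_poly f"
  shows "\<exists>f'. (\<forall>t. (f has_derivative f' t) (at t)) \<and> gaussian_poly (\<lambda>t. f' t (axis j 1))"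
  using assms
proof (induction f rule: gaussian_poly.induct)
  case (gauss a x)
  let ?g = "\<lambda>t. exp (- pi * (norm (t - a))\<^sup>2) *\<^sub>R x"
  let ?f' = "\<lambda>t h. (exp (- pi * ((t - a) \<bullet> (t - a))) * (- pi * (2 * ((t - a) \<bullet> h)))) *\<^sub>R x"
  have "(?g has_derivative ?f' t) (at t)" for t
    unfolding power2_norm_eq_inner
    by (rule derivative_eq_intros refl ext | simp)+ (simp add: inner_commute algebra_simps)
  moreover have "gaussian_poly (\<lambda>t. ?f' t (axis j 1))"
  proof -
    have eq: "?f' t (axis j 1) = (- 2 * pi) *\<^sub>R ((t $ j) *\<^sub>R ?g t) + (2 * pi * (a $ j)) *\<^sub>R ?g t" for t
      by (simp add: inner_axis power2_norm_eq_inner scaleR_left_distrib[symmetric] algebra_simps)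
    show ?thesis unfolding eq by (intro gaussian_poly.intros)
  qed
  ultimately show ?case by (intro exI[of _ ?f'] conjI allI)
next
  case (add f g)
  then obtain f' g' where "\<And>t. (f has_derivative f' t) (at t)" "gaussian_poly (\<lambda>t. f' t (axis j 1))"
    "\<And>t. (g has_derivative g' t) (at t)" "gaussian_poly (\<lambda>t. g' t (axis j 1))"
    by blast
  then show ?case
    by (intro exI[of _ "\<lambda>t h. f' t h + g' t h"]) (auto intro: has_derivative_add gaussian_poly.add)
next
  case (scale f c)
  then obtain f' where "\<And>t. (f has_derivative f' t) (at t)" "gaussian_poly (\<lambda>t. f' t (axis j 1))"
    by blast
  then show ?case
    by (intro exI[of _ "\<lambda>t h. c *\<^sub>R f' t h"]) (auto intro: has_derivative_scaleR_right gaussian_poly.scale)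
next
  case (coord f k)
  then obtain f' where f': "\<And>t. (f has_derivative f' t) (at t)" "gaussian_poly (\<lambda>t. f' t (axis j 1))"
    by blast
  have "((\<lambda>t. (t $ k) *\<^sub>R f t) has_derivative (\<lambda>h. (t $ k) *\<^sub>R f' t h + (h $ k) *\<^sub>R f t)) (at t)" for t
    by (intro has_derivative_scaleR f' bounded_linear.has_derivative[OF bounded_linear_vec_nth] has_derivative_ident)
  moreover have "gaussian_poly (\<lambda>t. (t $ k) *\<^sub>R f' t (axis j 1) + (axis j 1 $ k :: real) *\<^sub>R f t)"
    by (intro gaussian_poly.intros f' coord.hyps)
  ultimately show ?case
    by (intro exI[of _ "\<lambda>t h. (t $ k) *\<^sub>R f' t h + (h $ k) *\<^sub>R f t"]) simp
qed

lemma power_le_fact_exp: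
  fixes x :: real
  assumes "x \<ge> 0"
  shows "x ^ N \<le> fact N * exp x"
proof -
  have "x ^ N / fact N \<le> (\<Sum>n<Suc N. x ^ n / fact n)"
    using assms by (intro member_le_sum) auto
  also have "\<dots> \<le> exp x"
    unfolding exp_def using assms summable_exp_generic[of x]
    by (intro order_trans[OF sum_le_suminf]) (auto simp: scaleR_conv_of_real field_simps)
  finally show ?thesis by (simp add: field_simps)
qed

text \<open>The induction keeps \<open>N\<close> arbitrary because a coordinate factor is absorbed
  by passing to \<open>Suc N\<close>.\<close>

lemma gaussian_poly_decay:
  fixes f :: "real ^ 'd::finite \<Rightarrow> 'x::real_normed_vector"
  assumes "gaussian_poly f"
  shows "\<exists>C. \<forall>t. norm t ^ N * norm (f t) \<le> C"
  using assms
proof (induction f arbitrary: N rule: gaussian_poly.induct)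
  case (gauss a x)
  show ?case
  proof (intro exI allI)
    fix t :: "real ^ 'd"
    \<comment> \<open>The power costs a factor \<open>exp (norm t)\<close>, and
      \<open>norm t\<close> is at most \<open>1 + pi * (norm (t - a))\<^sup>2 + norm a\<close>; the
      Gaussian cancels the quadratic term exactly.\<close>
    have "norm t ^ N \<le> fact N * exp (norm t)"
      by (intro power_le_fact_exp) simp
    also have "norm t \<le> norm (t - a) + norm a"
      using norm_triangle_ineq[of "t - a" a] by simp
    also have "norm (t - a) \<le> 1 + pi * (norm (t - a))\<^sup>2"
    proof -
      have "norm (t - a) \<le> 1 + (norm (t - a))\<^sup>2"
        using sum_squares_bound[of "norm (t - a)" 1] norm_ge_zero[of "t - a"] by (simp, linarith)
      also have "\<dots> \<le> 1 + pi * (norm (t - a))\<^sup>2"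
        using pi_gt3 mult_right_mono[of 1 pi "(norm (t - a))\<^sup>2"] by simp
      finally show ?thesis .
    qed
    finally have "norm t ^ N \<le> fact N * exp (1 + pi * (norm (t - a))\<^sup>2 + norm a)"
      by simp
    then have "norm t ^ N * exp (- pi * (norm (t - a))\<^sup>2) \<le>
        fact N * exp (1 + pi * (norm (t - a))\<^sup>2 + norm a) * exp (- pi * (norm (t - a))\<^sup>2)"
      by (intro mult_right_mono) auto
    also have "\<dots> = fact N * exp (1 + norm a)"
      by (simp add: mult_exp_exp mult.assoc)
    finally have "norm t ^ N * exp (- pi * (norm (t - a))\<^sup>2) * norm x \<le> fact N * exp (1 + norm a) * norm x"
      by (intro mult_right_mono) auto
    then show "norm t ^ N * norm (exp (- pi * (norm (t - a))\<^sup>2) *\<^sub>R x) \<le> fact N * exp (1 + norm a) * norm x"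
      by (simp add: mult.assoc)
  qed
next
  case (add f g)
  obtain C D where C: "\<And>t. norm t ^ N * norm (f t) \<le> C" and D: "\<And>t. norm t ^ N * norm (g t) \<le> D"
    using add.IH[of N] by blast
  have "norm t ^ N * norm (f t + g t) \<le> C + D" for t
    using mult_left_mono[OF norm_triangle_ineq[of "f t" "g t"], of "norm t ^ N"] C[of t] D[of t]
    by (simp add: distrib_left)
  then show ?case by blast
next
  case (scale f c)
  obtain C where C: "\<And>t. norm t ^ N * norm (f t) \<le> C"
    using scale.IH[of N] by blast
  have "norm t ^ N * norm (c *\<^sub>R f t) \<le> \<bar>c\<bar> * C" for t
    using mult_left_mono[OF C[of t], of "\<bar>c\<bar>"] by (simp add: mult_ac)
  then show ?case by blast
next
  case (coord f j)
  obtain C where C: "\<And>t. norm t ^ Suc N * norm (f t) \<le> C"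
    using coord.IH[of "Suc N"] by blast
  have "norm t ^ N * norm ((t $ j) *\<^sub>R f t) \<le> C" for t
  proof -
    have "norm t ^ N * (\<bar>t $ j\<bar> * norm (f t)) \<le> norm t ^ N * (norm t * norm (f t))"
      by (intro mult_left_mono mult_right_mono component_le_norm_cart) auto
    then show ?thesis using C[of t] by (simp add: mult_ac)
  qed
  then show ?case by blast
qed

lemma gaussian_poly_iterated_partial:
  "gaussian_poly f \<Longrightarrow> gaussian_poly (iterated_partial js f)"
proof (induction js)
  case (Cons j js)
  then obtain f' where f': "\<And>t. (iterated_partial js f has_derivative f' t) (at t)"
    "gaussian_poly (\<lambda>t. f' t (axis j 1))"
    using gaussian_poly_derivative by blast
  then have "frechet_derivative (iterated_partial js f) (at t) = f' t" for t
    using frechet_derivative_at by metis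
  then show ?case using f' by simp
qed simp

lemma schwartz_gaussian_poly:
  assumes "gaussian_poly f"
  shows "schwartz f"
  unfolding schwartz_def
proof (intro allI conjI)
  fix js t
  have "gaussian_poly (iterated_partial js f)"
    using assms by (rule gaussian_poly_iterated_partial)
  then show "iterated_partial js f differentiable (at t)"
    using gaussian_poly_derivative unfolding differentiable_def by blast
  show "\<exists>C. \<forall>t. norm t ^ N * norm (iterated_partial js f t) \<le> C" for N
    using gaussian_poly_iterated_partial[OF assms] by (rule gaussian_poly_decay)
qed

lemma gaussian_poly_sum:
  "finite J \<Longrightarrow> (\<And>k. k \<in> J \<Longrightarrow> gaussian_poly (f k)) \<Longrightarrow> gaussian_poly (\<lambda>t. \<Sum>k\<in>J. f k t)"
proof (induction J rule: finite_induct)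
  case empty
  then show ?case using gaussian_poly.gauss[of 0 0] by simp
qed (simp add: gaussian_poly.add)

text \<open>The characteristic function of the standard normal law, after substituting
  \<open>sqrt (2 * pi) * (x - c)\<close>. Moving the centre to \<open>c\<close> contributes only a
  phase.\<close>

lemma
  fixes s c :: real
  shows integrable_gaussian_exp: "integrable lborel (\<lambda>u. exp (\<i> * of_real (s * u)) * of_real (exp (- pi * (u - c)\<^sup>2)))"
    and integral_gaussian_exp: "integral\<^sup>L lborel (\<lambda>u. exp (\<i> * of_real (s * u)) * of_real (exp (- pi * (u - c)\<^sup>2))) =
      exp (\<i> * of_real (s * c)) * of_real (exp (- s\<^sup>2 / (4 * pi)))"
proof -
  let ?f = "\<lambda>c u. exp (\<i> * of_real (s * u)) * complex_of_real (exp (- pi * (u - c)\<^sup>2))"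
  have int0: "integrable lborel (\<lambda>u::real. exp (- pi * (u - c)\<^sup>2))"
  proof -
    have "normal_density c (1 / sqrt (2 * pi)) u = exp (- pi * (u - c)\<^sup>2)" for u
      by (simp add: normal_density_def power_divide)
    then show ?thesis
      using integrable_normal_density[of "1 / sqrt (2 * pi)" c] by (simp cong: Bochner_Integration.integrable_cong)
  qed
  show "integrable lborel (?f c)"
    by (rule Bochner_Integration.integrable_bound[OF int0]) (auto simp: norm_mult)
  \<comment> \<open>The frequency seen by the standard normal variable after rescaling;
    \<open>t\<^sup>2 / 2\<close> equals \<open>s\<^sup>2 / (4 * pi)\<close>.\<close>
  define t where "t = s / sqrt (2 * pi)"
  have "(CLINT x|std_normal_distribution. iexp (t * x)) = exp (- (t\<^sup>2) / 2)"
    using char_std_normal_distribution by (simp add: char_def fun_eq_iff)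
  also have "(CLINT x|std_normal_distribution. iexp (t * x)) = (CLINT x|lborel. std_normal_density x *\<^sub>R iexp (t * x))"
    by (rule integral_density) auto
  also have "\<dots> = \<bar>sqrt (2 * pi)\<bar> *\<^sub>R (CLINT x|lborel. std_normal_density (- sqrt (2 * pi) * c + sqrt (2 * pi) * x) *\<^sub>R iexp (t * (- sqrt (2 * pi) * c + sqrt (2 * pi) * x)))"
    by (rule lborel_integral_real_affine) simp
  also have "\<dots> = (CLINT x|lborel. sqrt (2 * pi) *\<^sub>R (std_normal_density (- sqrt (2 * pi) * c + sqrt (2 * pi) * x) *\<^sub>R iexp (t * (- sqrt (2 * pi) * c + sqrt (2 * pi) * x))))"
    by (subst Bochner_Integration.integral_scaleR_right) simp
  also have "\<dots> = (CLINT x|lborel. exp (- (\<i> * of_real (s * c))) * ?f c x)"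
  proof (rule Bochner_Integration.integral_cong[OF refl])
    fix x :: real
    have 1: "- sqrt (2 * pi) * c + sqrt (2 * pi) * x = sqrt (2 * pi) * (x - c)" by (simp add: algebra_simps)
    have 2: "sqrt (2 * pi) * std_normal_density (sqrt (2 * pi) * (x - c)) = exp (- pi * (x - c)\<^sup>2)"
      by (simp add: std_normal_density_def power_mult_distrib)
    have 3: "iexp (t * (sqrt (2 * pi) * (x - c))) = exp (- (\<i> * of_real (s * c))) * exp (\<i> * of_real (s * x))"
      by (simp add: t_def mult_exp_exp algebra_simps)
    show "sqrt (2 * pi) *\<^sub>R (std_normal_density (- sqrt (2 * pi) * c + sqrt (2 * pi) * x) *\<^sub>R iexp (t * (- sqrt (2 * pi) * c + sqrt (2 * pi) * x))) =
       exp (- (\<i> * of_real (s * c))) * ?f c x"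
      unfolding 1 3 scaleR_scaleR 2 by (simp add: scaleR_conv_of_real mult_ac)
  qed
  also have "\<dots> = exp (- (\<i> * of_real (s * c))) * (CLINT x|lborel. ?f c x)"
    by simp
  finally have *: "exp (- (\<i> * of_real (s * c))) * (CLINT x|lborel. ?f c x) = of_real (exp (- (t\<^sup>2) / 2))"
    by simp
  have cancel: "exp (\<i> * of_real (s * c)) * (exp (- (\<i> * of_real (s * c))) * z) = z" for z
    by (simp add: exp_minus)
  have t: "- (t\<^sup>2) / 2 = - s\<^sup>2 / (4 * pi)"
    by (simp add: t_def power_divide)
  have "(CLINT u|lborel. ?f c u) = exp (\<i> * of_real (s * c)) * (exp (- (\<i> * of_real (s * c))) * (CLINT x|lborel. ?f c x))"
    by (rule cancel[symmetric])
  also have "\<dots> = exp (\<i> * of_real (s * c)) * of_real (exp (- s\<^sup>2 / (4 * pi)))"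
    unfolding * t ..
  finally show "(CLINT u|lborel. ?f c u) = exp (\<i> * of_real (s * c)) * of_real (exp (- s\<^sup>2 / (4 * pi)))" .
qed

lemma
  fixes h :: "'a::euclidean_space \<Rightarrow> real \<Rightarrow> complex"
  assumes h: "\<And>b. b \<in> Basis \<Longrightarrow> integrable lborel (h b)"
  shows integrable_lborel_prod_Basis: "integrable lborel (\<lambda>t::'a. \<Prod>b\<in>Basis. h b (t \<bullet> b))"
    and integral_lborel_prod_Basis:
      "integral\<^sup>L lborel (\<lambda>t::'a. \<Prod>b\<in>Basis. h b (t \<bullet> b)) = (\<Prod>b\<in>Basis. integral\<^sup>L lborel (h b))"
proof -
  interpret product_sigma_finite "\<lambda>_::'a. lborel :: real measure" ..
  let ?T = "\<lambda>f. \<Sum>b\<in>Basis. f b *\<^sub>R (b::'a)"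
  have lb: "(lborel :: 'a measure) = distr (\<Pi>\<^sub>M b\<in>Basis. lborel) borel ?T"
    by (rule lborel_eq)
  have h_meas: "h b \<in> borel_measurable borel" if "b \<in> Basis" for b
    using borel_measurable_integrable[OF h[OF that]] by simp
  have T: "?T \<in> (\<Pi>\<^sub>M b\<in>Basis. lborel) \<rightarrow>\<^sub>M (borel :: 'a measure)"
    by measurable
  have meas: "(\<lambda>t::'a. \<Prod>b\<in>Basis. h b (t \<bullet> b)) \<in> borel_measurable borel"
    by (intro borel_measurable_prod measurable_compose[OF _ h_meas]) measurable
  have comp: "(\<Prod>b\<in>Basis. h b (?T f \<bullet> b)) = (\<Prod>b\<in>Basis. h b (f b))" for f
    by (rule prod.cong) (auto simp: inner_sum_left inner_Basis if_distrib cong: if_cong)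
  show "integrable lborel (\<lambda>t::'a. \<Prod>b\<in>Basis. h b (t \<bullet> b))"
    unfolding lb using product_integrable_prod[OF finite_Basis h]
    by (subst integrable_distr_eq[OF T meas]) (simp add: comp)
  show "integral\<^sup>L lborel (\<lambda>t::'a. \<Prod>b\<in>Basis. h b (t \<bullet> b)) = (\<Prod>b\<in>Basis. integral\<^sup>L lborel (h b))"
    unfolding lb using product_integral_prod[OF finite_Basis h]
    by (subst integral_distr[OF T meas]) (simp add: comp)
qed

lemma
  fixes s a :: "'a::euclidean_space"
  shows integrable_gaussian_character:
      "integrable lborel (\<lambda>t. exp (\<i> * of_real (s \<bullet> t)) * of_real (exp (- pi * (norm (t - a))\<^sup>2)))"
    and integral_gaussian_character:
      "integral\<^sup>L lborel (\<lambda>t. exp (\<i> * of_real (s \<bullet> t)) * of_real (exp (- pi * (norm (t - a))\<^sup>2))) =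
        exp (\<i> * of_real (s \<bullet> a)) * of_real (exp (- (norm s)\<^sup>2 / (4 * pi)))"
proof -
  let ?h = "\<lambda>b u. exp (\<i> * of_real ((s \<bullet> b) * u)) * complex_of_real (exp (- pi * (u - a \<bullet> b)\<^sup>2))"
  have norm2: "(norm (x::'a))\<^sup>2 = (\<Sum>b\<in>Basis. (x \<bullet> b)\<^sup>2)" for x
    by (subst power2_norm_eq_inner, subst euclidean_inner) (simp add: power2_eq_square)
  have exp_inner: "exp (\<i> * complex_of_real (s \<bullet> x)) = (\<Prod>b\<in>Basis. exp (\<i> * of_real ((s \<bullet> b) * (x \<bullet> b))))" for x
    by (subst euclidean_inner) (simp only: of_real_sum sum_distrib_left exp_sum[OF finite_Basis])
  have eq: "exp (\<i> * of_real (s \<bullet> t)) * complex_of_real (exp (- pi * (norm (t - a))\<^sup>2)) = (\<Prod>b\<in>Basis. ?h b (t \<bullet> b))" for t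
    unfolding exp_inner prod.distrib
    by (simp only: norm2 inner_diff_left sum_distrib_left exp_sum[OF finite_Basis] of_real_prod)
  show "integrable lborel (\<lambda>t. exp (\<i> * of_real (s \<bullet> t)) * complex_of_real (exp (- pi * (norm (t - a))\<^sup>2)))"
    unfolding eq by (intro integrable_lborel_prod_Basis integrable_gaussian_exp)
  have "integral\<^sup>L lborel (\<lambda>t. exp (\<i> * of_real (s \<bullet> t)) * complex_of_real (exp (- pi * (norm (t - a))\<^sup>2))) =
      (\<Prod>b\<in>Basis. exp (\<i> * of_real ((s \<bullet> b) * (a \<bullet> b))) * of_real (exp (- (s \<bullet> b)\<^sup>2 / (4 * pi))))"
    unfolding eq by (subst integral_lborel_prod_Basis) (simp_all only: integrable_gaussian_exp integral_gaussian_exp)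
  also have "\<dots> = exp (\<i> * of_real (s \<bullet> a)) * of_real (exp (- (norm s)\<^sup>2 / (4 * pi)))"
    unfolding exp_inner prod.distrib
    by (simp only: norm2 sum_negf[symmetric] sum_divide_distrib exp_sum[OF finite_Basis] of_real_prod)
  finally show "integral\<^sup>L lborel (\<lambda>t. exp (\<i> * of_real (s \<bullet> t)) * complex_of_real (exp (- pi * (norm (t - a))\<^sup>2))) =
      exp (\<i> * of_real (s \<bullet> a)) * of_real (exp (- (norm s)\<^sup>2 / (4 * pi)))" .
qed

text \<open>The profile is a probability density that this Fourier transform fixes. The centres are
  integer points of a single axis, so translations turn into characters of one coordinate in every
  dimension.\<close>

definition bump :: "'d::finite \<Rightarrow> int \<Rightarrow> real ^ 'd \<Rightarrow> real" where
  "bump i k t = exp (- pi * (norm (t - axis i (of_int k)))\<^sup>2)"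

definition weight :: "real ^ 'd::finite \<Rightarrow> real" where
  "weight \<xi> = exp (- pi * (norm \<xi>)\<^sup>2)"

definition torus_char :: "'d::finite \<Rightarrow> int \<Rightarrow> real ^ 'd \<Rightarrow> complex" where
  "torus_char i k \<xi> = cis (2 * pi * of_int k * (\<xi> $ i))"

lemma norm_torus_char [simp]: "cmod (torus_char i k \<xi>) = 1"
  by (simp add: torus_char_def)

lemma bump_nonneg [simp]: "bump i k t \<ge> 0"
  by (simp add: bump_def)

lemma weight_pos: "weight \<xi> > 0"
  by (simp add: weight_def)

lemma measurable_bump [measurable]: "bump i k \<in> borel_measurable borel"
  unfolding bump_def by measurable

lemma measurable_torus_char [measurable]: "torus_char i k \<in> borel_measurable borel"
  unfolding torus_char_def
  by (intro borel_measurable_continuous_onI continuous_intros)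

lemma gaussian_poly_bump: "gaussian_poly (\<lambda>t. bump i k t *\<^sub>R x)"
  unfolding bump_def by (rule gaussian_poly.gauss)

lemma has_Bochner_integral_bump:
  fixes x :: "'x::complex_banach" and s :: "real ^ 'd::finite"
  shows "has_Bochner_integral lborel (\<lambda>t. exp (\<i> * of_real (s \<bullet> t)) *\<^sub>C (bump i k t *\<^sub>R x))
    ((exp (\<i> * of_real (s $ i * of_int k)) * of_real (exp (- (norm s)\<^sup>2 / (4 * pi)))) *\<^sub>C x)"
proof -
  let ?h = "\<lambda>t. exp (\<i> * of_real (s \<bullet> t)) * complex_of_real (bump i k t)"
  have "has_Bochner_integral lborel ?h (integral\<^sup>L lborel ?h)"
    unfolding bump_def by (intro has_Bochner_integral_lebesgue integrable_gaussian_character)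
  then have "has_Bochner_integral lborel (\<lambda>t. ?h t *\<^sub>C x) (integral\<^sup>L lborel ?h *\<^sub>C x)"
    by (rule has_Bochner_integral_bounded_linear[OF scaleC.bounded_linear_left])
  moreover have "integral\<^sup>L lborel ?h = exp (\<i> * of_real (s $ i * of_int k)) * of_real (exp (- (norm s)\<^sup>2 / (4 * pi)))"
    unfolding bump_def integral_gaussian_character by (simp add: inner_axis)
  moreover have "?h t *\<^sub>C x = exp (\<i> * of_real (s \<bullet> t)) *\<^sub>C (bump i k t *\<^sub>R x)" for t
    by (simp only: scaleC_scaleC[symmetric] scaleC_of_real)
  ultimately show ?thesis by simp
qed

text \<open>The sign in \<open>bump i (- k)\<close> offsets the sign in the forward transform. All
  translates share the same factor \<open>weight\<close>, which can therefore be divided out of the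
  whole sum.\<close>

lemma fourier_bump_sum:
  fixes x :: "int \<Rightarrow> 'x::complex_banach"
  shows "fourier (\<lambda>t. \<Sum>k\<in>J. bump i (- k) t *\<^sub>R x k) \<xi> = weight \<xi> *\<^sub>R (\<Sum>k\<in>J. torus_char i k \<xi> *\<^sub>C x k)"
proof -
  let ?s = "(- 2 * pi) *\<^sub>R \<xi>"
  have "has_Bochner_integral lborel (\<lambda>t. \<Sum>k\<in>J. exp (\<i> * of_real (?s \<bullet> t)) *\<^sub>C (bump i (- k) t *\<^sub>R x k))
      (\<Sum>k\<in>J. (exp (\<i> * of_real (?s $ i * of_int (- k))) * of_real (exp (- (norm ?s)\<^sup>2 / (4 * pi)))) *\<^sub>C x k)"
    by (intro has_Bochner_integral_sum has_Bochner_integral_bump)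
  also have "(\<lambda>t. \<Sum>k\<in>J. exp (\<i> * of_real (?s \<bullet> t)) *\<^sub>C (bump i (- k) t *\<^sub>R x k)) =
      (\<lambda>t. exp (- 2 * pi * \<i> * complex_of_real (\<xi> \<bullet> t)) *\<^sub>C (\<Sum>k\<in>J. bump i (- k) t *\<^sub>R x k))"
    by (simp add: scaleC.sum_right mult_ac)
  also have "(\<Sum>k\<in>J. (exp (\<i> * of_real (?s $ i * of_int (- k))) * of_real (exp (- (norm ?s)\<^sup>2 / (4 * pi)))) *\<^sub>C x k) =
      weight \<xi> *\<^sub>R (\<Sum>k\<in>J. torus_char i k \<xi> *\<^sub>C x k)"
  proof -
    have "exp (\<i> * of_real (?s $ i * of_int (- k))) = torus_char i k \<xi>" for k
      by (simp add: torus_char_def cis_conv_exp mult_ac)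
    moreover have "- (norm ?s)\<^sup>2 / (4 * pi) = - pi * (norm \<xi>)\<^sup>2"
      by (simp add: power2_eq_square)
    ultimately have "(exp (\<i> * of_real (?s $ i * of_int (- k))) * of_real (exp (- (norm ?s)\<^sup>2 / (4 * pi)))) *\<^sub>C x k =
        weight \<xi> *\<^sub>R (torus_char i k \<xi> *\<^sub>C x k)" for k
      by (simp only: weight_def scaleC_of_real[symmetric] scaleC_scaleC mult.commute)
    then show ?thesis by (simp only: scaleR_sum_right)
  qed
  finally show ?thesis unfolding fourier_def by (rule Bochner_integral_eq)
qed

text \<open>The inverse transform is the forward one at \<open>- \<xi>\<close>, and
  \<open>weight\<close> is even.\<close>

lemma inv_fourier_bump:
  "inv_fourier (\<lambda>t. complex_of_real (bump i j t)) \<xi> = of_real (weight \<xi>) * torus_char i j \<xi>"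
proof -
  have "inv_fourier f \<xi> = fourier f (- \<xi>)" for f :: "real ^ 'a \<Rightarrow> complex"
    unfolding fourier_def inv_fourier_def by simp
  moreover have "fourier (\<lambda>t. complex_of_real (bump i j t)) (- \<xi>) = of_real (weight \<xi>) * torus_char i j \<xi>"
    using fourier_bump_sum[where J = "{- j}" and i = i and x = "\<lambda>_. 1 :: complex" and \<xi> = "- \<xi>"]
    by (simp add: weight_def torus_char_def scaleC_complex_def scaleR_conv_of_real)
  ultimately show ?thesis by simp
qed

text \<open>Two geometric series in \<open>exp (-1)\<close>, one for each side of a point, times the
  factor \<open>exp 2\<close> lost when quadratic decay is replaced by linear decay from an
  integer.\<close>

definition bump_const :: real where
  "bump_const = 2 * exp 2 * (1 / (1 - exp (-1)))"

lemma sum_exp_abs_le: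
  fixes J :: "int set"
  assumes "finite J"
  shows "(\<Sum>k\<in>J. exp (- \<bar>of_int (k - l)\<bar>)) \<le> 2 * (1 / (1 - exp (- 1 :: real)))"
proof -
  let ?g = "\<lambda>n::nat. exp (- 1 :: real) ^ n"
  have gs: "?g sums (1 / (1 - exp (- 1)))" by (rule geometric_sums) simp
  have fin: "(\<Sum>n\<in>A. ?g n) \<le> 1 / (1 - exp (- 1))" if "finite A" for A
    using sum_le_suminf[OF sums_summable[OF gs] that] sums_unique[OF gs] by simp
  have half: "(\<Sum>k\<in>I. exp (- \<bar>of_int (k - l)\<bar>)) \<le> 1 / (1 - exp (- 1 :: real))"
    if I: "finite I" and inj: "inj_on (\<lambda>k. nat \<bar>k - l\<bar>) I" for I
  proof -
    have "exp (- \<bar>of_int (k - l)\<bar>) = ?g (nat \<bar>k - l\<bar>)" for k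
      by (simp flip: exp_of_nat_mult)
    then have "(\<Sum>k\<in>I. exp (- \<bar>of_int (k - l)\<bar>)) = (\<Sum>n\<in>(\<lambda>k. nat \<bar>k - l\<bar>) ` I. ?g n)"
      by (simp only: sum.reindex[OF inj] comp_def)
    also have "\<dots> \<le> 1 / (1 - exp (- 1))" using I by (intro fin) simp
    finally show ?thesis .
  qed
  have "(\<Sum>k\<in>J. exp (- \<bar>of_int (k - l)\<bar>) :: real) =
      (\<Sum>k\<in>J \<inter> {l..}. exp (- \<bar>of_int (k - l)\<bar>)) + (\<Sum>k\<in>J - {l..}. exp (- \<bar>of_int (k - l)\<bar>))"
    using assms by (rule sum.Int_Diff)
  also have "\<dots> \<le> 1 / (1 - exp (- 1)) + 1 / (1 - exp (- 1))"
    using assms by (intro add_mono half) (auto simp: inj_on_def)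
  finally show ?thesis by simp
qed

lemma abs_le_1_plus_square: "\<bar>y :: real\<bar> \<le> 1 + y\<^sup>2"
proof -
  have "2 * \<bar>y\<bar> \<le> y\<^sup>2 + 1" using sum_squares_bound[of "\<bar>y\<bar>" 1] by simp
  then show ?thesis using abs_ge_zero[of y] by linarith
qed

lemma sum_bump_le:
  assumes "finite J"
  shows "(\<Sum>k\<in>J. bump i k t) \<le> bump_const"
proof -
  \<comment> \<open>Distances to \<open>t\<close> become distances to this integer: going from
    quadratic to linear decay costs \<open>exp 1\<close>, and rounding costs another
    \<open>exp 1\<close>.\<close>
  define l where "l = \<lfloor>t $ i\<rfloor>"
  have "bump i k t \<le> exp 2 * exp (- \<bar>of_int (k - l)\<bar>)" for k
  proof -
    let ?y = "t $ i - of_int k"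
    have l: "0 \<le> t $ i - of_int l" "t $ i - of_int l < 1"
      unfolding l_def by linarith+
    have "\<bar>?y\<bar> \<le> norm (t - axis i (of_int k))"
      using component_le_norm_cart[of "t - axis i (of_int k)" i] by simp
    then have "?y\<^sup>2 \<le> (norm (t - axis i (of_int k)))\<^sup>2"
      by (metis abs_ge_zero power2_abs power_mono)
    also have "\<dots> \<le> pi * (norm (t - axis i (of_int k)))\<^sup>2"
      using pi_gt3 mult_right_mono[of 1 pi "(norm (t - axis i (of_int k)))\<^sup>2"] by simp
    finally have 1: "?y\<^sup>2 \<le> pi * (norm (t - axis i (of_int k)))\<^sup>2" .
    have 2: "\<bar>?y\<bar> \<le> 1 + ?y\<^sup>2"
      by (rule abs_le_1_plus_square)
    have 3: "\<bar>of_int (k - l)\<bar> \<le> \<bar>?y\<bar> + (1::real)"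
      using l by simp
    have "- pi * (norm (t - axis i (of_int k)))\<^sup>2 \<le> 2 + - \<bar>of_int (k - l)\<bar>"
      using 1 2 3 by linarith
    then show ?thesis unfolding bump_def exp_add[symmetric] by (rule exp_le_cancel_iff[THEN iffD2])
  qed
  then have "(\<Sum>k\<in>J. bump i k t) \<le> (\<Sum>k\<in>J. exp 2 * exp (- \<bar>of_int (k - l)\<bar>))"
    by (intro sum_mono)
  also have "\<dots> \<le> exp 2 * (2 * (1 / (1 - exp (- 1))))"
    unfolding sum_distrib_left[symmetric] by (intro mult_left_mono sum_exp_abs_le assms) auto
  finally show ?thesis by (simp add: bump_const_def mult_ac)
qed

lemma nn_integral_bump: "(\<integral>\<^sup>+t. ennreal (bump i k t) \<partial>lborel) = 1"
proof -
  have int: "integrable lborel (\<lambda>t. complex_of_real (bump i k t))"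
    using integrable_gaussian_character[of 0 "axis i (of_int k) :: real ^ 'a"] by (simp add: bump_def)
  have "complex_of_real (integral\<^sup>L lborel (bump i k)) = integral\<^sup>L lborel (\<lambda>t. complex_of_real (bump i k t))"
    by simp
  also have "\<dots> = 1"
    using integral_gaussian_character[of 0 "axis i (of_int k) :: real ^ 'a"] by (simp add: bump_def)
  finally have "integral\<^sup>L lborel (bump i k) = 1" by (simp only: of_real_eq_1_iff)
  moreover have "integrable lborel (bump i k)"
    using int by (simp add: complex_of_real_integrable_eq)
  ultimately show ?thesis
    by (subst nn_integral_eq_integral) auto
qed

text \<open>The bumps are weights with pointwise total at most \<open>bump_const\<close> and
  integral one each, so the power mean followed by integration turns an L^s norm into an ell^s norm.
  The relabelling \<open>\<sigma>\<close> allows \<open>- k\<close> on the input side and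
  \<open>k\<close> on the test side.\<close>

lemma nn_integral_bump_sum_powr:
  assumes J: "finite J" and s: "s \<ge> 1" and a: "\<And>k. k \<in> J \<Longrightarrow> a k \<ge> 0" and \<sigma>: "inj_on \<sigma> J"
  shows "(\<integral>\<^sup>+t. ennreal ((\<Sum>k\<in>J. bump i (\<sigma> k) t * a k) powr s) \<partial>lborel) \<le>
    ennreal (bump_const powr (s - 1) * (\<Sum>k\<in>J. a k powr s))"
proof -
  have "(\<integral>\<^sup>+t. ennreal ((\<Sum>k\<in>J. bump i (\<sigma> k) t * a k) powr s) \<partial>lborel) \<le>
      (\<integral>\<^sup>+t. ennreal (bump_const powr (s - 1)) * (\<Sum>k\<in>J. ennreal (bump i (\<sigma> k) t) * ennreal (a k powr s)) \<partial>lborel)"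
  proof (rule nn_integral_mono)
    fix t
    have "(\<Sum>k\<in>J. bump i (\<sigma> k) t) = (\<Sum>k\<in>\<sigma> ` J. bump i k t)"
      by (simp add: sum.reindex[OF \<sigma>])
    also have "\<dots> \<le> bump_const" using J by (intro sum_bump_le) simp
    finally have "(\<Sum>k\<in>J. bump i (\<sigma> k) t * a k) powr s \<le> bump_const powr (s - 1) * (\<Sum>k\<in>J. bump i (\<sigma> k) t * a k powr s)"
      using J s a by (intro weighted_power_mean) auto
    then have "ennreal ((\<Sum>k\<in>J. bump i (\<sigma> k) t * a k) powr s) \<le> ennreal (bump_const powr (s - 1) * (\<Sum>k\<in>J. bump i (\<sigma> k) t * a k powr s))"
      by (rule ennreal_leI)
    also have "\<dots> = ennreal (bump_const powr (s - 1)) * (\<Sum>k\<in>J. ennreal (bump i (\<sigma> k) t) * ennreal (a k powr s))"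
      by (simp add: ennreal_mult sum_nonneg flip: sum_ennreal)
    finally show "ennreal ((\<Sum>k\<in>J. bump i (\<sigma> k) t * a k) powr s) \<le> \<dots>" .
  qed
  also have "\<dots> = ennreal (bump_const powr (s - 1)) * (\<Sum>k\<in>J. ennreal (a k powr s))"
    by (simp add: nn_integral_cmult nn_integral_sum nn_integral_multc nn_integral_bump del: sum_ennreal)
  also have "\<dots> = ennreal (bump_const powr (s - 1) * (\<Sum>k\<in>J. a k powr s))"
    by (simp add: ennreal_mult sum_nonneg)
  finally show ?thesis .
qed

lemma Lp_norm_bump_sum:
  fixes x :: "int \<Rightarrow> 'x::complex_banach" and i :: "'d::finite"
  assumes J: "finite J" and p: "p \<ge> 1"
  shows "Lp_norm p (\<lambda>t. \<Sum>k\<in>J. bump i (- k) t *\<^sub>R x k) \<le>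
    (bump_const powr (p - 1)) powr (1 / p) * (\<Sum>k\<in>J. norm (x k) powr p) powr (1 / p)"
proof -
  let ?f = "\<lambda>t. \<Sum>k\<in>J. bump i (- k) t *\<^sub>R x k"
  let ?R = "bump_const powr (p - 1) * (\<Sum>k\<in>J. norm (x k) powr p)"
  have R: "?R \<ge> 0" by (intro mult_nonneg_nonneg sum_nonneg) auto
  have "(\<integral>\<^sup>+t. ennreal (norm (?f t) powr p) \<partial>lborel) \<le>
      (\<integral>\<^sup>+t. ennreal ((\<Sum>k\<in>J. bump i (- k) t * norm (x k)) powr p) \<partial>lborel)"
  proof (intro nn_integral_mono ennreal_leI powr_mono2)
    fix t show "norm (?f t) \<le> (\<Sum>k\<in>J. bump i (- k) t * norm (x k))"
      by (rule order_trans[OF norm_sum]) simp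
  qed (use p in auto)
  also have "\<dots> \<le> ennreal ?R"
    by (rule nn_integral_bump_sum_powr) (use J p in \<open>auto simp: inj_on_def\<close>)
  finally have le: "(\<integral>\<^sup>+t. ennreal (norm (?f t) powr p) \<partial>lborel) \<le> ennreal ?R" .
  have "strongly_measurable lborel ?f"
    by (intro strongly_measurable_sum strongly_measurable_scaleR strongly_measurable_borel strongly_measurable_const) measurable
  then have [measurable]: "(\<lambda>t. norm (?f t)) \<in> borel_measurable borel"
    using strongly_measurable_norm[of lborel ?f] by simp
  have "(\<integral>t. norm (?f t) powr p \<partial>lborel) = enn2real (\<integral>\<^sup>+t. ennreal (norm (?f t) powr p) \<partial>lborel)"
    by (rule integral_eq_nn_integral) auto
  also have "\<dots> \<le> ?R"
    using enn2real_mono[OF le] R by simp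
  finally have "Lp_norm p ?f \<le> ?R powr (1 / p)"
    unfolding Lp_norm_def using p by (intro powr_mono2) auto
  then show ?thesis by (simp add: powr_mult sum_nonneg)
qed

section \<open>Transference from Fourier multipliers to Fourier coefficients\<close>

text \<open>A period cell of the characters on which \<open>norm \<xi>\<close> is bounded and bounded away from zero, so
  that powers of \<open>norm \<xi>\<close> do not affect \<open>\<gamma>\<close>-boundedness of multipliers supported there.\<close>

definition freq_box :: "(real ^ 'd::finite) set" where
  "freq_box = {\<xi>. \<forall>b\<in>Basis. \<xi> \<bullet> b \<in> {1..<2}}"

text \<open>The character \<open>torus_char i j\<close> is not conjugated, so the integral is the
  Fourier coefficient at frequency \<open>- j\<close> of \<mu> applied to the character sum.\<close>

definition multiplier_integrand ::
    "'d::finite \<Rightarrow> (real ^ 'd \<Rightarrow> ('x::complex_banach, 'y::complex_banach) cblinfun) \<Rightarrow> int set \<Rightarrow> (int \<Rightarrow> 'x) \<Rightarrow> int \<Rightarrow> real ^ 'd \<Rightarrow> 'y" where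
  "multiplier_integrand i \<mu> J x j \<xi> = indicat_real freq_box \<xi> *\<^sub>R
     (torus_char i j \<xi> *\<^sub>C cblinfun_apply (\<mu> \<xi>) (\<Sum>k\<in>J. torus_char i k \<xi> *\<^sub>C x k))"

definition discrete_multiplier where
  "discrete_multiplier i \<mu> J x j = Bochner_integral lborel (multiplier_integrand i \<mu> J x j)"

text \<open>The multiplier divides out the two factors \<open>weight\<close> that the Fourier transforms of the input
  \<open>\<Sum>k. bump i (- k) t *\<^sub>R x k\<close> and of the test function \<open>bump i j\<close> contribute.\<close>

lemma discrete_multiplier_bounded:
  fixes \<mu> :: "real ^ 'd::finite \<Rightarrow> ('x::complex_banach, 'y::complex_banach) cblinfun"
  assumes p: "p \<ge> 1" and q: "q > 1" "q' > 1" "1 / q + 1 / q' = 1"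
    and bdd: "multiplier_bounded p q (\<lambda>\<xi>. (indicat_real freq_box \<xi> / (weight \<xi>)\<^sup>2) *\<^sub>R \<mu> \<xi>)"
  shows "\<exists>K. \<forall>J x J' b. finite J \<longrightarrow> finite J' \<longrightarrow> (\<forall>j. b j \<ge> 0) \<longrightarrow>
    (\<Sum>j\<in>J'. b j * norm (discrete_multiplier i \<mu> J x j)) \<le>
      K * (\<Sum>j\<in>J'. b j powr q') powr (1 / q') * (\<Sum>k\<in>J. norm (x k) powr p) powr (1 / p)"
proof -
  let ?m = "\<lambda>\<xi>. (indicat_real freq_box \<xi> / (weight \<xi>)\<^sup>2) *\<^sub>R \<mu> \<xi>"
  from bdd obtain C0 where C0: "\<And>f. schwartz f \<Longrightarrow> \<exists>g. in_Lp q g \<and>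
      (\<forall>\<phi>. schwartz \<phi> \<longrightarrow> fourier_multiplier ?m f \<phi> = distribution_of g \<phi>) \<and> Lp_norm q g \<le> C0 * Lp_norm p f"
    unfolding multiplier_bounded_def by blast
  define C where "C = max C0 0"
  define D where "D = (bump_const powr (p - 1)) powr (1 / p)"
  define E where "E = (bump_const powr (q' - 1)) powr (1 / q')"
  have nonneg: "C \<ge> 0" "D \<ge> 0" "E \<ge> 0" by (auto simp: C_def D_def E_def)
  have "(\<Sum>j\<in>J'. b j * norm (discrete_multiplier i \<mu> J x j)) \<le>
      E * C * D * (\<Sum>j\<in>J'. b j powr q') powr (1 / q') * (\<Sum>k\<in>J. norm (x k) powr p) powr (1 / p)"
    if J: "finite J" "finite J'" and b: "\<And>j. b j \<ge> 0" for J J' b and x :: "int \<Rightarrow> 'x"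
  proof -
    let ?f = "\<lambda>t. \<Sum>k\<in>J. bump i (- k) t *\<^sub>R x k"
    let ?X = "(\<Sum>k\<in>J. norm (x k) powr p) powr (1 / p)" and ?B = "(\<Sum>j\<in>J'. b j powr q') powr (1 / q')"
    have "schwartz ?f"
      by (intro schwartz_gaussian_poly gaussian_poly_sum gaussian_poly_bump J)
    then obtain g where g: "in_Lp q g"
      and gT: "\<And>\<phi>. schwartz \<phi> \<Longrightarrow> fourier_multiplier ?m ?f \<phi> = distribution_of g \<phi>"
      and g_le: "Lp_norm q g \<le> C0 * Lp_norm p ?f"
      using C0 by blast
    have g_le': "Lp_norm q g \<le> C * (D * ?X)"
    proof -
      have "Lp_norm q g \<le> C * Lp_norm p ?f"
        by (rule order_trans[OF g_le mult_right_mono]) (auto simp: C_def Lp_norm_def)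
      also have "\<dots> \<le> C * (D * ?X)"
        unfolding D_def using nonneg by (intro mult_left_mono Lp_norm_bump_sum J p) auto
      finally show ?thesis .
    qed
    have g_meas [measurable]: "(\<lambda>t. norm (g t)) \<in> borel_measurable borel"
      using g strongly_measurable_norm[of lborel g] by (simp add: in_Lp_def)
    have g_int: "(\<integral>\<^sup>+t. ennreal (norm (g t) powr q) \<partial>lborel) = ennreal (Lp_norm q g powr q)"
    proof -
      have "(\<integral>\<^sup>+t. ennreal (norm (g t) powr q) \<partial>lborel) = ennreal (\<integral>t. norm (g t) powr q \<partial>lborel)"
        using g by (intro nn_integral_eq_integral) (auto simp: in_Lp_def)
      then show ?thesis
        using q by (simp add: Lp_norm_def powr_powr integral_nonneg_AE)
    qed
    \<comment> \<open>Both sides are the distribution \<open>fourier_multiplier ?m ?f\<close> tested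
      on a bump. In frequency the two weights cancel and leave the discrete multiplier; in space the
      distribution is the function \<open>g\<close>.\<close>
    have z: "discrete_multiplier i \<mu> J x j = Bochner_integral lborel (\<lambda>t. complex_of_real (bump i j t) *\<^sub>C g t)" for j
    proof -
      have "schwartz (\<lambda>t. complex_of_real (bump i j t))"
        using schwartz_gaussian_poly[OF gaussian_poly_bump[of i j "1 :: complex"]] by (simp add: scaleR_conv_of_real)
      then have "distribution_of g (\<lambda>t. complex_of_real (bump i j t)) =
          fourier_multiplier ?m ?f (\<lambda>t. complex_of_real (bump i j t))"
        by (rule gT[symmetric])
      also have "\<dots> = Bochner_integral lborel (\<lambda>\<xi>. (of_real (weight \<xi>) * torus_char i j \<xi>) *\<^sub>C
          cblinfun_apply (?m \<xi>) (weight \<xi> *\<^sub>R (\<Sum>k\<in>J. torus_char i k \<xi> *\<^sub>C x k)))"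
        unfolding fourier_multiplier_def inv_fourier_distribution_def distribution_of_def fourier_bump_sum inv_fourier_bump ..
      also have "(\<lambda>\<xi>. (of_real (weight \<xi>) * torus_char i j \<xi>) *\<^sub>C
            cblinfun_apply (?m \<xi>) (weight \<xi> *\<^sub>R (\<Sum>k\<in>J. torus_char i k \<xi> *\<^sub>C x k))) =
          multiplier_integrand i \<mu> J x j"
      proof
        fix \<xi> :: "real ^ 'd"
        have "weight \<xi> * (indicat_real freq_box \<xi> / (weight \<xi>)\<^sup>2) * weight \<xi> = indicat_real freq_box \<xi>"
          using weight_pos[of \<xi>] by (simp add: power2_eq_square)
        then show "(of_real (weight \<xi>) * torus_char i j \<xi>) *\<^sub>C
              cblinfun_apply (?m \<xi>) (weight \<xi> *\<^sub>R (\<Sum>k\<in>J. torus_char i k \<xi> *\<^sub>C x k)) =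
            multiplier_integrand i \<mu> J x j \<xi>"
          by (simp only: multiplier_integrand_def cblinfun.scaleR_left cblinfun.scaleR_right scaleC_scaleC[symmetric] scaleC_of_real
              scaleC.scaleR_right scaleR_scaleR mult_ac)
      qed
      finally show ?thesis
        unfolding discrete_multiplier_def distribution_of_def ..
    qed
    \<comment> \<open>The weights \<open>b\<close> stand for a dual sequence: pairing the outputs
      with \<open>b\<close> gives one integral of \<open>norm (g t)\<close> against a bump sum, and
      Hoelder's inequality finishes.\<close>
    have "ennreal (\<Sum>j\<in>J'. b j * norm (discrete_multiplier i \<mu> J x j)) =
        (\<Sum>j\<in>J'. ennreal (b j) * ennreal (norm (discrete_multiplier i \<mu> J x j)))"
      using b by (simp add: sum_ennreal[symmetric] ennreal_mult del: sum_ennreal)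
    also have "\<dots> \<le> (\<Sum>j\<in>J'. ennreal (b j) * (\<integral>\<^sup>+t. ennreal (bump i j t * norm (g t)) \<partial>lborel))"
    proof (intro sum_mono mult_left_mono)
      fix j
      show "ennreal (norm (discrete_multiplier i \<mu> J x j)) \<le> (\<integral>\<^sup>+t. ennreal (bump i j t * norm (g t)) \<partial>lborel)"
        unfolding z using Bochner_integral_norm_bound[of lborel "\<lambda>t. complex_of_real (bump i j t) *\<^sub>C g t"]
        by (simp add: norm_scaleC)
    qed simp
    also have "\<dots> = (\<integral>\<^sup>+t. (\<Sum>j\<in>J'. ennreal (b j) * ennreal (bump i j t * norm (g t))) \<partial>lborel)"
      by (subst nn_integral_sum) (simp_all add: nn_integral_cmult)
    also have "\<dots> = (\<integral>\<^sup>+t. ennreal ((\<Sum>j\<in>J'. bump i j t * b j) * norm (g t)) \<partial>lborel)"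
      using b by (simp add: sum_distrib_right sum_distrib_left mult_ac flip: ennreal_mult)
    also have "\<dots> \<le> ennreal (E * ?B * Lp_norm q g)"
    proof (rule nn_integral_Hoelder[of q' q])
      have "(\<integral>\<^sup>+t. ennreal ((\<Sum>j\<in>J'. bump i j t * b j) powr q') \<partial>lborel) \<le>
          ennreal (bump_const powr (q' - 1) * (\<Sum>j\<in>J'. b j powr q'))"
        using nn_integral_bump_sum_powr[of J' q' b "\<lambda>k. k" i] J b q by simp
      also have "bump_const powr (q' - 1) * (\<Sum>j\<in>J'. b j powr q') = (E * ?B) powr q'"
        using q b by (simp add: E_def powr_mult powr_powr sum_nonneg)
      finally show "(\<integral>\<^sup>+t. ennreal ((\<Sum>j\<in>J'. bump i j t * b j) powr q') \<partial>lborel) \<le> ennreal ((E * ?B) powr q')" .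
    qed (use q b nonneg g_int in \<open>auto simp: add.commute sum_nonneg Lp_norm_def\<close>)
    finally have "(\<Sum>j\<in>J'. b j * norm (discrete_multiplier i \<mu> J x j)) \<le> E * ?B * Lp_norm q g"
      using nonneg by (subst (asm) ennreal_le_iff) (auto simp: Lp_norm_def)
    also have "\<dots> \<le> E * ?B * (C * (D * ?X))"
      using nonneg by (intro mult_left_mono g_le') auto
    finally show ?thesis by (simp add: mult_ac)
  qed
  then show ?thesis by blast
qed

section \<open>Uniform boundedness\<close>

text \<open>For operator-valued functions this is measurability in the operator norm, which implies
  \<open>X_strongly_measurable\<close>. The bound is required at every point because
  gamma-boundedness concerns the full range and does not ignore null sets.\<close>

definition bounded_measurable :: "'a measure \<Rightarrow> ('a \<Rightarrow> 'v::real_normed_vector) \<Rightarrow> bool" where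
  "bounded_measurable M \<mu> \<longleftrightarrow> strongly_measurable M \<mu> \<and> (\<exists>B. \<forall>\<xi>. norm (\<mu> \<xi>) \<le> B)"

lemma bounded_measurableI:
  "strongly_measurable M \<mu> \<Longrightarrow> (\<And>\<xi>. norm (\<mu> \<xi>) \<le> B) \<Longrightarrow> bounded_measurable M \<mu>"
  by (auto simp: bounded_measurable_def)

lemma bounded_measurable_add:
  assumes "bounded_measurable M \<mu>" "bounded_measurable M \<nu>"
  shows "bounded_measurable M (\<lambda>\<xi>. \<mu> \<xi> + \<nu> \<xi>)"
proof -
  obtain A B where "\<And>\<xi>. norm (\<mu> \<xi>) \<le> A" "\<And>\<xi>. norm (\<nu> \<xi>) \<le> B"
    using assms unfolding bounded_measurable_def by blast
  then have "norm (\<mu> \<xi> + \<nu> \<xi>) \<le> A + B" for \<xi>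
    by (meson add_mono norm_triangle_ineq order_trans)
  then show ?thesis
    using assms by (intro bounded_measurableI strongly_measurable_add) (auto simp: bounded_measurable_def)
qed

lemma bounded_measurable_scaleR:
  assumes "bounded_measurable M \<mu>"
  shows "bounded_measurable M (\<lambda>\<xi>. c *\<^sub>R \<mu> \<xi>)"
proof -
  obtain A where "\<And>\<xi>. norm (\<mu> \<xi>) \<le> A"
    using assms unfolding bounded_measurable_def by blast
  then have "norm (c *\<^sub>R \<mu> \<xi>) \<le> \<bar>c\<bar> * A" for \<xi>
    by (simp add: mult_left_mono)
  then show ?thesis
    using assms by (intro bounded_measurableI strongly_measurable_scaleR strongly_measurable_const)
      (auto simp: bounded_measurable_def)
qed

text \<open>Banach--Steinhaus by a gliding hump: a series with terms \<open>\<plusminus> 3\<^sup>-\<^sup>n \<nu>\<^sub>n\<close>, where \<open>\<nu>\<^sub>n\<close> nearly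
  attains the norm of the \<open>n\<close>-th functional and the sign prevents cancellation. Its partial sums are
  simple functions, hence its limit is strongly measurable.\<close>

lemma uniformly_bounded_on_simple_functions:
  fixes T :: "'t \<Rightarrow> ('a \<Rightarrow> 'v::banach) \<Rightarrow> real"
  assumes add: "\<And>t \<mu> \<nu>. t \<in> I \<Longrightarrow> bounded_measurable M \<mu> \<Longrightarrow> bounded_measurable M \<nu> \<Longrightarrow>
      T t (\<lambda>\<xi>. \<mu> \<xi> + \<nu> \<xi>) \<le> T t \<mu> + T t \<nu>"
    and scale: "\<And>t \<mu> c. t \<in> I \<Longrightarrow> bounded_measurable M \<mu> \<Longrightarrow> T t (\<lambda>\<xi>. c *\<^sub>R \<mu> \<xi>) = \<bar>c\<bar> * T t \<mu>"
    and cont: "\<And>t. t \<in> I \<Longrightarrow> \<exists>L. \<forall>\<mu> B. bounded_measurable M \<mu> \<longrightarrow> (\<forall>\<xi>. norm (\<mu> \<xi>) \<le> B) \<longrightarrow> T t \<mu> \<le> L * B"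
    and ptw: "\<And>\<mu>. bounded_measurable M \<mu> \<Longrightarrow> \<exists>C. \<forall>t\<in>I. T t \<mu> \<le> C"
  shows "\<exists>C. \<forall>t\<in>I. \<forall>\<mu>. simple_function M \<mu> \<longrightarrow> (\<forall>\<xi>. norm (\<mu> \<xi>) \<le> 1) \<longrightarrow> T t \<mu> \<le> C"
proof (rule ccontr)
  assume contra: "\<not> ?thesis"
  define S where "S = {\<mu> :: 'a \<Rightarrow> 'v. simple_function M \<mu> \<and> (\<forall>\<xi>. norm (\<mu> \<xi>) \<le> 1)}"
  \<comment> \<open>The norm of the functional, measured on simple functions only.\<close>
  define N where "N t = (SUP \<mu>\<in>S. T t \<mu>)" for t
  have bm: "bounded_measurable M \<mu>" if "simple_function M \<mu>" "\<And>\<xi>. norm (\<mu> \<xi>) \<le> B" for \<mu> :: "'a \<Rightarrow> 'v" and B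
    using that by (intro bounded_measurableI strongly_measurable_simple)
  have bdd: "bdd_above (T t ` S)" if t: "t \<in> I" for t
  proof -
    obtain L where L: "\<And>\<mu> B. bounded_measurable M \<mu> \<Longrightarrow> (\<And>\<xi>. norm (\<mu> \<xi>) \<le> B) \<Longrightarrow> T t \<mu> \<le> L * B"
      using cont[OF t] by blast
    have "T t \<mu> \<le> L * 1" if "\<mu> \<in> S" for \<mu>
      using that by (intro L bm[of _ 1]) (auto simp: S_def)
    then show ?thesis by (intro bdd_aboveI2[of _ _ "L * 1"])
  qed
  have T_le_N: "T t \<mu> \<le> N t" if "t \<in> I" "\<mu> \<in> S" for t \<mu>
    unfolding N_def by (rule cSUP_upper[OF that(2) bdd[OF that(1)]])
  \<comment> \<open>Growth like 4^n beats the step size 3^-n used below, so the contributions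
    \<open>(4 / 3) ^ n\<close> are unbounded.\<close>
  have "\<exists>t\<in>I. N t > 4 ^ n" for n :: nat
  proof -
    have "\<not> (\<forall>t\<in>I. \<forall>\<mu>. simple_function M \<mu> \<longrightarrow> (\<forall>\<xi>. norm (\<mu> \<xi>) \<le> 1) \<longrightarrow> T t \<mu> \<le> 4 ^ n)"
      using contra by blast
    then obtain t \<mu> where "t \<in> I" "\<mu> \<in> S" "T t \<mu> > 4 ^ n"
      by (auto simp: S_def not_le)
    then show ?thesis using T_le_N[of t \<mu>] by force
  qed
  then obtain t where t: "\<And>n::nat. t n \<in> I" and N: "\<And>n. N (t n) > 4 ^ n"
    by metis
  have N_pos: "N (t n) > 0" for n
    using N[of n] by (rule less_trans[rotated]) simp
  have "\<exists>\<mu>\<in>S. T (t n) \<mu> > (2 / 3) * N (t n)" for n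
  proof -
    have "(\<lambda>_. 0) \<in> S" by (simp add: S_def)
    then have "S \<noteq> {}" by blast
    moreover have "(2 / 3) * N (t n) < (SUP \<mu>\<in>S. T (t n) \<mu>)"
      using N_pos[of n] by (simp flip: N_def)
    ultimately show ?thesis using less_cSUP_iff[OF _ bdd[OF t]] by blast
  qed
  then obtain \<nu> where \<nu>: "\<And>n. \<nu> n \<in> S" and T\<nu>: "\<And>n. T (t n) (\<nu> n) > (2 / 3) * N (t n)"
    by metis
  define y where "y n \<xi> = (1 / 3 :: real) ^ n *\<^sub>R \<nu> n \<xi>" for n \<xi>
  have y_simple: "simple_function M (y n)" for n
    unfolding y_def using \<nu>[of n] by (intro simple_function_compose1[where g = "\<lambda>v. (1 / 3) ^ n *\<^sub>R v"]) (simp add: S_def)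
  have y_norm: "norm (y n \<xi>) \<le> (1 / 3) ^ n" for n \<xi>
    using \<nu>[of n] by (simp add: y_def S_def mult_left_le)
  have y_bm: "bounded_measurable M (y n)" for n
    by (rule bm[OF y_simple y_norm])
  have Ty: "T (t n) (y n) > (1 / 3) ^ n * ((2 / 3) * N (t n))" for n
  proof -
    have "T (t n) (y n) = (1 / 3) ^ n * T (t n) (\<nu> n)"
      unfolding y_def using \<nu>[of n] by (subst scale[OF t]) (auto simp: S_def intro!: bm[of _ 1])
    then show ?thesis using T\<nu>[of n] by simp
  qed
  \<comment> \<open>Each functional decides the sign of its own step. Twice \<open>y n\<close> is
    the difference of the two candidates, so by subadditivity at least one of them has value at
    least \<open>T (t n) (y n)\<close>.\<close>
  define P where "P = rec_nat (\<lambda>_. 0 :: 'v)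
    (\<lambda>n f. if T (t n) (\<lambda>\<xi>. f \<xi> + y n \<xi>) \<ge> T (t n) (y n) then (\<lambda>\<xi>. f \<xi> + y n \<xi>) else (\<lambda>\<xi>. f \<xi> + (-1) *\<^sub>R y n \<xi>))"
  have P_0: "P 0 = (\<lambda>_. 0)" by (simp add: P_def)
  have P_Suc: "P (Suc n) = (if T (t n) (\<lambda>\<xi>. P n \<xi> + y n \<xi>) \<ge> T (t n) (y n)
      then (\<lambda>\<xi>. P n \<xi> + y n \<xi>) else (\<lambda>\<xi>. P n \<xi> + (-1) *\<^sub>R y n \<xi>))" for n
    by (simp add: P_def)
  have P_step: "norm (P (Suc n) \<xi> - P n \<xi>) \<le> (1 / 3) ^ n" for n \<xi>
    using y_norm[of n \<xi>] by (simp add: P_Suc)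
  have P_simple: "simple_function M (P n)" for n
  proof (induction n)
    case (Suc n)
    have "simple_function M (\<lambda>\<xi>. P n \<xi> + (-1) *\<^sub>R y n \<xi>)"
      by (rule simple_function_compose2[OF Suc.IH y_simple])
    moreover have "simple_function M (\<lambda>\<xi>. P n \<xi> + y n \<xi>)"
      by (rule simple_function_compose2[OF Suc.IH y_simple])
    ultimately show ?case by (simp add: P_Suc)
  qed (simp add: P_0)
  have P_diff: "norm (P (n + k) \<xi> - P n \<xi>) \<le> (3 / 2) * (1 / 3) ^ n" for n k \<xi>
  proof -
    have "norm (P (n + k) \<xi> - P n \<xi>) \<le> (3 / 2) * ((1 / 3) ^ n - (1 / 3) ^ (n + k))"
    proof (induction k)
      case (Suc k)
      have "norm (P (n + Suc k) \<xi> - P n \<xi>) \<le> norm (P (Suc (n + k)) \<xi> - P (n + k) \<xi>) + norm (P (n + k) \<xi> - P n \<xi>)"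
        using norm_triangle_ineq[of "P (Suc (n + k)) \<xi> - P (n + k) \<xi>" "P (n + k) \<xi> - P n \<xi>"] by simp
      then show ?case using P_step[of "n + k" \<xi>] Suc.IH by simp
    qed simp
    then show ?thesis by (rule order_trans) simp
  qed
  have P_bm: "bounded_measurable M (P n)" for n
    using P_diff[of 0 n] by (intro bm[OF P_simple, of n "3 / 2"]) (simp add: P_0)
  have T_P: "T (t n) (P (Suc n)) \<ge> T (t n) (y n)" for n
  proof (cases "T (t n) (\<lambda>\<xi>. P n \<xi> + y n \<xi>) \<ge> T (t n) (y n)")
    case False
    let ?u = "\<lambda>\<xi>. P n \<xi> + y n \<xi>" and ?v = "\<lambda>\<xi>. P n \<xi> + (-1) *\<^sub>R y n \<xi>"
    have uv: "bounded_measurable M ?u" "bounded_measurable M ?v"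
      by (intro bounded_measurable_add bounded_measurable_scaleR P_bm y_bm)+
    have "2 * T (t n) (y n) = T (t n) (\<lambda>\<xi>. 2 *\<^sub>R y n \<xi>)"
      by (simp add: scale[OF t y_bm])
    also have "(\<lambda>\<xi>. 2 *\<^sub>R y n \<xi>) = (\<lambda>\<xi>. ?u \<xi> + (-1) *\<^sub>R ?v \<xi>)"
      by (simp add: scaleR_2)
    also have "T (t n) (\<lambda>\<xi>. ?u \<xi> + (-1) *\<^sub>R ?v \<xi>) \<le> T (t n) ?u + T (t n) ?v"
      using add[OF t uv(1) bounded_measurable_scaleR[OF uv(2)], of n "-1"] scale[OF t uv(2), of n "-1"] by simp
    finally show ?thesis using False by (simp add: P_Suc)
  qed (simp add: P_Suc)
  have "Cauchy (\<lambda>n. P n \<xi>)" for \<xi>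
  proof (rule CauchyI')
    fix e :: real assume "e > 0"
    moreover have "(\<lambda>n. (3 / 2) * (1 / 3 :: real) ^ n) \<longlonglongrightarrow> (3 / 2) * 0"
      by (intro tendsto_intros) simp
    ultimately have "\<forall>\<^sub>F n in sequentially. (3 / 2) * (1 / 3) ^ n < e"
      by (intro order_tendstoD(2)) auto
    then obtain m where m: "\<And>n. n \<ge> m \<Longrightarrow> (3 / 2) * (1 / 3) ^ n < e"
      by (auto simp: eventually_sequentially)
    have "dist (P n \<xi>) (P k \<xi>) < e" if "n \<ge> m" "n < k" for n k
      using P_diff[of n "k - n" \<xi>] m[OF that(1)] that by (simp add: dist_norm norm_minus_commute)
    then show "\<exists>m. \<forall>n\<ge>m. \<forall>k>n. dist (P n \<xi>) (P k \<xi>) < e" by blast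
  qed
  then obtain Q where Q: "\<And>\<xi>. (\<lambda>n. P n \<xi>) \<longlonglongrightarrow> Q \<xi>"
    unfolding Cauchy_convergent_iff convergent_def by metis
  have Q_diff: "norm (Q \<xi> - P n \<xi>) \<le> (3 / 2) * (1 / 3) ^ n" for n \<xi>
  proof (rule LIMSEQ_le_const2)
    show "(\<lambda>k. norm (P (k + n) \<xi> - P n \<xi>)) \<longlonglongrightarrow> norm (Q \<xi> - P n \<xi>)"
      by (intro tendsto_intros LIMSEQ_ignore_initial_segment Q)
    show "\<exists>m. \<forall>k\<ge>m. norm (P (k + n) \<xi> - P n \<xi>) \<le> (3 / 2) * (1 / 3) ^ n"
      using P_diff[of n _ \<xi>] by (simp add: add.commute)
  qed
  have Q_bm: "bounded_measurable M Q"
  proof (rule bounded_measurableI)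
    show "strongly_measurable M Q"
      unfolding strongly_measurable_def using P_simple Q by blast
    show "norm (Q \<xi>) \<le> 3 / 2" for \<xi> using Q_diff[of \<xi> 0] by (simp add: P_0)
  qed
  have "T (t n) Q \<ge> (1 / 6) * (4 / 3) ^ n" for n
  proof -
    obtain L where L: "\<And>\<mu> B. bounded_measurable M \<mu> \<Longrightarrow> (\<And>\<xi>. norm (\<mu> \<xi>) \<le> B) \<Longrightarrow> T (t n) \<mu> \<le> L * B"
      using cont[OF t] by blast
    \<comment> \<open>The steps after index \<open>n\<close> sum to at most
      \<open>(3 / 2) * (1 / 3) ^ Suc n\<close>, which is \<open>?c\<close>. They cost at most
      \<open>?c * N (t n)\<close>, while step \<open>n\<close> gains
      \<open>(2 / 3) * (1 / 3) ^ n * N (t n)\<close>; the constant 1/6 is 2/3 - 1/2.\<close>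
    let ?c = "(1 / 2) * (1 / 3 :: real) ^ n"
    \<comment> \<open>\<open>N\<close> controls simple functions, and \<open>Q\<close> need not be
      simple. The tail is therefore cut at a finite stage: its simple part is charged to
      \<open>N\<close>, and the rest to the continuity constant \<open>L\<close>, where it vanishes
      as \<open>k\<close> grows.\<close>
    have le: "T (t n) (P (Suc n)) \<le> T (t n) Q + L * ((3 / 2) * (1 / 3) ^ (Suc n + k)) + ?c * N (t n)" for k
    proof -
      let ?m = "Suc n + k"
      let ?a = "\<lambda>\<xi>. P ?m \<xi> + (-1) *\<^sub>R Q \<xi>" and ?b = "\<lambda>\<xi>. P ?m \<xi> + (-1) *\<^sub>R P (Suc n) \<xi>"
      have ab: "bounded_measurable M ?a" "bounded_measurable M ?b"
        by (intro bounded_measurable_add bounded_measurable_scaleR P_bm Q_bm)+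
      have a: "T (t n) ?a \<le> L * ((3 / 2) * (1 / 3) ^ ?m)"
        using Q_diff[of _ ?m] by (intro L ab) (simp add: norm_minus_commute)
      have b: "T (t n) ?b \<le> ?c * N (t n)"
      proof -
        have "(\<lambda>\<xi>. (1 / ?c) *\<^sub>R ?b \<xi>) \<in> S"
        proof -
          have "simple_function M (\<lambda>\<xi>. (1 / ?c) *\<^sub>R ?b \<xi>)"
            by (rule simple_function_compose2[OF P_simple P_simple])
          moreover have "norm ((1 / ?c) *\<^sub>R ?b \<xi>) \<le> 1" for \<xi>
            using P_diff[of "Suc n" k \<xi>] by (subst norm_scaleR) (simp add: field_simps)
          ultimately show ?thesis by (simp add: S_def)
        qed
        then have "T (t n) (\<lambda>\<xi>. (1 / ?c) *\<^sub>R ?b \<xi>) \<le> N (t n)" by (rule T_le_N[OF t])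
        then show ?thesis unfolding scale[OF t ab(2)] by (simp add: field_simps)
      qed
      have "T (t n) (P (Suc n)) = T (t n) (\<lambda>\<xi>. (Q \<xi> + ?a \<xi>) + (-1) *\<^sub>R ?b \<xi>)"
        by simp
      also have "\<dots> \<le> T (t n) (\<lambda>\<xi>. Q \<xi> + ?a \<xi>) + T (t n) (\<lambda>\<xi>. (-1) *\<^sub>R ?b \<xi>)"
        by (intro add t bounded_measurable_add[OF Q_bm ab(1)] bounded_measurable_scaleR ab)
      also have "\<dots> \<le> (T (t n) Q + T (t n) ?a) + T (t n) ?b"
        using add[OF t Q_bm ab(1), of n] scale[OF t ab(2), of n "-1"] by simp
      finally show ?thesis using a b by linarith
    qed
    have "(\<lambda>k. T (t n) Q + L * ((3 / 2) * (1 / 3) ^ (k + Suc n)) + ?c * N (t n)) \<longlonglongrightarrow> T (t n) Q + L * ((3 / 2) * 0) + ?c * N (t n)"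
      by (intro tendsto_intros LIMSEQ_ignore_initial_segment) simp
    then have "T (t n) (P (Suc n)) \<le> T (t n) Q + L * ((3 / 2) * 0) + ?c * N (t n)"
    proof (rule LIMSEQ_le_const)
      show "\<exists>m. \<forall>k\<ge>m. T (t n) (P (Suc n)) \<le> T (t n) Q + L * ((3 / 2) * (1 / 3) ^ (k + Suc n)) + ?c * N (t n)"
        using le by (metis add.commute)
    qed
    then have "(1 / 3) ^ n * ((2 / 3) * N (t n)) \<le> T (t n) Q + ?c * N (t n)"
      using Ty[of n] T_P[of n] by simp
    then have "(1 / 6) * ((1 / 3) ^ n * N (t n)) \<le> T (t n) Q" by (simp add: algebra_simps)
    moreover have "(1 / 6) * ((1 / 3) ^ n * 4 ^ n) \<le> (1 / 6) * ((1 / 3) ^ n * N (t n))"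
      using N[of n] by (intro mult_left_mono) auto
    ultimately show ?thesis by (simp flip: power_mult_distrib)
  qed
  moreover obtain C where "\<And>n. T (t n) Q \<le> C" using ptw[OF Q_bm] t by blast
  ultimately have "(1 / 6) * (4 / 3) ^ n \<le> C" for n :: nat by (meson order_trans)
  then have "(4 / 3 :: real) ^ n \<le> 6 * C" for n by (simp add: field_simps)
  moreover obtain n where "6 * C < (4 / 3 :: real) ^ n"
    using real_arch_pow[of "4 / 3" "6 * C"] by auto
  ultimately show False by (meson not_le)
qed

section \<open>Orthogonality of characters on the period cell\<close>

lemma measurable_freq_box [measurable]: "freq_box \<in> sets borel"
proof -
  have "freq_box = (\<Inter>b\<in>Basis. {\<xi> :: real ^ 'a. 1 \<le> \<xi> \<bullet> b \<and> \<xi> \<bullet> b < 2})"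
    by (auto simp: freq_box_def)
  also have "\<dots> \<in> sets borel"
    by (intro sets.finite_INT) auto
  finally show ?thesis .
qed

text \<open>The integrand factors over the coordinates. The factor for \<open>i\<close> is
  integrated over full periods of its character, and each other factor is the integral of 1 over a
  unit interval.\<close>

lemma
  fixes i :: "'d::finite"
  shows integrable_box_char: "integrable lborel (\<lambda>\<xi>. indicat_real freq_box \<xi> *\<^sub>R torus_char i k \<xi>)"
    and integral_box_char: "integral\<^sup>L lborel (\<lambda>\<xi>. indicat_real freq_box \<xi> *\<^sub>R torus_char i k \<xi>) = (if k = 0 then 1 else 0)"
proof -
  let ?e = "axis i 1 :: real ^ 'd"
  define h where "h b u = complex_of_real (indicat_real {1..<2} u) * (if b = ?e then cis (2 * pi * of_int k * u) else 1)" for b :: "real ^ 'd" and u :: real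
  have e: "?e \<in> Basis" by (simp add: axis_in_Basis_iff)
  have eq: "indicat_real freq_box \<xi> *\<^sub>R torus_char i k \<xi> = (\<Prod>b\<in>Basis. h b (\<xi> \<bullet> b))" for \<xi> :: "real ^ 'd"
  proof -
    have "(\<Prod>b\<in>Basis. complex_of_real (indicat_real {1..<2} (\<xi> \<bullet> b))) = of_real (indicat_real freq_box \<xi>)"
      by (auto simp: freq_box_def indicator_def prod_eq_1_iff intro: prod.neutral)
    moreover have "(\<Prod>b\<in>Basis. if b = ?e then cis (2 * pi * of_int k * (\<xi> \<bullet> b)) else 1) = torus_char i k \<xi>"
      using e by (simp add: prod.delta torus_char_def inner_axis)
    ultimately show ?thesis by (simp add: h_def prod.distrib scaleR_conv_of_real)
  qed
  have set: "set_integrable lborel {1..2} (\<lambda>u::real. cis (2 * pi * of_int l * u))" for l :: int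
    by (intro borel_integrable_atLeastAtMost' continuous_intros)
  \<comment> \<open>The cell is half-open while the fundamental theorem of calculus is applied on
    the closed interval; they differ in one point.\<close>
  have ind: "indicator {1..<2} u = indicat_real {1..2} u" if "u \<noteq> 2" for u :: real
    using that by (auto simp: indicator_def)
  have h_eq: "h b u = indicat_real {1..<2} u *\<^sub>R cis (2 * pi * of_int (if b = ?e then k else 0) * u)" for b u
    by (simp add: h_def scaleR_conv_of_real)
  have int: "integrable lborel (\<lambda>u. indicat_real {1..<2} u *\<^sub>R cis (2 * pi * of_int l * u))" for l :: int
    by (rule set_integrable_subset[OF set[of l], of "{1..<2}", unfolded set_integrable_def]) auto
  have val: "(CLINT u|lborel. indicat_real {1..<2} u *\<^sub>R cis (2 * pi * of_int l * u)) = (if l = 0 then 1 else 0)" for l :: int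
  proof -
    have "(CLINT u|lborel. indicat_real {1..<2} u *\<^sub>R cis (2 * pi * of_int l * u)) =
        (CLINT u|lborel. indicat_real {1..2} u *\<^sub>R cis (2 * pi * of_int l * u))"
    proof (rule integral_cong_AE)
      have "AE u in lborel. u \<noteq> (2::real)" by (rule AE_lborel_singleton)
      then show "AE u in lborel. indicat_real {1..<2} u *\<^sub>R cis (2 * pi * of_int l * u) = indicat_real {1..2} u *\<^sub>R cis (2 * pi * of_int l * u)"
        by eventually_elim (simp add: ind)
    qed (use int[of l] set[of l] in \<open>auto simp: set_integrable_def dest: borel_measurable_integrable\<close>)
    also have "\<dots> = (if l = 0 then 1 else 0)"
    proof (cases "l = 0")
      case True
      then show ?thesis by simp
    next
      case False
      let ?F = "\<lambda>u::real. cis (2 * pi * of_int l * u) / (\<i> * of_real (2 * pi * of_int l))"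
      have "(CLINT u|lborel. indicat_real {1..2} u *\<^sub>R cis (2 * pi * of_int l * u)) = ?F 2 - ?F 1"
      proof (rule integral_FTC_Icc)
        show "(?F has_vector_derivative cis (2 * pi * of_int l * u)) (at u within {1..2})" for u
        proof -
          have "((\<lambda>u. exp (\<i> * of_real (2 * pi * of_int l) * of_real u) / (\<i> * of_real (2 * pi * of_int l))) has_vector_derivative
             (exp (\<i> * of_real (2 * pi * of_int l) * of_real u))) (at u within {1..2})"
            using False by (auto intro!: derivative_eq_intros has_vector_derivative_real_field simp: field_simps)
          then show ?thesis by (simp add: cis_conv_exp mult_ac)
        qed
        show "continuous_on {1..2} (\<lambda>u::real. cis (2 * pi * of_int l * u))"
          by (intro continuous_intros)
      qed simp
      also have "\<dots> = 0"
        using cis_multiple_2pi[of "of_int l * 2"] cis_multiple_2pi[of "of_int l"] by (simp add: mult_ac)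
      finally show ?thesis using False by simp
    qed
    finally show ?thesis .
  qed
  show "integrable lborel (\<lambda>\<xi>. indicat_real freq_box \<xi> *\<^sub>R torus_char i k \<xi>)"
    unfolding eq by (rule integrable_lborel_prod_Basis) (simp only: h_eq int)
  have "integral\<^sup>L lborel (\<lambda>\<xi>. indicat_real freq_box \<xi> *\<^sub>R torus_char i k \<xi>) = (\<Prod>b\<in>Basis. integral\<^sup>L lborel (h b))"
    unfolding eq by (rule integral_lborel_prod_Basis) (simp only: h_eq int)
  also have "\<dots> = (\<Prod>b\<in>Basis. if b = ?e then (if k = 0 then 1 else 0) else 1)"
  proof (rule prod.cong[OF refl])
    fix b :: "real ^ 'd"
    show "integral\<^sup>L lborel (h b) = (if b = ?e then (if k = 0 then 1 else 0) else 1)"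
      using val[of "if b = ?e then k else 0", folded h_eq] by simp
  qed
  also have "\<dots> = (if k = 0 then 1 else 0)"
    using e by (simp add: prod.delta)
  finally show "integral\<^sup>L lborel (\<lambda>\<xi>. indicat_real freq_box \<xi> *\<^sub>R torus_char i k \<xi>) = (if k = 0 then 1 else 0)" .
qed

text \<open>The trivial character \<open>k = 0\<close> supplies the volume.\<close>

lemma emeasure_freq_box: "emeasure lborel (freq_box :: (real ^ 'd::finite) set) = 1"
proof -
  let ?Q = "freq_box :: (real ^ 'd) set"
  have int: "integrable lborel (indicat_real ?Q)"
    using integrable_norm[OF integrable_box_char[of _ 0]] by simp
  have "complex_of_real (integral\<^sup>L lborel (indicat_real ?Q)) = 1"
    using integral_box_char[of _ 0] by (simp add: torus_char_def scaleR_conv_of_real)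
  then have 1: "integral\<^sup>L lborel (indicat_real ?Q) = 1"
    by (simp only: of_real_eq_1_iff)
  have "emeasure lborel ?Q = (\<integral>\<^sup>+\<xi>. ennreal (indicat_real ?Q \<xi>) \<partial>lborel)"
    by (simp add: ennreal_indicator)
  also have "\<dots> = ennreal (integral\<^sup>L lborel (indicat_real ?Q))"
    by (rule nn_integral_eq_integral[OF int]) simp
  also have "\<dots> = 1" by (simp only: 1 ennreal_1)
  finally show ?thesis .
qed

lemma norm_bounds_freq_box:
  assumes "\<xi> \<in> (freq_box :: (real ^ 'd::finite) set)"
  shows "1 \<le> norm \<xi>" "norm \<xi> \<le> 2 * real CARD('d)"
proof -
  obtain b :: "real ^ 'd" where b: "b \<in> Basis" using nonempty_Basis by blast
  have "1 \<le> \<xi> \<bullet> b" using assms b by (auto simp: freq_box_def)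
  also have "\<dots> \<le> norm \<xi>" using Basis_le_norm[OF b, of \<xi>] by simp
  finally show "1 \<le> norm \<xi>" .
  have "norm \<xi> \<le> (\<Sum>b\<in>Basis. \<bar>\<xi> \<bullet> b\<bar>)" by (rule norm_le_l1)
  also have "\<dots> \<le> (\<Sum>b\<in>(Basis :: (real ^ 'd) set). 2)"
    using assms by (intro sum_mono) (force simp: freq_box_def)
  also have "\<dots> = 2 * real CARD('d)" by simp
  finally show "norm \<xi> \<le> 2 * real CARD('d)" .
qed

lemma norm_int_char_sum_le: "norm (\<Sum>k\<in>J. torus_char i k \<xi> *\<^sub>C (x k :: 'x::complex_normed_vector)) \<le> (\<Sum>k\<in>J. norm (x k))"
  by (rule order_trans[OF norm_sum]) (simp add: norm_scaleC)

lemma strongly_measurable_int_char_sum: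
  "strongly_measurable lborel (\<lambda>\<xi>. \<Sum>k\<in>J. torus_char i k \<xi> *\<^sub>C (x k :: 'x::complex_normed_vector))"
  by (intro strongly_measurable_sum strongly_measurable_scaleC strongly_measurable_borel strongly_measurable_const) simp

lemma
  fixes \<mu> :: "real ^ 'd::finite \<Rightarrow> ('x::complex_banach, 'y::complex_banach) cblinfun"
  assumes \<mu>: "strongly_measurable lborel \<mu>" and B: "\<And>\<xi>. norm (\<mu> \<xi>) \<le> B"
  shows strongly_measurable_multiplier_integrand: "strongly_measurable lborel (multiplier_integrand i \<mu> J x j)"
    and nn_integral_multiplier_integrand_le:
      "(\<integral>\<^sup>+\<xi>. norm (multiplier_integrand i \<mu> J x j \<xi>) \<partial>lborel) \<le> ennreal (B * (\<Sum>k\<in>J. norm (x k)))"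
    and nn_integral_multiplier_integrand_finite: "(\<integral>\<^sup>+\<xi>. norm (multiplier_integrand i \<mu> J x j \<xi>) \<partial>lborel) < \<infinity>"
proof -
  show "strongly_measurable lborel (multiplier_integrand i \<mu> J x j)"
    unfolding multiplier_integrand_def
    by (intro strongly_measurable_scaleR strongly_measurable_scaleC strongly_measurable_cblinfun \<mu>
        strongly_measurable_int_char_sum strongly_measurable_borel) simp_all
  have B0: "B \<ge> 0" using B[of undefined] norm_ge_zero order_trans by blast
  let ?X = "\<Sum>k\<in>J. norm (x k)"
  have "(\<integral>\<^sup>+\<xi>. norm (multiplier_integrand i \<mu> J x j \<xi>) \<partial>lborel) \<le>
      (\<integral>\<^sup>+\<xi>. ennreal (B * ?X) * indicator (freq_box :: (real ^ 'd) set) \<xi> \<partial>lborel)"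
  proof (rule nn_integral_mono)
    fix \<xi> :: "real ^ 'd"
    have "norm (cblinfun_apply (\<mu> \<xi>) (\<Sum>k\<in>J. torus_char i k \<xi> *\<^sub>C x k)) \<le> B * ?X"
      using B B0 by (intro order_trans[OF norm_cblinfun_apply] mult_mono norm_int_char_sum_le) auto
    then show "ennreal (norm (multiplier_integrand i \<mu> J x j \<xi>)) \<le> ennreal (B * ?X) * indicator freq_box \<xi>"
      by (auto simp: multiplier_integrand_def indicator_def norm_scaleC intro: ennreal_leI)
  qed
  also have "\<dots> = ennreal (B * ?X)"
    by (simp add: nn_integral_cmult_indicator emeasure_freq_box)
  finally show le: "(\<integral>\<^sup>+\<xi>. norm (multiplier_integrand i \<mu> J x j \<xi>) \<partial>lborel) \<le> ennreal (B * ?X)" .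
  show "(\<integral>\<^sup>+\<xi>. norm (multiplier_integrand i \<mu> J x j \<xi>) \<partial>lborel) < \<infinity>"
    by (rule le_less_trans[OF le]) simp
qed

lemma norm_discrete_multiplier_le:
  assumes \<mu>: "strongly_measurable lborel \<mu>" and B: "\<And>\<xi>. norm (\<mu> \<xi>) \<le> B"
  shows "norm (discrete_multiplier i \<mu> J x j) \<le> B * (\<Sum>k\<in>J. norm (x k))"
proof -
  have "B \<ge> 0" using B[of undefined] norm_ge_zero order_trans by blast
  then have "B * (\<Sum>k\<in>J. norm (x k)) \<ge> 0" by (simp add: sum_nonneg)
  moreover have "ennreal (norm (discrete_multiplier i \<mu> J x j)) \<le> ennreal (B * (\<Sum>k\<in>J. norm (x k)))"
    unfolding discrete_multiplier_def
    by (rule order_trans[OF Bochner_integral_norm_bound nn_integral_multiplier_integrand_le[OF \<mu> B]])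
  ultimately show ?thesis by simp
qed

lemma discrete_multiplier_add:
  assumes "bounded_measurable lborel \<mu>" "bounded_measurable lborel \<nu>"
  shows "discrete_multiplier i (\<lambda>\<xi>. \<mu> \<xi> + \<nu> \<xi>) J x j = discrete_multiplier i \<mu> J x j + discrete_multiplier i \<nu> J x j"
proof -
  obtain A B where *: "strongly_measurable lborel \<mu>" "\<And>\<xi>. norm (\<mu> \<xi>) \<le> A"
    "strongly_measurable lborel \<nu>" "\<And>\<xi>. norm (\<nu> \<xi>) \<le> B"
    using assms unfolding bounded_measurable_def by blast
  have "multiplier_integrand i (\<lambda>\<xi>. \<mu> \<xi> + \<nu> \<xi>) J x j =
      (\<lambda>\<xi>. multiplier_integrand i \<mu> J x j \<xi> + multiplier_integrand i \<nu> J x j \<xi>)"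
    by (simp add: fun_eq_iff multiplier_integrand_def cblinfun.add_left scaleC.add_right scaleR_add_right)
  then show ?thesis
    unfolding discrete_multiplier_def
    by (simp add: Bochner_integral_add strongly_measurable_multiplier_integrand[OF *(1,2)] strongly_measurable_multiplier_integrand[OF *(3,4)]
        nn_integral_multiplier_integrand_finite[OF *(1,2), simplified] nn_integral_multiplier_integrand_finite[OF *(3,4), simplified])
qed

lemma discrete_multiplier_scaleR:
  assumes "bounded_measurable lborel \<mu>"
  shows "discrete_multiplier i (\<lambda>\<xi>. c *\<^sub>R \<mu> \<xi>) J x j = c *\<^sub>R discrete_multiplier i \<mu> J x j"
proof -
  obtain A where *: "strongly_measurable lborel \<mu>" "\<And>\<xi>. norm (\<mu> \<xi>) \<le> A"
    using assms unfolding bounded_measurable_def by blast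
  have "multiplier_integrand i (\<lambda>\<xi>. c *\<^sub>R \<mu> \<xi>) J x j = (\<lambda>\<xi>. c *\<^sub>R multiplier_integrand i \<mu> J x j \<xi>)"
    by (simp add: fun_eq_iff multiplier_integrand_def cblinfun.scaleR_left scaleC.scaleR_right mult.commute)
  then show ?thesis
    unfolding discrete_multiplier_def
    using Bochner_integral_bounded_linear[OF bounded_linear_scaleR_right strongly_measurable_multiplier_integrand[OF *]
        nn_integral_multiplier_integrand_finite[OF *]] by simp
qed

section \<open>A uniform bound for simple multipliers\<close>

definition all_multipliers_bounded ::
    "'d::finite itself \<Rightarrow> ('x::complex_banach \<times> 'y::complex_banach) itself \<Rightarrow> real \<Rightarrow> real \<Rightarrow> real \<Rightarrow> bool" where
  "all_multipliers_bounded (_ :: 'd itself) (_ :: ('x \<times> 'y) itself) p q e \<longleftrightarrow>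
     (\<forall>m :: real ^ 'd \<Rightarrow> ('x, 'y) cblinfun.
        X_strongly_measurable m \<and> gamma_bounded (range (\<lambda>\<xi>. rpow (norm \<xi>) e *\<^sub>R m \<xi>)) \<longrightarrow> multiplier_bounded p q m)"

text \<open>The multiplier vanishes off the cell, and on the cell both \<open>norm \<xi>\<close> and
  \<open>weight \<xi>\<close> lie between positive constants. Its values stay bounded after
  multiplication by the power of \<open>norm \<xi>\<close>, and bounded sets of these operators are
  gamma-bounded.\<close>

lemma multiplier_bounded_on_box:
  fixes \<mu> :: "real ^ 'd::finite \<Rightarrow> ('x::complex_banach, 'y::complex_banach) cblinfun"
  assumes H: "all_multipliers_bounded TYPE('d) TYPE('x \<times> 'y) p q e"
    and types: "has_cotype TYPE('x) 2" "has_type TYPE('y) 2"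
    and \<mu>: "bounded_measurable lborel \<mu>"
  shows "multiplier_bounded p q (\<lambda>\<xi>. (indicat_real freq_box \<xi> / (weight \<xi>)\<^sup>2) *\<^sub>R \<mu> \<xi>)"
proof -
  let ?m = "\<lambda>\<xi>. (indicat_real freq_box \<xi> / (weight \<xi>)\<^sup>2) *\<^sub>R \<mu> \<xi>"
  obtain A where sm: "strongly_measurable lborel \<mu>" and A: "\<And>\<xi>. norm (\<mu> \<xi>) \<le> A"
    using \<mu> unfolding bounded_measurable_def by blast
  have A0: "A \<ge> 0" using A[of undefined] norm_ge_zero order_trans by blast
  have [measurable]: "(weight :: real ^ 'd \<Rightarrow> real) \<in> borel_measurable borel"
    unfolding weight_def by measurable
  have "strongly_measurable lborel ?m"
    by (intro strongly_measurable_scaleR sm strongly_measurable_borel) simp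
  then have "X_strongly_measurable ?m"
    unfolding X_strongly_measurable_def by (intro allI strongly_measurable_cblinfun strongly_measurable_const)
  moreover have "gamma_bounded (range (\<lambda>\<xi>. rpow (norm \<xi>) e *\<^sub>R ?m \<xi>))"
  proof (rule gamma_bounded_of_bounded[OF types])
    define R where "R = 2 * real CARD('d)"
    have "real 1 \<le> real CARD('d)" by (subst of_nat_le_iff) (simp add: Suc_le_eq)
    then have R: "R \<ge> 1" unfolding R_def by linarith
    fix S assume "S \<in> range (\<lambda>\<xi>. rpow (norm \<xi>) e *\<^sub>R ?m \<xi>)"
    then obtain \<xi> where S: "S = rpow (norm \<xi>) e *\<^sub>R ?m \<xi>" by blast
    \<comment> \<open>As \<open>norm \<xi>\<close> is at least one on the cell, replacing
      \<open>e\<close> by its absolute value only enlarges the power.\<close>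
    show "norm S \<le> R powr \<bar>e\<bar> * (1 / (exp (- pi * R\<^sup>2))\<^sup>2 * A)"
    proof (cases "\<xi> \<in> freq_box")
      case False
      then show ?thesis using A0 by (simp add: S)
    next
      case True
      note bounds = norm_bounds_freq_box[OF True, folded R_def]
      have 1: "\<bar>rpow (norm \<xi>) e\<bar> \<le> R powr \<bar>e\<bar>"
      proof -
        have "norm \<xi> powr e \<le> norm \<xi> powr \<bar>e\<bar>" using bounds by (intro powr_mono) auto
        also have "\<dots> \<le> R powr \<bar>e\<bar>" using bounds by (intro powr_mono2) auto
        finally show ?thesis using R by (auto simp: rpow_def)
      qed
      have "(norm \<xi>)\<^sup>2 \<le> R\<^sup>2" using bounds by (intro power_mono) auto
      then have "exp (- pi * R\<^sup>2) \<le> weight \<xi>"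
        by (simp add: weight_def)
      then have "1 / (weight \<xi>)\<^sup>2 \<le> 1 / (exp (- pi * R\<^sup>2))\<^sup>2"
        using weight_pos[of \<xi>] by (intro divide_left_mono power_mono mult_pos_pos zero_less_power) auto
      then have 2: "1 / (weight \<xi>)\<^sup>2 * norm (\<mu> \<xi>) \<le> 1 / (exp (- pi * R\<^sup>2))\<^sup>2 * A"
        by (intro mult_mono A) auto
      have "\<bar>rpow (norm \<xi>) e\<bar> * (1 / (weight \<xi>)\<^sup>2 * norm (\<mu> \<xi>)) \<le> R powr \<bar>e\<bar> * (1 / (exp (- pi * R\<^sup>2))\<^sup>2 * A)"
        by (rule mult_mono[OF 1 2]) auto
      then show ?thesis using True by (simp add: S)
    qed
  qed
  ultimately show ?thesis using H unfolding all_multipliers_bounded_def by blast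
qed

text \<open>Multipliers are restricted to the simple ones that serve as tests. The size of the
  output is expressed by pairing with \<open>b\<close>, so \<open>s\<close> is dual to the exponent
  of the target.\<close>

definition discretely_bounded ::
    "'d::finite \<Rightarrow> ('x::complex_banach \<times> 'y::complex_banach) itself \<Rightarrow> real \<Rightarrow> real \<Rightarrow> real \<Rightarrow> bool" where
  "discretely_bounded i (_ :: ('x \<times> 'y) itself) p s K \<longleftrightarrow> K \<ge> 0 \<and>
     (\<forall>(\<mu> :: real ^ 'd \<Rightarrow> ('x, 'y) cblinfun) J x J' b.
        simple_function lborel \<mu> \<longrightarrow> (\<forall>\<xi>. norm (\<mu> \<xi>) \<le> 1) \<longrightarrow> finite J \<longrightarrow> finite J' \<longrightarrow> (\<forall>j. b j \<ge> 0) \<longrightarrow>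
        (\<Sum>j\<in>J'. b j * norm (discrete_multiplier i \<mu> J x j)) \<le>
        K * (\<Sum>j\<in>J'. b j powr s) powr (1 / s) * (\<Sum>k\<in>J. norm (x k) powr p) powr (1 / p))"

lemma discretely_boundedD:
  fixes \<mu> :: "real ^ 'd::finite \<Rightarrow> ('x::complex_banach, 'y::complex_banach) cblinfun"
  assumes "discretely_bounded i TYPE('x \<times> 'y) p s K" "simple_function lborel \<mu>" "\<And>\<xi>. norm (\<mu> \<xi>) \<le> 1"
    and "finite J" "finite J'" "\<And>j. b j \<ge> 0"
  shows "(\<Sum>j\<in>J'. b j * norm (discrete_multiplier i \<mu> J x j)) \<le>
    K * (\<Sum>j\<in>J'. b j powr s) powr (1 / s) * (\<Sum>k\<in>J. norm (x k) powr p) powr (1 / p)"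
  using assms unfolding discretely_bounded_def by blast

text \<open>Each finite test \<open>(J, x, J', b)\<close> is a sublinear functional of \<mu>,
  normalized by \<open>?W\<close>. A single multiplier satisfies all tests with its own constant,
  and this is the pointwise hypothesis of the gliding hump.\<close>

lemma exists_discrete_bound:
  fixes i :: "'d::finite"
  assumes H: "all_multipliers_bounded TYPE('d) TYPE('x::complex_banach \<times> 'y::complex_banach) p q e"
    and types: "has_cotype TYPE('x) 2" "has_type TYPE('y) 2"
    and p: "p \<ge> 1" and q: "q > 1" "q' > 1" "1 / q + 1 / q' = 1"
  shows "\<exists>K. discretely_bounded i TYPE('x \<times> 'y) p q' K"
proof -
  let ?W = "\<lambda>(J, x, J', b). (\<Sum>j\<in>J'. b j powr q') powr (1 / q') * (\<Sum>k\<in>J. norm (x k :: 'x) powr p) powr (1 / p)"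
  let ?Z = "\<lambda>(J, x, J', b) \<mu>. \<Sum>j\<in>J'. b j * norm (discrete_multiplier i (\<mu> :: real ^ 'd \<Rightarrow> ('x, 'y) cblinfun) J x j)"
  define I where "I = {(J :: int set, x, J' :: int set, b). finite J \<and> finite J' \<and> (\<forall>j. b j \<ge> 0) \<and> ?W (J, x, J', b) > 0}"
  have single: "\<exists>K. \<forall>J x J' b. finite J \<longrightarrow> finite J' \<longrightarrow> (\<forall>j. b j \<ge> 0) \<longrightarrow>
      ?Z (J, x, J', b) \<mu> \<le> K * ?W (J, x, J', b)" if "bounded_measurable lborel \<mu>" for \<mu>
    using discrete_multiplier_bounded[OF p q multiplier_bounded_on_box[OF H types that], of i]
    by (simp add: mult.assoc)
  have "\<exists>C. \<forall>t\<in>I. \<forall>\<mu>. simple_function lborel \<mu> \<longrightarrow> (\<forall>\<xi>. norm (\<mu> \<xi>) \<le> 1) \<longrightarrow> ?Z t \<mu> / ?W t \<le> C"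
  proof (rule uniformly_bounded_on_simple_functions)
    fix t and \<mu> \<nu> :: "real ^ 'd \<Rightarrow> ('x, 'y) cblinfun" and c
    assume t: "t \<in> I" and \<mu>: "bounded_measurable lborel \<mu>" and \<nu>: "bounded_measurable lborel \<nu>"
    obtain J x J' b where t_eq: "t = (J, x, J', b)" by (cases t) auto
    have b: "\<And>j. b j \<ge> 0" and W: "?W t > 0" using t by (auto simp: I_def t_eq)
    have "?Z t (\<lambda>\<xi>. \<mu> \<xi> + \<nu> \<xi>) \<le> ?Z t \<mu> + ?Z t \<nu>"
      unfolding t_eq using b
      by (simp add: discrete_multiplier_add[OF \<mu> \<nu>] sum.distrib[symmetric] distrib_left[symmetric] sum_mono mult_left_mono norm_triangle_ineq)
    then show "?Z t (\<lambda>\<xi>. \<mu> \<xi> + \<nu> \<xi>) / ?W t \<le> ?Z t \<mu> / ?W t + ?Z t \<nu> / ?W t"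
      using W by (simp add: add_divide_distrib[symmetric] divide_right_mono)
  next
    fix t and \<mu> :: "real ^ 'd \<Rightarrow> ('x, 'y) cblinfun" and c
    assume t: "t \<in> I" and \<mu>: "bounded_measurable lborel \<mu>"
    obtain J x J' b where t_eq: "t = (J, x, J', b)" by (cases t) auto
    show "?Z t (\<lambda>\<xi>. c *\<^sub>R \<mu> \<xi>) / ?W t = \<bar>c\<bar> * (?Z t \<mu> / ?W t)"
      unfolding t_eq by (simp add: discrete_multiplier_scaleR[OF \<mu>] sum_distrib_left mult_ac)
  next
    fix t assume t: "t \<in> I"
    obtain J x J' b where t_eq: "t = (J, x, J', b)" by (cases t) auto
    have b: "\<And>j. b j \<ge> 0" and W: "?W t > 0" using t by (auto simp: I_def t_eq)
    have "?Z t \<mu> / ?W t \<le> (\<Sum>j\<in>J'. b j * (\<Sum>k\<in>J. norm (x k))) / ?W t * B"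
      if "bounded_measurable lborel \<mu>" "\<forall>\<xi>. norm (\<mu> \<xi>) \<le> B" for \<mu> B
    proof -
      have "norm (discrete_multiplier i \<mu> J x j) \<le> B * (\<Sum>k\<in>J. norm (x k))" for j
        using that by (intro norm_discrete_multiplier_le) (auto simp: bounded_measurable_def)
      then have "?Z t \<mu> \<le> (\<Sum>j\<in>J'. b j * (B * (\<Sum>k\<in>J. norm (x k))))"
        unfolding t_eq prod.case using b by (intro sum_mono mult_left_mono) auto
      also have "\<dots> = (\<Sum>j\<in>J'. b j * (\<Sum>k\<in>J. norm (x k))) * B"
        by (simp add: sum_distrib_right sum_distrib_left mult_ac)
      finally show ?thesis using W by (simp add: divide_right_mono)
    qed
    then show "\<exists>L. \<forall>\<mu> B. bounded_measurable lborel \<mu> \<longrightarrow> (\<forall>\<xi>. norm (\<mu> \<xi>) \<le> B) \<longrightarrow> ?Z t \<mu> / ?W t \<le> L * B"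
      by blast
  next
    fix \<mu> :: "real ^ 'd \<Rightarrow> ('x, 'y) cblinfun" assume \<mu>: "bounded_measurable lborel \<mu>"
    then obtain K where "\<And>J x J' b. finite J \<Longrightarrow> finite J' \<Longrightarrow> (\<forall>j. b j \<ge> 0) \<Longrightarrow> ?Z (J, x, J', b) \<mu> \<le> K * ?W (J, x, J', b)"
      using single by blast
    then have "?Z t \<mu> \<le> K * ?W t \<and> ?W t > 0" if "t \<in> I" for t
      using that by (cases t) (auto simp: I_def)
    then show "\<exists>C. \<forall>t\<in>I. ?Z t \<mu> / ?W t \<le> C"
      by (intro exI[of _ K] ballI) (simp add: pos_divide_le_eq)
  qed
  then obtain C where C: "\<And>t \<mu>. t \<in> I \<Longrightarrow> simple_function lborel \<mu> \<Longrightarrow> (\<And>\<xi>. norm (\<mu> \<xi>) \<le> 1) \<Longrightarrow> ?Z t \<mu> / ?W t \<le> C"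
    by blast
  have "?Z (J, x, J', b) \<mu> \<le> max C 0 * ?W (J, x, J', b)"
    if \<mu>: "simple_function lborel \<mu>" "\<And>\<xi>. norm (\<mu> \<xi>) \<le> 1" and fin: "finite J" "finite J'" and b: "\<And>j. b j \<ge> 0" for \<mu> J x J' b
  proof (cases "?W (J, x, J', b) > 0")
    case True
    then have "?Z (J, x, J', b) \<mu> / ?W (J, x, J', b) \<le> C"
      using fin b by (intro C \<mu>) (simp add: I_def)
    then have "?Z (J, x, J', b) \<mu> \<le> C * ?W (J, x, J', b)"
      using True by (simp only: pos_divide_le_eq)
    also have "\<dots> \<le> max C 0 * ?W (J, x, J', b)"
      using True by (intro mult_right_mono) auto
    finally show ?thesis .
  next
    \<comment> \<open>A test of zero weight cannot be normalized; for it the estimate with the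
      constant of this one \<mu> already has right-hand side zero.\<close>
    case False
    moreover have "?W (J, x, J', b) \<ge> 0" by simp
    ultimately have W: "?W (J, x, J', b) = 0" by linarith
    have "bounded_measurable lborel \<mu>"
      using \<mu> by (intro bounded_measurableI strongly_measurable_simple)
    then obtain K where "?Z (J, x, J', b) \<mu> \<le> K * ?W (J, x, J', b)"
      using single[of \<mu>] fin b by blast
    then show ?thesis unfolding W by simp
  qed
  then show ?thesis
    unfolding discretely_bounded_def by (intro exI[of _ "max C 0"]) (simp add: mult.assoc)
qed

section \<open>Trigonometric polynomials\<close>

lemma torus_char_0 [simp]: "torus_char i 0 \<xi> = 1"
  by (simp add: torus_char_def)

lemma torus_char_mult: "torus_char i j \<xi> * torus_char i k \<xi> = torus_char i (j + k) \<xi>"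
  by (simp add: torus_char_def cis_mult algebra_simps)

lemma cnj_torus_char: "cnj (torus_char i k \<xi>) = torus_char i (- k) \<xi>"
  by (simp add: torus_char_def cis_cnj)

lemma torus_char_of_nat: "torus_char i (int k) \<xi> = torus_char i 1 \<xi> ^ k"
  by (simp add: torus_char_def Complex.DeMoivre mult_ac)

definition trig_poly :: "'d::finite \<Rightarrow> (real ^ 'd \<Rightarrow> complex) \<Rightarrow> bool" where
  "trig_poly i h \<longleftrightarrow> (\<exists>J c. finite J \<and> h = (\<lambda>\<xi>. \<Sum>j\<in>J. c j * torus_char i j \<xi>))"

lemma trig_poly_char: "trig_poly i (\<lambda>\<xi>. c * torus_char i j \<xi>)"
  unfolding trig_poly_def by (intro exI[of _ "{j}"] exI[of _ "\<lambda>_. c"]) simp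

lemma trig_poly_add:
  assumes "trig_poly i g" "trig_poly i h"
  shows "trig_poly i (\<lambda>\<xi>. g \<xi> + h \<xi>)"
proof -
  obtain I J c d where I: "finite I" and J: "finite J"
    and g: "g = (\<lambda>\<xi>. \<Sum>j\<in>I. c j * torus_char i j \<xi>)" and h: "h = (\<lambda>\<xi>. \<Sum>j\<in>J. d j * torus_char i j \<xi>)"
    using assms unfolding trig_poly_def by blast
  have "(\<Sum>j\<in>I \<union> J. ((if j \<in> I then c j else 0) + (if j \<in> J then d j else 0)) * torus_char i j \<xi>) =
      (\<Sum>j\<in>I. c j * torus_char i j \<xi>) + (\<Sum>j\<in>J. d j * torus_char i j \<xi>)" for \<xi>
    using I J by (simp add: distrib_right sum.distrib if_distrib[of "\<lambda>c. c * _"] sum.If_cases Int_absorb1 Int_absorb2 cong: if_cong)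
  then show ?thesis
    unfolding trig_poly_def g h
    by (intro exI[of _ "I \<union> J"] exI[of _ "\<lambda>j. (if j \<in> I then c j else 0) + (if j \<in> J then d j else 0)"]) (simp add: I J)
qed

lemma trig_poly_sum:
  "finite A \<Longrightarrow> (\<And>a. a \<in> A \<Longrightarrow> trig_poly i (h a)) \<Longrightarrow> trig_poly i (\<lambda>\<xi>. \<Sum>a\<in>A. h a \<xi>)"
proof (induction A rule: finite_induct)
  case empty
  show ?case using trig_poly_char[of i 0 0] by simp
qed (simp add: trig_poly_add)

lemma trig_poly_mult:
  assumes "trig_poly i g" "trig_poly i h"
  shows "trig_poly i (\<lambda>\<xi>. g \<xi> * h \<xi>)"
proof -
  obtain I J c d where I: "finite I" and J: "finite J"
    and g: "g = (\<lambda>\<xi>. \<Sum>j\<in>I. c j * torus_char i j \<xi>)" and h: "h = (\<lambda>\<xi>. \<Sum>j\<in>J. d j * torus_char i j \<xi>)"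
    using assms unfolding trig_poly_def by blast
  have "(\<Sum>j\<in>I. c j * torus_char i j \<xi>) * (\<Sum>k\<in>J. d k * torus_char i k \<xi>) =
      (\<Sum>j\<in>I. \<Sum>k\<in>J. (c j * d k) * torus_char i (j + k) \<xi>)" for \<xi>
    unfolding torus_char_mult[symmetric] sum_product by (simp add: mult_ac)
  then show ?thesis
    unfolding g h using I J by (simp add: trig_poly_sum trig_poly_char)
qed

text \<open>A real-linear function of \<open>z\<close> is a combination of \<open>z\<close> and its
  conjugate, which on the circle are the characters of index 1 and -1; sums and products stay in the
  class.\<close>

lemma trig_poly_real_polynomial:
  assumes "real_polynomial_function g"
  shows "trig_poly i (\<lambda>\<xi>. complex_of_real (g (torus_char i 1 \<xi>)))"
  using assms
proof (induction g rule: real_polynomial_function.induct)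
  case (linear f)
  interpret bounded_linear f by fact
  have eq: "complex_of_real (f (torus_char i 1 \<xi>)) =
      ((f 1 - \<i> * f \<i>) / 2) * torus_char i 1 \<xi> + ((f 1 + \<i> * f \<i>) / 2) * torus_char i (- 1) \<xi>" for \<xi>
  proof -
    let ?z = "torus_char i 1 \<xi>"
    have "f ?z = f (Re ?z *\<^sub>R 1 + Im ?z *\<^sub>R \<i>)"
      by (rule arg_cong[of _ _ f]) (simp add: complex_eq_iff)
    also have "\<dots> = Re ?z * f 1 + Im ?z * f \<i>"
      by (simp only: add scaleR real_scaleR_def)
    finally have "f ?z = Re ?z * f 1 + Im ?z * f \<i>" .
    then show ?thesis
      unfolding cnj_torus_char[symmetric] by (simp add: complex_eq_iff field_simps)
  qed
  show ?case unfolding eq by (intro trig_poly_add trig_poly_char)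
next
  case (const c)
  show ?case using trig_poly_char[of i "complex_of_real c" 0] by simp
qed (simp_all add: trig_poly_add trig_poly_mult)

definition char_sum :: "'d::finite \<Rightarrow> nat \<Rightarrow> (nat \<Rightarrow> 'x::complex_normed_vector) \<Rightarrow> real ^ 'd \<Rightarrow> 'x" where
  "char_sum i n x \<xi> = (\<Sum>k<n. torus_char i (int k) \<xi> *\<^sub>C x k)"

lemma char_sum_int: "(\<Sum>k\<in>int ` {..<n}. torus_char i k \<xi> *\<^sub>C x (nat k)) = char_sum i n x \<xi>"
  unfolding char_sum_def by (subst sum.reindex) (auto simp: comp_def)

lemma norm_char_sum: "norm (char_sum i n x \<xi>) \<le> (\<Sum>k<n. norm (x k))"
  unfolding char_sum_def by (rule order_trans[OF norm_sum]) (simp add: norm_scaleC)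

lemma strongly_measurable_char_sum: "strongly_measurable lborel (char_sum i n x)"
  unfolding char_sum_def
  by (intro strongly_measurable_sum strongly_measurable_scaleC strongly_measurable_borel strongly_measurable_const) simp

lemma measurable_norm_char_sum [measurable]: "(\<lambda>\<xi>. norm (char_sum i n x \<xi>)) \<in> borel_measurable borel"
  using strongly_measurable_norm[OF strongly_measurable_char_sum] by simp

lemma char_sum_circle:
  "char_sum i n x \<xi> = (\<Sum>k<n. torus_char i 1 \<xi> ^ k *\<^sub>C x k)"
  by (simp add: char_sum_def torus_char_of_nat)

lemma continuous_on_power_sum:
  "continuous_on A (\<lambda>z. \<Sum>k<n. z ^ k *\<^sub>C (x k :: 'x::complex_normed_vector))"
  by (intro continuous_on_sum scaleC.continuous_on continuous_intros)

text \<open>The norm is a continuous function of the circle point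
  \<open>torus_char i 1 \<xi>\<close>, so Stone--Weierstrass on the circle is uniform in \<xi>. A
  polynomial is wanted because a discrete test admits finitely many coefficients.\<close>

lemma trig_poly_approx_norm:
  assumes "\<delta> > 0"
  obtains J c where "finite J" "\<And>\<xi>. norm ((\<Sum>j\<in>J. c j * torus_char i j \<xi>) - of_real (norm (char_sum i n x \<xi>))) \<le> \<delta>"
proof -
  let ?f = "\<lambda>z. norm (\<Sum>k<n. z ^ k *\<^sub>C x k)"
  have "continuous_on (sphere 0 1) ?f"
    by (intro continuous_on_norm continuous_on_power_sum)
  then obtain g where g: "real_polynomial_function g" "\<And>z. z \<in> sphere (0::complex) 1 \<Longrightarrow> \<bar>?f z - g z\<bar> < \<delta>"
    using Stone_Weierstrass_real_polynomial_function[of "sphere (0::complex) 1" ?f \<delta>] assms by auto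
  obtain J c where J: "finite J" and eq: "(\<lambda>\<xi>. complex_of_real (g (torus_char i 1 \<xi>))) = (\<lambda>\<xi>. \<Sum>j\<in>J. c j * torus_char i j \<xi>)"
    using trig_poly_real_polynomial[OF g(1), of i] unfolding trig_poly_def by blast
  have "norm ((\<Sum>j\<in>J. c j * torus_char i j \<xi>) - of_real (norm (char_sum i n x \<xi>))) \<le> \<delta>" for \<xi>
    using g(2)[of "torus_char i 1 \<xi>"] fun_cong[OF eq, of \<xi>, symmetric]
    by (simp add: char_sum_circle abs_minus_commute flip: of_real_diff)
  then show thesis using J that by blast
qed

text \<open>A finite \<delta>-net of \<open>K\<close> provides the values, and each point takes the
  first net element within \<delta>. The distance to a fixed vector is measurable, which makes this
  selection measurable.\<close>

lemma simple_approx_compact: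
  fixes f :: "'a \<Rightarrow> 'v::real_normed_vector"
  assumes f: "strongly_measurable M f" and K: "compact K" "f ` space M \<subseteq> K" and \<delta>: "\<delta> > 0"
  obtains S where "simple_function M S" "\<And>\<xi>. \<xi> \<in> space M \<Longrightarrow> norm (f \<xi> - S \<xi>) \<le> \<delta>"
proof -
  obtain C where C: "finite C" "K \<subseteq> (\<Union>c\<in>C. ball c \<delta>)"
    using compactE_image[OF K(1), of K "\<lambda>c. ball c \<delta>"] \<delta> by (metis UN_I centre_in_ball open_ball subsetI)
  obtain cs where cs: "set cs = C" using finite_list[OF C(1)] by blast
  have net: "\<exists>S. simple_function M S \<and> (\<forall>\<xi>\<in>space M. (\<exists>c\<in>set cs. norm (f \<xi> - c) < \<delta>) \<longrightarrow> norm (f \<xi> - S \<xi>) < \<delta>)" for cs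
  proof (induction cs)
    case Nil
    show ?case by (rule exI[of _ "\<lambda>_. 0"]) simp
  next
    case (Cons c cs)
    then obtain S where S: "simple_function M S"
      "\<And>\<xi>. \<xi> \<in> space M \<Longrightarrow> (\<exists>c\<in>set cs. norm (f \<xi> - c) < \<delta>) \<Longrightarrow> norm (f \<xi> - S \<xi>) < \<delta>"
      by blast
    have "(\<lambda>\<xi>. norm (f \<xi> - c)) \<in> borel_measurable M"
      by (rule strongly_measurable_norm_diff_simple[OF f]) simp
    then have "{\<xi>\<in>space M. norm (f \<xi> - c) < \<delta>} \<in> sets M" by measurable
    then have "simple_function M (\<lambda>\<xi>. if norm (f \<xi> - c) < \<delta> then c else S \<xi>)"
      using S(1) by (intro simple_function_If) auto
    then show ?case
      using S(2) by (intro exI[of _ "\<lambda>\<xi>. if norm (f \<xi> - c) < \<delta> then c else S \<xi>"]) auto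
  qed
  obtain S where S: "simple_function M S"
    "\<And>\<xi>. \<xi> \<in> space M \<Longrightarrow> (\<exists>c\<in>set cs. norm (f \<xi> - c) < \<delta>) \<Longrightarrow> norm (f \<xi> - S \<xi>) < \<delta>"
    using net[of cs] by blast
  have "norm (f \<xi> - S \<xi>) \<le> \<delta>" if \<xi>: "\<xi> \<in> space M" for \<xi>
  proof -
    have "f \<xi> \<in> (\<Union>c\<in>C. ball c \<delta>)" using \<xi> K C by blast
    then have "\<exists>c\<in>set cs. norm (f \<xi> - c) < \<delta>" by (auto simp: cs dist_norm norm_minus_commute)
    then show ?thesis using S(2)[OF \<xi>] by simp
  qed
  then show thesis using S(1) that by blast
qed

text \<open>The values lie in a continuous image of the circle. Any map composed with
  \<open>S\<close> is again simple, so choices made from \<open>S\<close> raise no measurability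
  question.\<close>

lemma simple_approx_char_sum:
  assumes "\<delta> > 0"
  obtains S where "simple_function lborel S" "\<And>\<xi>. norm (char_sum i n x \<xi> - S \<xi>) \<le> \<delta>"
proof -
  let ?\<Phi> = "\<lambda>z. \<Sum>k<n. z ^ k *\<^sub>C x k"
  have "compact (?\<Phi> ` sphere 0 1)"
    by (intro compact_continuous_image continuous_on_power_sum) simp
  moreover have "char_sum i n x ` space lborel \<subseteq> ?\<Phi> ` sphere 0 1"
    by (auto simp: char_sum_circle)
  ultimately show thesis
    by (rule simple_approx_compact[OF strongly_measurable_char_sum _ _ assms]) (auto intro: that)
qed

section \<open>From the torus to Gaussian sums\<close>

lemma measurable_randomized_char_sum:
  fixes x :: "nat \<Rightarrow> 'x::complex_banach" and i :: "'d::finite"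
  shows "(\<lambda>(\<gamma>, \<xi>). norm (char_sum i n (\<lambda>k. \<gamma> k *\<^sub>C x k) \<xi>)) \<in> borel_measurable (gaussian_space \<Otimes>\<^sub>M (lborel :: (real ^ 'd) measure))"
proof -
  let ?M = "gaussian_space \<Otimes>\<^sub>M (lborel :: (real ^ 'd) measure)"
  have "strongly_measurable ?M (\<lambda>(\<gamma>, \<xi>). char_sum i n (\<lambda>k. \<gamma> k *\<^sub>C x k) \<xi>)"
    unfolding case_prod_beta char_sum_def
    by (intro strongly_measurable_sum strongly_measurable_scaleC strongly_measurable_borel strongly_measurable_const) measurable
  from strongly_measurable_norm[OF this] show ?thesis
    by (simp add: case_prod_beta)
qed

text \<open>For each frequency the characters are unimodular, so they do not change the law of the Gaussian sum.\<close>

lemma nn_integral_randomized_char_sum: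
  fixes x :: "nat \<Rightarrow> 'x::complex_banach" and i :: "'d::finite"
  shows "(\<integral>\<^sup>+\<gamma>. (\<integral>\<^sup>+\<xi>. ennreal (indicat_real freq_box \<xi> * (norm (char_sum i n (\<lambda>k. \<gamma> k *\<^sub>C x k) \<xi>))\<^sup>2) \<partial>lborel) \<partial>gaussian_space)
    = ennreal ((gaussian_norm n x)\<^sup>2)"
proof -
  interpret G: prob_space gaussian_space by (rule prob_space_gaussian_space)
  interpret GL: pair_sigma_finite gaussian_space "lborel :: (real ^ 'd) measure" ..
  let ?M = "gaussian_space \<Otimes>\<^sub>M (lborel :: (real ^ 'd) measure)"
  have comm: "char_sum i n (\<lambda>k. \<gamma> k *\<^sub>C x k) \<xi> = (\<Sum>k<n. (torus_char i (int k) \<xi> * \<gamma> k) *\<^sub>C x k)" for \<gamma> \<xi>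
    by (simp add: char_sum_def scaleC_scaleC)
  note measurable_randomized_char_sum[of i n x, unfolded comm, measurable]
  have "(\<integral>\<^sup>+\<gamma>. (\<integral>\<^sup>+\<xi>. ennreal (indicat_real freq_box \<xi> * (norm (char_sum i n (\<lambda>k. \<gamma> k *\<^sub>C x k) \<xi>))\<^sup>2) \<partial>lborel) \<partial>gaussian_space) =
      (\<integral>\<^sup>+\<xi>. (\<integral>\<^sup>+\<gamma>. ennreal (indicat_real freq_box \<xi> * (norm (\<Sum>k<n. (torus_char i (int k) \<xi> * \<gamma> k) *\<^sub>C x k))\<^sup>2) \<partial>gaussian_space) \<partial>lborel)"
    unfolding comm by (rule GL.Fubini'[symmetric]) measurable
  also have "\<dots> = (\<integral>\<^sup>+\<xi>. ennreal ((gaussian_norm n x)\<^sup>2) * indicator (freq_box :: (real ^ 'd) set) \<xi> \<partial>lborel)"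
  proof (rule nn_integral_cong)
    fix \<xi> :: "real ^ 'd"
    have "(\<integral>\<^sup>+\<gamma>. ennreal ((norm (\<Sum>k<n. (torus_char i (int k) \<xi> * \<gamma> k) *\<^sub>C x k))\<^sup>2) \<partial>gaussian_space) = ennreal ((gaussian_norm n x)\<^sup>2)"
      by (rule gaussian_norm_invariant) (simp add: gaussian_invariant_mult)
    then show "(\<integral>\<^sup>+\<gamma>. ennreal (indicat_real freq_box \<xi> * (norm (\<Sum>k<n. (torus_char i (int k) \<xi> * \<gamma> k) *\<^sub>C x k))\<^sup>2) \<partial>gaussian_space) =
        ennreal ((gaussian_norm n x)\<^sup>2) * indicator freq_box \<xi>"
      by (simp add: indicator_def)
  qed
  also have "\<dots> = ennreal ((gaussian_norm n x)\<^sup>2)"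
    by (simp add: nn_integral_cmult_indicator emeasure_freq_box)
  finally show ?thesis .
qed

text \<open>Squared, unlike \<open>gaussian_norm\<close>: its average over randomized coefficients
  is the square of \<open>gaussian_norm\<close>.\<close>

definition box_norm2 :: "'d::finite \<Rightarrow> nat \<Rightarrow> (nat \<Rightarrow> 'x::complex_normed_vector) \<Rightarrow> real" where
  "box_norm2 i n x = (\<integral>\<xi>. indicat_real freq_box \<xi> * (norm (char_sum i n x \<xi>))\<^sup>2 \<partial>lborel)"

lemma integrable_on_box:
  fixes h :: "real ^ 'd::finite \<Rightarrow> 'b::{banach, second_countable_topology}"
  assumes [measurable]: "h \<in> borel_measurable borel" and "\<And>\<xi>. norm (h \<xi>) \<le> B"
  shows "integrable lborel (\<lambda>\<xi>. indicat_real freq_box \<xi> *\<^sub>R h \<xi>)"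
  by (rule integrableI_bounded_set_indicator[where B = B]) (use assms in \<open>auto simp: emeasure_freq_box\<close>)

lemma integrable_box_norm2:
  "integrable lborel (\<lambda>\<xi>. indicat_real freq_box \<xi> * (norm (char_sum i n x \<xi>))\<^sup>2)"
  using integrable_on_box[of "\<lambda>\<xi>. (norm (char_sum i n x \<xi>))\<^sup>2" "(\<Sum>k<n. norm (x k))\<^sup>2"]
  by (simp add: power_mono norm_char_sum)

lemma box_norm2_nonneg: "box_norm2 i n x \<ge> 0"
  unfolding box_norm2_def by (rule integral_nonneg_AE) simp

lemma nn_integral_box_norm2:
  "(\<integral>\<^sup>+\<xi>. ennreal (indicat_real freq_box \<xi> * (norm (char_sum i n x \<xi>))\<^sup>2) \<partial>lborel) = ennreal (box_norm2 i n x)"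
  unfolding box_norm2_def by (rule nn_integral_eq_integral[OF integrable_box_norm2]) simp

text \<open>The estimate is applied to \<open>\<gamma> k *\<^sub>C x k\<close>, squared and
  integrated. The power mean with exponent \<open>2 / p\<close> and weights
  \<open>norm (x k) powr p\<close> isolates \<open>(cmod (\<gamma> k))\<^sup>2\<close>, whose mean
  is one.\<close>

lemma has_type_of_box_norm2:
  fixes i :: "'d::finite"
  assumes p: "1 \<le> p" "p \<le> 2" and K: "K \<ge> 0"
    and le: "\<And>n x :: nat \<Rightarrow> 'x::complex_banach. sqrt (box_norm2 i n x) \<le> K * (\<Sum>k<n. norm (x k) powr p) powr (1 / p)"
  shows "has_type TYPE('x) p"
proof -
  have "gaussian_norm n x \<le> K * (\<Sum>k<n. norm (x k) powr p) powr (1 / p)" for n and x :: "nat \<Rightarrow> 'x"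
  proof -
    define A where "A = (\<Sum>k<n. norm (x k) powr p)"
    have A: "A \<ge> 0" by (simp add: A_def sum_nonneg)
    have "ennreal ((gaussian_norm n x)\<^sup>2) = (\<integral>\<^sup>+\<gamma>. ennreal (box_norm2 i n (\<lambda>k. \<gamma> k *\<^sub>C x k)) \<partial>gaussian_space)"
      by (simp add: nn_integral_randomized_char_sum[where i = i, symmetric] nn_integral_box_norm2)
    also have "\<dots> \<le> (\<integral>\<^sup>+\<gamma>. (\<Sum>k<n. ennreal (K\<^sup>2 * A powr (2 / p - 1) * norm (x k) powr p) * ennreal ((cmod (\<gamma> k))\<^sup>2)) \<partial>gaussian_space)"
    proof (rule nn_integral_mono)
      fix \<gamma> :: "nat \<Rightarrow> complex"
      have "box_norm2 i n (\<lambda>k. \<gamma> k *\<^sub>C x k) = (sqrt (box_norm2 i n (\<lambda>k. \<gamma> k *\<^sub>C x k)))\<^sup>2"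
        by (simp add: box_norm2_nonneg)
      also have "\<dots> \<le> (K * (\<Sum>k<n. norm (\<gamma> k *\<^sub>C x k) powr p) powr (1 / p))\<^sup>2"
        by (intro power_mono le) (simp add: box_norm2_nonneg)
      also have "\<dots> = K\<^sup>2 * (\<Sum>k<n. norm (x k) powr p * cmod (\<gamma> k) powr p) powr (2 / p)"
        using p by (simp add: power_mult_distrib norm_scaleC powr_mult mult.commute
            powr_powr flip: powr_numeral)
      also have "\<dots> \<le> K\<^sup>2 * (A powr (2 / p - 1) * (\<Sum>k<n. norm (x k) powr p * (cmod (\<gamma> k) powr p) powr (2 / p)))"
        using p by (intro mult_left_mono weighted_power_mean) (auto simp: A_def)
      also have "\<dots> = (\<Sum>k<n. (K\<^sup>2 * A powr (2 / p - 1) * norm (x k) powr p) * (cmod (\<gamma> k))\<^sup>2)"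
        using p by (simp add: powr_powr sum_distrib_left mult_ac)
      finally have "ennreal (box_norm2 i n (\<lambda>k. \<gamma> k *\<^sub>C x k)) \<le> ennreal (\<Sum>k<n. (K\<^sup>2 * A powr (2 / p - 1) * norm (x k) powr p) * (cmod (\<gamma> k))\<^sup>2)"
        by (rule ennreal_leI)
      also have "\<dots> = (\<Sum>k<n. ennreal (K\<^sup>2 * A powr (2 / p - 1) * norm (x k) powr p) * ennreal ((cmod (\<gamma> k))\<^sup>2))"
        by (simp add: ennreal_mult flip: sum_ennreal)
      finally show "ennreal (box_norm2 i n (\<lambda>k. \<gamma> k *\<^sub>C x k)) \<le> \<dots>" .
    qed
    also have "\<dots> = (\<Sum>k<n. ennreal (K\<^sup>2 * A powr (2 / p - 1) * norm (x k) powr p))"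
      by (simp add: nn_integral_sum nn_integral_cmult nn_integral_gaussian_space_square del: sum_ennreal)
    also have "\<dots> = ennreal (K\<^sup>2 * A powr (2 / p - 1) * A)"
      by (subst sum_ennreal) (auto simp: A_def sum_distrib_left)
    also have "K\<^sup>2 * A powr (2 / p - 1) * A = (K * A powr (1 / p))\<^sup>2"
    proof (cases "A = 0")
      case False
      then have "A powr (2 / p - 1) * A = A powr (2 / p)" using A by (simp add: powr_diff)
      also have "\<dots> = (A powr (1 / p))\<^sup>2" by (simp add: powr_powr flip: powr_numeral)
      finally show ?thesis by (simp add: power_mult_distrib mult.assoc)
    qed simp
    finally have "(gaussian_norm n x)\<^sup>2 \<le> (K * A powr (1 / p))\<^sup>2" by simp
    moreover have "K * A powr (1 / p) \<ge> 0" using K by simp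
    ultimately show ?thesis unfolding A_def[symmetric] by (rule power2_le_imp_le)
  qed
  then show ?thesis unfolding has_type_def using p by blast
qed

text \<open>The deterministic quantity \<open>B powr (2 / q - 1) * B\<close> is written as a
  Gaussian average. The power mean with exponent \<open>q / 2\<close> bounds the averaged sum by the
  square of the randomized ell^q norm, to which the hypothesis applies.\<close>

lemma has_cotype_of_box_norm2:
  fixes i :: "'d::finite"
  assumes q: "2 \<le> q" and K: "K \<ge> 0"
    and le: "\<And>n y :: nat \<Rightarrow> 'y::complex_banach. (\<Sum>k<n. norm (y k) powr q) powr (1 / q) \<le> K * sqrt (box_norm2 i n y)"
  shows "has_cotype TYPE('y) q"
proof -
  have "(\<Sum>k<n. norm (y k) powr q) powr (1 / q) \<le> K * gaussian_norm n y" for n and y :: "nat \<Rightarrow> 'y"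
  proof -
    define B where "B = (\<Sum>k<n. norm (y k) powr q)"
    have B: "B \<ge> 0" by (simp add: B_def sum_nonneg)
    show ?thesis
    proof (cases "B = 0")
      case True
      then show ?thesis using K by (simp add: B_def gaussian_norm_nonneg)
    next
      case False
      then have B: "B > 0" using B by simp
      have "ennreal ((B powr (1 / q))\<^sup>2) = ennreal (B powr (2 / q - 1) * B)"
        using B by (simp add: powr_diff powr_powr flip: powr_numeral)
      also have "\<dots> = (\<Sum>k<n. ennreal (B powr (2 / q - 1) * norm (y k) powr q))"
        by (subst sum_ennreal) (auto simp: B_def sum_distrib_left)
      also have "\<dots> = (\<integral>\<^sup>+\<gamma>. (\<Sum>k<n. ennreal (B powr (2 / q - 1) * norm (y k) powr q) * ennreal ((cmod (\<gamma> k))\<^sup>2)) \<partial>gaussian_space)"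
        by (simp add: nn_integral_sum nn_integral_cmult nn_integral_gaussian_space_square del: sum_ennreal)
      also have "\<dots> \<le> (\<integral>\<^sup>+\<gamma>. ennreal (K\<^sup>2) * ennreal (box_norm2 i n (\<lambda>k. \<gamma> k *\<^sub>C y k)) \<partial>gaussian_space)"
      proof (rule nn_integral_mono)
        fix \<gamma> :: "nat \<Rightarrow> complex"
        let ?s = "\<Sum>k<n. norm (y k) powr q * (cmod (\<gamma> k))\<^sup>2" and ?S = "\<Sum>k<n. norm (\<gamma> k *\<^sub>C y k) powr q"
        have s: "?s \<ge> 0" "?S \<ge> 0" by (auto intro!: sum_nonneg)
        have "?s powr (q / 2) \<le> B powr (q / 2 - 1) * (\<Sum>k<n. norm (y k) powr q * ((cmod (\<gamma> k))\<^sup>2) powr (q / 2))"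
          using q by (intro weighted_power_mean) (auto simp: B_def)
        also have "\<dots> = B powr (q / 2 - 1) * ?S"
          by (simp add: norm_scaleC powr_mult powr_powr mult.commute flip: powr_numeral)
        finally have "(?s powr (q / 2)) powr (2 / q) \<le> (B powr (q / 2 - 1) * ?S) powr (2 / q)"
          using q by (intro powr_mono2) auto
        then have "?s \<le> B powr (1 - 2 / q) * (?S powr (1 / q))\<^sup>2"
          using q s by (simp add: powr_powr powr_mult diff_divide_distrib left_diff_distrib flip: powr_numeral)
        then have "B powr (2 / q - 1) * ?s \<le> B powr (2 / q - 1) * (B powr (1 - 2 / q) * (?S powr (1 / q))\<^sup>2)"
          by (intro mult_left_mono) auto
        also have "\<dots> = (?S powr (1 / q))\<^sup>2"
          using B by (simp add: mult.assoc[symmetric] powr_add[symmetric])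
        also have "\<dots> \<le> (K * sqrt (box_norm2 i n (\<lambda>k. \<gamma> k *\<^sub>C y k)))\<^sup>2"
          by (intro power_mono le) simp
        also have "\<dots> = K\<^sup>2 * box_norm2 i n (\<lambda>k. \<gamma> k *\<^sub>C y k)"
          by (simp add: power_mult_distrib box_norm2_nonneg)
        finally have "ennreal (B powr (2 / q - 1) * ?s) \<le> ennreal (K\<^sup>2 * box_norm2 i n (\<lambda>k. \<gamma> k *\<^sub>C y k))"
          by (rule ennreal_leI)
        moreover have "ennreal (B powr (2 / q - 1) * ?s) = (\<Sum>k<n. ennreal (B powr (2 / q - 1) * norm (y k) powr q) * ennreal ((cmod (\<gamma> k))\<^sup>2))"
          by (simp add: sum_distrib_left mult.assoc flip: ennreal_mult sum_ennreal)
        ultimately show "(\<Sum>k<n. ennreal (B powr (2 / q - 1) * norm (y k) powr q) * ennreal ((cmod (\<gamma> k))\<^sup>2)) \<le>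
            ennreal (K\<^sup>2) * ennreal (box_norm2 i n (\<lambda>k. \<gamma> k *\<^sub>C y k))"
          by (simp add: ennreal_mult box_norm2_nonneg)
      qed
      also have "\<dots> = ennreal (K\<^sup>2) * ennreal ((gaussian_norm n y)\<^sup>2)"
      proof -
        \<comment> \<open>Measurability in the Gaussian variable comes from the parameter integral;
          it allows the constant to be taken outside.\<close>
        have "(\<lambda>\<gamma>. ennreal (box_norm2 i n (\<lambda>k. \<gamma> k *\<^sub>C y k))) \<in> borel_measurable gaussian_space"
          unfolding nn_integral_box_norm2[symmetric]
          using measurable_randomized_char_sum[of i n y]
          by (intro sigma_finite_measure.borel_measurable_nn_integral sigma_finite_lborel)
            (auto simp: case_prod_beta)
        then show ?thesis
          by (simp add: nn_integral_cmult nn_integral_randomized_char_sum[where i = i, symmetric] nn_integral_box_norm2)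
      qed
      also have "\<dots> = ennreal ((K * gaussian_norm n y)\<^sup>2)"
        by (simp add: power_mult_distrib ennreal_mult)
      finally have "(B powr (1 / q))\<^sup>2 \<le> (K * gaussian_norm n y)\<^sup>2" by simp
      moreover have "K * gaussian_norm n y \<ge> 0" using K by (simp add: gaussian_norm_nonneg)
      ultimately show ?thesis unfolding B_def[symmetric] by (rule power2_le_imp_le)
    qed
  qed
  then show ?thesis unfolding has_cotype_def using q by blast
qed

section \<open>Testing the discrete multipliers\<close>

lemma le_of_tendsto_at_right:
  fixes f :: "real \<Rightarrow> real"
  assumes "(f \<longlongrightarrow> L) (at_right 0)" "\<And>\<delta>. \<delta> > 0 \<Longrightarrow> a \<le> f \<delta>"
  shows "a \<le> L"
  by (rule tendsto_lowerbound[OF assms(1)]) (auto simp: eventually_at_filter assms(2) intro: always_eventually)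

lemma borel_measurable_of_strongly_measurable:
  fixes f :: "'a \<Rightarrow> 'b::{real_normed_vector, second_countable_topology}"
  assumes "strongly_measurable M f"
  shows "f \<in> borel_measurable M"
proof -
  obtain s where s: "\<And>i. simple_function M (s i)" "\<And>x. x \<in> space M \<Longrightarrow> (\<lambda>i::nat. s i x) \<longlonglongrightarrow> f x"
    using assms unfolding strongly_measurable_def by blast
  show ?thesis
    by (rule borel_measurable_LIMSEQ_metric[OF borel_measurable_simple_function[OF s(1)] s(2)])
qed

section \<open>Integration and Parseval's identity on the period cell\<close>

definition box_integral :: "(real ^ 'd::finite \<Rightarrow> 'b::{banach, second_countable_topology}) \<Rightarrow> 'b" where
  "box_integral h = integral\<^sup>L lborel (\<lambda>\<xi>. indicat_real freq_box \<xi> *\<^sub>R h \<xi>)"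

text \<open>The cell has volume one, so a pointwise error passes to the integral unchanged.\<close>

lemma norm_box_integral_diff_le:
  fixes g h :: "real ^ 'd::finite \<Rightarrow> 'b::{banach, second_countable_topology}"
  assumes meas: "g \<in> borel_measurable borel" "h \<in> borel_measurable borel"
    and bounds: "\<And>\<xi>. norm (g \<xi>) \<le> A" "\<And>\<xi>. norm (h \<xi>) \<le> B" and le: "\<And>\<xi>. norm (g \<xi> - h \<xi>) \<le> \<epsilon>"
  shows "norm (box_integral g - box_integral h) \<le> \<epsilon>"
proof -
  let ?Q = "freq_box :: (real ^ 'd) set"
  note int = integrable_on_box[OF meas(1) bounds(1)] integrable_on_box[OF meas(2) bounds(2)]
  have Q: "integrable lborel (\<lambda>\<xi>. indicat_real ?Q \<xi> * \<epsilon>)"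
    using integrable_on_box[of "\<lambda>_. \<epsilon>" "\<bar>\<epsilon>\<bar>"] by simp
  have "norm (box_integral g - box_integral h) =
      norm (integral\<^sup>L lborel (\<lambda>\<xi>. indicat_real ?Q \<xi> *\<^sub>R g \<xi> - indicat_real ?Q \<xi> *\<^sub>R h \<xi>))"
    using int by (simp add: box_integral_def)
  also have "\<dots> \<le> integral\<^sup>L lborel (\<lambda>\<xi>. norm (indicat_real ?Q \<xi> *\<^sub>R g \<xi> - indicat_real ?Q \<xi> *\<^sub>R h \<xi>))"
    by (rule integral_norm_bound)
  also have "\<dots> \<le> integral\<^sup>L lborel (\<lambda>\<xi>. indicat_real ?Q \<xi> * \<epsilon>)"
    using int Q le by (intro integral_mono integrable_norm Bochner_Integration.integrable_diff) (auto simp: indicator_def)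
  also have "\<dots> = \<epsilon>"
    using emeasure_freq_box[where 'd = 'd] by (simp add: measure_def)
  finally show ?thesis .
qed

lemma box_integral_of_real: "box_integral (\<lambda>\<xi>. complex_of_real (h \<xi>)) = of_real (box_integral h)"
  by (simp add: box_integral_def scaleR_conv_of_real flip: of_real_mult)

lemma box_norm2_eq: "box_norm2 i n x = box_integral (\<lambda>\<xi>. (norm (char_sum i n x \<xi>))\<^sup>2)"
  by (simp add: box_norm2_def box_integral_def)

lemma box_integral_sum:
  assumes "\<And>j. j \<in> J \<Longrightarrow> h j \<in> borel_measurable borel" "\<And>j \<xi>. j \<in> J \<Longrightarrow> norm (h j \<xi>) \<le> B j"
  shows "box_integral (\<lambda>\<xi>. \<Sum>j\<in>J. h j \<xi>) = (\<Sum>j\<in>J. box_integral (h j))"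
  unfolding box_integral_def scaleR_sum_right
  by (rule Bochner_Integration.integral_sum) (rule integrable_on_box[OF assms])

lemma box_integral_mult_left: "box_integral (\<lambda>\<xi>. c * h \<xi>) = c * box_integral (h :: real ^ 'd::finite \<Rightarrow> complex)"
proof -
  have "indicat_real freq_box \<xi> *\<^sub>R (c * h \<xi>) = c * (indicat_real freq_box \<xi> *\<^sub>R h \<xi>)" for \<xi> :: "real ^ 'd"
    by simp
  then show ?thesis unfolding box_integral_def by (simp only: integral_mult_right_zero)
qed

lemma Parseval_trig_poly:
  assumes "finite J"
  shows "box_integral (\<lambda>\<xi>. (cmod (\<Sum>j\<in>J. c j * torus_char i j \<xi>))\<^sup>2) = (\<Sum>j\<in>J. (cmod (c j))\<^sup>2)"
proof -
  have expand: "complex_of_real ((cmod (\<Sum>j\<in>J. c j * torus_char i j \<xi>))\<^sup>2) =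
      (\<Sum>j\<in>J. \<Sum>k\<in>J. (c j * cnj (c k)) * torus_char i (j - k) \<xi>)" for \<xi>
    unfolding complex_norm_square diff_conv_add_uminus torus_char_mult[symmetric]
    by (simp add: sum_product cnj_torus_char mult_ac)
  have "complex_of_real (box_integral (\<lambda>\<xi>. (cmod (\<Sum>j\<in>J. c j * torus_char i j \<xi>))\<^sup>2)) =
      box_integral (\<lambda>\<xi>. \<Sum>j\<in>J. \<Sum>k\<in>J. (c j * cnj (c k)) * torus_char i (j - k) \<xi>)"
    unfolding expand[symmetric] by (rule box_integral_of_real[symmetric])
  also have "\<dots> = (\<Sum>j\<in>J. box_integral (\<lambda>\<xi>. \<Sum>k\<in>J. (c j * cnj (c k)) * torus_char i (j - k) \<xi>))"
  proof (rule box_integral_sum)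
    fix j \<xi>
    show "norm (\<Sum>k\<in>J. (c j * cnj (c k)) * torus_char i (j - k) \<xi>) \<le> (\<Sum>k\<in>J. cmod (c j) * cmod (c k))"
      by (rule order_trans[OF norm_sum]) (simp add: norm_mult)
  qed measurable
  also have "\<dots> = (\<Sum>j\<in>J. \<Sum>k\<in>J. (c j * cnj (c k)) * box_integral (torus_char i (j - k)))"
  proof (rule sum.cong[OF refl])
    fix j
    have "box_integral (\<lambda>\<xi>. \<Sum>k\<in>J. (c j * cnj (c k)) * torus_char i (j - k) \<xi>) =
        (\<Sum>k\<in>J. box_integral (\<lambda>\<xi>. (c j * cnj (c k)) * torus_char i (j - k) \<xi>))"
      by (rule box_integral_sum[where B = "\<lambda>k. cmod (c j) * cmod (c k)"]) (auto simp: norm_mult)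
    then show "box_integral (\<lambda>\<xi>. \<Sum>k\<in>J. (c j * cnj (c k)) * torus_char i (j - k) \<xi>) =
        (\<Sum>k\<in>J. (c j * cnj (c k)) * box_integral (torus_char i (j - k)))"
      by (simp only: box_integral_mult_left)
  qed
  also have "\<dots> = (\<Sum>j\<in>J. \<Sum>k\<in>J. if j = k then c j * cnj (c k) else 0)"
    by (intro sum.cong refl) (simp add: box_integral_def integral_box_char)
  also have "\<dots> = (\<Sum>j\<in>J. complex_of_real ((cmod (c j))\<^sup>2))"
    using assms by (simp flip: complex_norm_square)
  also have "\<dots> = complex_of_real (\<Sum>j\<in>J. (cmod (c j))\<^sup>2)" by simp
  finally show ?thesis by (simp only: of_real_eq_iff)
qed

text \<open>By Parseval the left side is the integral of the squared modulus of the polynomial;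
  factoring the difference of squares shows that it differs from the squared L^2 norm by an error
  that vanishes with \<delta>.\<close>

lemma sum_squares_trig_poly_approx:
  assumes J: "finite J" and \<delta>: "\<delta> > 0"
    and P: "\<And>\<xi>. norm ((\<Sum>j\<in>J. c j * torus_char i j \<xi>) - of_real (norm (char_sum i n x \<xi>))) \<le> \<delta>"
  shows "(\<Sum>j\<in>J. (cmod (c j))\<^sup>2) \<le> box_norm2 i n x + \<delta> * (2 * (\<Sum>k<n. norm (x k)) + \<delta>)"
proof -
  let ?P = "\<lambda>\<xi>. \<Sum>j\<in>J. c j * torus_char i j \<xi>" and ?N = "\<lambda>\<xi>. norm (char_sum i n x \<xi>)" and ?R = "\<Sum>k<n. norm (x k)"
  have N: "0 \<le> ?N \<xi>" "?N \<xi> \<le> ?R" for \<xi> by (simp_all add: norm_char_sum)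
  have R0: "?R \<ge> 0" by (simp add: sum_nonneg)
  have diff: "\<bar>cmod (?P \<xi>) - ?N \<xi>\<bar> \<le> \<delta>" for \<xi>
    using order_trans[OF norm_triangle_ineq3 P[of \<xi>]] by simp
  have P_le: "cmod (?P \<xi>) \<le> ?R + \<delta>" for \<xi> using diff[of \<xi>] N(2)[of \<xi>] by linarith
  have "norm (box_integral (\<lambda>\<xi>. (cmod (?P \<xi>))\<^sup>2) - box_integral (\<lambda>\<xi>. (?N \<xi>)\<^sup>2)) \<le> \<delta> * (2 * ?R + \<delta>)"
  proof (rule norm_box_integral_diff_le)
    fix \<xi>
    show "norm ((cmod (?P \<xi>))\<^sup>2) \<le> (?R + \<delta>)\<^sup>2" using P_le[of \<xi>] by (simp add: power_mono)
    show "norm ((?N \<xi>)\<^sup>2) \<le> ?R\<^sup>2" using N[of \<xi>] by (simp add: power_mono)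
    have "(cmod (?P \<xi>))\<^sup>2 - (?N \<xi>)\<^sup>2 = (cmod (?P \<xi>) - ?N \<xi>) * (cmod (?P \<xi>) + ?N \<xi>)"
      by (simp add: power2_eq_square algebra_simps)
    then have "norm ((cmod (?P \<xi>))\<^sup>2 - (?N \<xi>)\<^sup>2) = \<bar>cmod (?P \<xi>) - ?N \<xi>\<bar> * (cmod (?P \<xi>) + ?N \<xi>)"
      by (simp add: abs_mult)
    also have "\<dots> \<le> \<delta> * (2 * ?R + \<delta>)"
      using diff[of \<xi>] P_le[of \<xi>] N[of \<xi>] \<delta> by (intro mult_mono) auto
    finally show "norm ((cmod (?P \<xi>))\<^sup>2 - (?N \<xi>)\<^sup>2) \<le> \<delta> * (2 * ?R + \<delta>)" .
  qed measurable
  then show ?thesis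
    unfolding Parseval_trig_poly[OF J] box_norm2_eq real_norm_def by linarith
qed

text \<open>An arbitrary selection without any measurability in \<open>a\<close>; it is composed
  with simple functions only.\<close>

definition norming :: "'a::complex_normed_vector \<Rightarrow> ('a, complex) cblinfun" where
  "norming a = (SOME \<nu>. norm \<nu> \<le> 1 \<and> cblinfun_apply \<nu> a = of_real (norm a))"

lemma norm_norming: "norm (norming a) \<le> 1"
  and norming_apply: "cblinfun_apply (norming a) a = of_real (norm a)"
  using someI_ex[OF exists_norming_functional[of a]] unfolding norming_def by blast+

lemma norm_norming_apply_le: "cmod (cblinfun_apply (norming a) b) \<le> norm b"
proof -
  have "norm (norming a) * norm b \<le> 1 * norm b"
    by (rule mult_right_mono[OF norm_norming norm_ge_zero])
  then show ?thesis
    using norm_cblinfun_apply[of "norming a" b] by simp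
qed

text \<open>One \<delta> comes from exchanging \<open>a\<close> and \<open>b\<close> inside the
  functional, the other from the difference of their norms.\<close>

lemma norming_apply_approx:
  assumes "norm (b - a) \<le> \<delta>"
  shows "cmod (cblinfun_apply (norming a) b - of_real (norm b)) \<le> 2 * \<delta>"
proof -
  have "cblinfun_apply (norming a) b - of_real (norm b) = cblinfun_apply (norming a) (b - a) + of_real (norm a - norm b)"
    by (simp add: cblinfun.diff_right norming_apply)
  then have "cmod (cblinfun_apply (norming a) b - of_real (norm b)) \<le> norm (b - a) + \<bar>norm a - norm b\<bar>"
    by (metis add_mono norm_norming_apply_le norm_of_real norm_triangle_le order_refl)
  also have "\<bar>norm a - norm b\<bar> \<le> norm (b - a)"
    by (metis norm_minus_commute norm_triangle_ineq3)
  finally show ?thesis using assms by simp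
qed

lemma sqrt_le_of_le_mult_sqrt:
  assumes "a \<le> C * sqrt a" "0 \<le> a" "0 \<le> C"
  shows "sqrt a \<le> C"
proof (cases "a = 0")
  case False
  then have "sqrt a > 0" using assms by simp
  moreover have "sqrt a * sqrt a \<le> C * sqrt a" using assms by simp
  ultimately show ?thesis using mult_le_cancel_right_pos by blast
qed (use assms in simp)

lemma sum_norm_int_image: "(\<Sum>k\<in>int ` {..<n}. f (nat k)) = (\<Sum>k<n. f k)"
  by (subst sum.reindex) (auto simp: comp_def)

lemma char_sum_apply_measurable:
  assumes "simple_function lborel \<mu>"
  shows "(\<lambda>\<xi>. cblinfun_apply (\<mu> \<xi>) (char_sum i n x \<xi>) :: complex) \<in> borel_measurable borel"
  using borel_measurable_of_strongly_measurable[OF strongly_measurable_cblinfun[OF strongly_measurable_simple[OF assms] strongly_measurable_char_sum], of i n x]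
  by simp

text \<open>The polynomial \<open>?P\<close> and the multiplier output \<open>u\<close> are both
  close to the norm of the character sum. Pairing the coefficients of \<open>?P\<close> with the
  outputs gives the integral of their product, nearly the squared L^2 norm. The ell^2 norm of those
  coefficients is nearly the L^2 norm itself, so one factor cancels.\<close>

lemma box_norm2_le_scalar_target:
  fixes i :: "'d::finite" and x :: "nat \<Rightarrow> 'x::complex_banach"
  assumes bound: "discretely_bounded i TYPE('x \<times> complex) p 2 K"
  shows "sqrt (box_norm2 i n x) \<le> K * (\<Sum>k<n. norm (x k) powr p) powr (1 / p)"
proof -
  have K: "K \<ge> 0" using bound by (simp add: discretely_bounded_def)
  define X where "X = (\<Sum>k<n. norm (x k) powr p) powr (1 / p)"
  let ?N = "\<lambda>\<xi>. norm (char_sum i n x \<xi>)" and ?R = "\<Sum>k<n. norm (x k)" and ?I = "box_norm2 i n x"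
  have N: "0 \<le> ?N \<xi>" "?N \<xi> \<le> ?R" for \<xi> by (simp_all add: norm_char_sum)
  have R0: "?R \<ge> 0" by (simp add: sum_nonneg)
  have X0: "X \<ge> 0" by (simp add: X_def)
  have le: "?I \<le> K * X * sqrt (?I + \<delta> * (2 * ?R + \<delta>)) + ((?R + \<delta>) * (2 * \<delta>) + \<delta> * ?R)" if \<delta>: "\<delta> > 0" for \<delta>
  proof -
    obtain J c where J: "finite J"
      and P: "\<And>\<xi>. norm ((\<Sum>j\<in>J. c j * torus_char i j \<xi>) - of_real (?N \<xi>)) \<le> \<delta>"
      by (rule trig_poly_approx_norm[OF \<delta>, where i = i and n = n and x = x]) (rule that)
    obtain S where S: "simple_function lborel S" "\<And>\<xi>. norm (char_sum i n x \<xi> - S \<xi>) \<le> \<delta>"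
      by (rule simple_approx_char_sum[OF \<delta>, where i = i and n = n and x = x]) (rule that)
    let ?P = "\<lambda>\<xi>. \<Sum>j\<in>J. c j * torus_char i j \<xi>"
    define \<mu> where "\<mu> \<xi> = norming (S \<xi>)" for \<xi>
    have \<mu>: "simple_function lborel \<mu>" "\<And>\<xi>. norm (\<mu> \<xi>) \<le> 1"
      unfolding \<mu>_def by (rule simple_function_compose1[OF S(1)]) (rule norm_norming)
    define u where "u \<xi> = cblinfun_apply (\<mu> \<xi>) (char_sum i n x \<xi>)" for \<xi>
    have u_meas [measurable]: "u \<in> borel_measurable borel"
      unfolding u_def by (rule char_sum_apply_measurable[OF \<mu>(1)])
    have u_le: "cmod (u \<xi>) \<le> ?R" for \<xi>
      unfolding u_def \<mu>_def using order_trans[OF norm_norming_apply_le N(2)] .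
    define z where "z j = discrete_multiplier i \<mu> (int ` {..<n}) (\<lambda>k. x (nat k)) j" for j
    have z: "z j = box_integral (\<lambda>\<xi>. torus_char i j \<xi> * u \<xi>)" for j
    proof -
      have "integrable lborel (\<lambda>\<xi>. indicat_real freq_box \<xi> *\<^sub>R (torus_char i j \<xi> * u \<xi>))"
        using u_le by (intro integrable_on_box[where B = ?R]) (auto simp: norm_mult)
      from Bochner_integral_eq[OF has_Bochner_integral_lebesgue[OF this]] show ?thesis
        by (simp add: z_def discrete_multiplier_def multiplier_integrand_def[abs_def] char_sum_int u_def box_integral_def scaleC_complex_def)
    qed
    have "(\<Sum>j\<in>J. c j * z j) = box_integral (\<lambda>\<xi>. \<Sum>j\<in>J. c j * (torus_char i j \<xi> * u \<xi>))"
      unfolding z box_integral_mult_left[symmetric] using u_le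
      by (intro box_integral_sum[symmetric, where B = "\<lambda>j. cmod (c j) * ?R"])
        (auto simp: norm_mult mult_left_mono)
    also have "\<dots> = box_integral (\<lambda>\<xi>. ?P \<xi> * u \<xi>)"
      by (simp add: sum_distrib_right mult.assoc)
    finally have sum_z: "(\<Sum>j\<in>J. c j * z j) = box_integral (\<lambda>\<xi>. ?P \<xi> * u \<xi>)" .
    have P_le: "cmod (?P \<xi>) \<le> ?R + \<delta>" for \<xi>
    proof -
      have "cmod (?P \<xi>) \<le> cmod (?P \<xi> - of_real (?N \<xi>)) + cmod (of_real (?N \<xi>))"
        using norm_triangle_ineq[of "?P \<xi> - of_real (?N \<xi>)" "of_real (?N \<xi>)"] by simp
      then show ?thesis using P[of \<xi>] N[of \<xi>] by simp
    qed
    have "norm (box_integral (\<lambda>\<xi>. ?P \<xi> * u \<xi>) - box_integral (\<lambda>\<xi>. complex_of_real ((?N \<xi>)\<^sup>2))) \<le> (?R + \<delta>) * (2 * \<delta>) + \<delta> * ?R"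
    proof (rule norm_box_integral_diff_le)
      fix \<xi>
      show "norm (?P \<xi> * u \<xi>) \<le> (?R + \<delta>) * ?R"
        unfolding norm_mult using P_le[of \<xi>] u_le[of \<xi>] R0 \<delta> by (intro mult_mono) auto
      show "norm (complex_of_real ((?N \<xi>)\<^sup>2)) \<le> ?R\<^sup>2"
        using N[of \<xi>] by (simp add: power_mono norm_power)
      \<comment> \<open>The product is compared factor by factor: an error of
        \<open>2 * \<delta>\<close> for \<open>u\<close> and one of \<delta> for the
        polynomial.\<close>
      have "?P \<xi> * u \<xi> - of_real ((?N \<xi>)\<^sup>2) = ?P \<xi> * (u \<xi> - of_real (?N \<xi>)) + (?P \<xi> - of_real (?N \<xi>)) * of_real (?N \<xi>)"
        by (simp add: algebra_simps power2_eq_square)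
      also have "norm \<dots> \<le> cmod (?P \<xi>) * cmod (u \<xi> - of_real (?N \<xi>)) + cmod (?P \<xi> - of_real (?N \<xi>)) * ?N \<xi>"
        by (rule order_trans[OF norm_triangle_ineq]) (simp add: norm_mult)
      also have "\<dots> \<le> (?R + \<delta>) * (2 * \<delta>) + \<delta> * ?R"
        using P_le[of \<xi>] P[of \<xi>] N[of \<xi>] norming_apply_approx[OF S(2)[of \<xi>]] R0 \<delta>
        by (intro add_mono mult_mono) (auto simp: u_def \<mu>_def)
      finally show "norm (?P \<xi> * u \<xi> - of_real ((?N \<xi>)\<^sup>2)) \<le> (?R + \<delta>) * (2 * \<delta>) + \<delta> * ?R" .
    qed measurable
    then have "cmod ((\<Sum>j\<in>J. c j * z j) - of_real ?I) \<le> (?R + \<delta>) * (2 * \<delta>) + \<delta> * ?R"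
      unfolding sum_z box_integral_of_real box_norm2_eq .
    then have 1: "?I \<le> cmod (\<Sum>j\<in>J. c j * z j) + ((?R + \<delta>) * (2 * \<delta>) + \<delta> * ?R)"
      using norm_triangle_ineq2[of "of_real ?I" "\<Sum>j\<in>J. c j * z j"] box_norm2_nonneg[of i n x]
      by (simp add: norm_minus_commute)
    have "cmod (\<Sum>j\<in>J. c j * z j) \<le> (\<Sum>j\<in>J. cmod (c j) * norm (z j))"
      by (rule order_trans[OF norm_sum]) (simp add: norm_mult)
    also have "\<dots> \<le> K * (\<Sum>j\<in>J. cmod (c j) powr 2) powr (1 / 2) * (\<Sum>k\<in>int ` {..<n}. norm (x (nat k)) powr p) powr (1 / p)"
      unfolding z_def by (intro discretely_boundedD[OF bound] \<mu> J) auto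
    also have "\<dots> = K * sqrt (\<Sum>j\<in>J. (cmod (c j))\<^sup>2) * X"
      unfolding X_def sum_norm_int_image[of "\<lambda>k. norm (x k) powr p"] by (simp add: powr_half_sqrt sum_nonneg)
    also have "\<dots> \<le> K * sqrt (?I + \<delta> * (2 * ?R + \<delta>)) * X"
      using K X0 by (intro mult_right_mono mult_left_mono real_sqrt_le_mono sum_squares_trig_poly_approx[OF J \<delta> P]) auto
    finally show ?thesis using 1 by (simp add: mult_ac)
  qed
  have lim: "((\<lambda>\<delta>. K * X * sqrt (?I + \<delta> * (2 * ?R + \<delta>)) + ((?R + \<delta>) * (2 * \<delta>) + \<delta> * ?R)) \<longlongrightarrow> K * X * sqrt ?I) (at_right 0)"
    by (auto intro!: tendsto_eq_intros)
  have "?I \<le> K * X * sqrt ?I"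
    by (rule le_of_tendsto_at_right[OF lim le])
  then show ?thesis
    unfolding X_def[symmetric] using K X0 by (intro sqrt_le_of_le_mult_sqrt box_norm2_nonneg) auto
qed

definition rank_one :: "('x::complex_banach, complex) cblinfun \<Rightarrow> 'y::complex_banach \<Rightarrow> ('x, 'y) cblinfun" where
  "rank_one \<nu> y = CBlinfun (Blinfun (\<lambda>v. cblinfun_apply \<nu> v *\<^sub>C y))"

lemma norm_rank_one: "norm (rank_one \<nu> y) \<le> norm \<nu> * norm y"
  and rank_one_apply: "cblinfun_apply (rank_one \<nu> y) v = cblinfun_apply \<nu> v *\<^sub>C y"
proof -
  let ?f = "\<lambda>v. cblinfun_apply \<nu> v *\<^sub>C y"
  have bl: "bounded_linear ?f"
    by (rule bounded_linear_compose[OF scaleC.bounded_linear_left cblinfun.bounded_linear_right])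
  have sc: "?f (c *\<^sub>C v) = c *\<^sub>C ?f v" for c v
    by (simp add: cblinfun_apply_scaleC scaleC_complex_def scaleC_scaleC)
  have le: "norm (?f v) \<le> norm \<nu> * norm y * norm v" for v
    using mult_right_mono[OF norm_cblinfun_apply[of \<nu> v], of "norm y"] by (simp add: norm_scaleC mult_ac)
  show "norm (rank_one \<nu> y) \<le> norm \<nu> * norm y"
    unfolding rank_one_def by (rule norm_CBlinfun_le[OF bl sc le]) simp
  show "cblinfun_apply (rank_one \<nu> y) v = cblinfun_apply \<nu> v *\<^sub>C y"
    unfolding rank_one_def cblinfun_apply_CBlinfun[OF bl sc] ..
qed

text \<open>The test weights are the norms of the vectors \<open>x k\<close> themselves. Pairing the
  output of index \<open>k\<close> with \<open>x k\<close> uses the second copy of the functional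
  and yields the integral of \<open>u * u\<close>. Both sides of the discrete bound then carry the
  same ell^p norm, whence the constant \<open>sqrt K\<close>.\<close>

lemma box_norm2_le_dual_target:
  fixes i :: "'d::finite" and x :: "nat \<Rightarrow> 'x::complex_banach"
  assumes bound: "discretely_bounded i TYPE('x \<times> ('x, complex) cblinfun) p p K"
  shows "sqrt (box_norm2 i n x) \<le> sqrt K * (\<Sum>k<n. norm (x k) powr p) powr (1 / p)"
proof -
  have K: "K \<ge> 0" using bound by (simp add: discretely_bounded_def)
  define X where "X = (\<Sum>k<n. norm (x k) powr p) powr (1 / p)"
  let ?N = "\<lambda>\<xi>. norm (char_sum i n x \<xi>)" and ?R = "\<Sum>k<n. norm (x k)" and ?I = "box_norm2 i n x"
  have N: "0 \<le> ?N \<xi>" "?N \<xi> \<le> ?R" for \<xi> by (simp_all add: norm_char_sum)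
  have R0: "?R \<ge> 0" by (simp add: sum_nonneg)
  have X0: "X \<ge> 0" by (simp add: X_def)
  have le: "?I \<le> K * X * X + (2 * \<delta>) * (2 * ?R)" if \<delta>: "\<delta> > 0" for \<delta>
  proof -
    obtain S where S: "simple_function lborel S" "\<And>\<xi>. norm (char_sum i n x \<xi> - S \<xi>) \<le> \<delta>"
      by (rule simple_approx_char_sum[OF \<delta>, where i = i and n = n and x = x]) (rule that)
    define \<mu> where "\<mu> \<xi> = rank_one (norming (S \<xi>)) (norming (S \<xi>))" for \<xi>
    have \<mu>: "simple_function lborel \<mu>" "\<And>\<xi>. norm (\<mu> \<xi>) \<le> 1"
    proof -
      show "simple_function lborel \<mu>" unfolding \<mu>_def by (rule simple_function_compose1[OF S(1)])
      show "norm (\<mu> \<xi>) \<le> 1" for \<xi>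
        unfolding \<mu>_def using norm_rank_one mult_mono[OF norm_norming norm_norming, of "S \<xi>" "S \<xi>"] by (fastforce intro: order_trans)
    qed
    define u where "u \<xi> = cblinfun_apply (norming (S \<xi>)) (char_sum i n x \<xi>)" for \<xi>
    have norming_simple: "simple_function lborel (\<lambda>\<xi>. norming (S \<xi>))"
      by (rule simple_function_compose1[OF S(1)])
    have u_meas [measurable]: "u \<in> borel_measurable borel"
      unfolding u_def by (rule char_sum_apply_measurable[OF norming_simple])
    have u_le: "cmod (u \<xi>) \<le> ?R" for \<xi>
      unfolding u_def using order_trans[OF norm_norming_apply_le N(2)] .
    let ?v = "\<lambda>k \<xi>. cblinfun_apply (norming (S \<xi>)) (x k)"
    have v_meas [measurable]: "?v k \<in> borel_measurable borel" for k
      using simple_function_compose1[OF norming_simple, of "\<lambda>T. cblinfun_apply T (x k)"] borel_measurable_simple_function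
      by force
    define z where "z j = discrete_multiplier i \<mu> (int ` {..<n}) (\<lambda>k. x (nat k)) j" for j
    have z: "cblinfun_apply (z j) (x k) = box_integral (\<lambda>\<xi>. torus_char i j \<xi> * u \<xi> * ?v k \<xi>)" for j k
    proof -
      have sm: "strongly_measurable lborel \<mu>" by (rule strongly_measurable_simple[OF \<mu>(1)])
      have "cblinfun_apply (z j) (x k) = Bochner_integral lborel
          (\<lambda>\<xi>. cblinfun_apply (multiplier_integrand i \<mu> (int ` {..<n}) (\<lambda>k. x (nat k)) j \<xi>) (x k))"
        unfolding z_def discrete_multiplier_def
        by (rule Bochner_integral_bounded_linear[OF cblinfun.bounded_linear_left
              strongly_measurable_multiplier_integrand[OF sm \<mu>(2)] nn_integral_multiplier_integrand_finite[OF sm \<mu>(2)], symmetric])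
      also have "(\<lambda>\<xi>. cblinfun_apply (multiplier_integrand i \<mu> (int ` {..<n}) (\<lambda>k. x (nat k)) j \<xi>) (x k)) =
          (\<lambda>\<xi>. indicat_real freq_box \<xi> *\<^sub>R (torus_char i j \<xi> * u \<xi> * ?v k \<xi>))"
        by (simp add: multiplier_integrand_def char_sum_int \<mu>_def rank_one_apply cblinfun.scaleR_left
            cblinfun_apply_scaleC_left u_def scaleC_complex_def mult.assoc)
      also have "Bochner_integral lborel \<dots> = box_integral (\<lambda>\<xi>. torus_char i j \<xi> * u \<xi> * ?v k \<xi>)"
        unfolding box_integral_def
      proof (rule Bochner_integral_eq[OF has_Bochner_integral_lebesgue], rule integrable_on_box)
        show "norm (torus_char i j \<xi> * u \<xi> * ?v k \<xi>) \<le> ?R * norm (x k)" for \<xi>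
          unfolding norm_mult using u_le[of \<xi>] norm_norming_apply_le[of "S \<xi>" "x k"] R0 by (simp add: mult_mono)
      qed measurable
      finally show ?thesis .
    qed
    have "(\<Sum>k<n. cblinfun_apply (z (int k)) (x k)) = box_integral (\<lambda>\<xi>. \<Sum>k<n. torus_char i (int k) \<xi> * u \<xi> * ?v k \<xi>)"
      unfolding z
    proof (rule box_integral_sum[symmetric])
      show "norm (torus_char i (int k) \<xi> * u \<xi> * ?v k \<xi>) \<le> ?R * norm (x k)" for k \<xi>
        unfolding norm_mult using u_le[of \<xi>] norm_norming_apply_le[of "S \<xi>" "x k"] R0 by (simp add: mult_mono)
    qed measurable
    \<comment> \<open>The character from the output and the second functional rebuild
      \<open>u\<close>. The square carries no conjugate, but \<open>u\<close> is within
      \<open>2 * \<delta>\<close> of a nonnegative real, so it is still close to the squared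
      norm.\<close>
    also have "(\<lambda>\<xi>. \<Sum>k<n. torus_char i (int k) \<xi> * u \<xi> * ?v k \<xi>) = (\<lambda>\<xi>. u \<xi> * u \<xi>)"
    proof
      fix \<xi>
      have "u \<xi> = (\<Sum>k<n. torus_char i (int k) \<xi> * ?v k \<xi>)"
        by (simp add: u_def char_sum_def cblinfun.sum_right cblinfun_apply_scaleC scaleC_complex_def)
      then have "u \<xi> * u \<xi> = u \<xi> * (\<Sum>k<n. torus_char i (int k) \<xi> * ?v k \<xi>)" by simp
      then show "(\<Sum>k<n. torus_char i (int k) \<xi> * u \<xi> * ?v k \<xi>) = u \<xi> * u \<xi>"
        by (simp add: sum_distrib_left mult_ac)
    qed
    finally have sum_z: "(\<Sum>k<n. cblinfun_apply (z (int k)) (x k)) = box_integral (\<lambda>\<xi>. u \<xi> * u \<xi>)" .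
    have "norm (box_integral (\<lambda>\<xi>. u \<xi> * u \<xi>) - box_integral (\<lambda>\<xi>. complex_of_real ((?N \<xi>)\<^sup>2))) \<le> (2 * \<delta>) * (2 * ?R)"
    proof (rule norm_box_integral_diff_le)
      fix \<xi>
      show "norm (u \<xi> * u \<xi>) \<le> ?R * ?R"
        unfolding norm_mult using u_le[of \<xi>] R0 by (intro mult_mono) auto
      show "norm (complex_of_real ((?N \<xi>)\<^sup>2)) \<le> ?R\<^sup>2"
        using N[of \<xi>] by (simp add: power_mono norm_power)
      have "u \<xi> * u \<xi> - of_real ((?N \<xi>)\<^sup>2) = (u \<xi> - of_real (?N \<xi>)) * (u \<xi> + of_real (?N \<xi>))"
        by (simp add: algebra_simps power2_eq_square)
      also have "norm \<dots> \<le> (2 * \<delta>) * (2 * ?R)"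
      proof -
        have "cmod (u \<xi> + of_real (?N \<xi>)) \<le> 2 * ?R"
          using norm_triangle_ineq[of "u \<xi>" "of_real (?N \<xi>)"] u_le[of \<xi>] N[of \<xi>] by simp
        then show ?thesis
          unfolding norm_mult using norming_apply_approx[OF S(2)[of \<xi>]] \<delta> by (intro mult_mono) (auto simp: u_def)
      qed
      finally show "norm (u \<xi> * u \<xi> - of_real ((?N \<xi>)\<^sup>2)) \<le> (2 * \<delta>) * (2 * ?R)" .
    qed measurable
    then have "cmod ((\<Sum>k<n. cblinfun_apply (z (int k)) (x k)) - of_real ?I) \<le> (2 * \<delta>) * (2 * ?R)"
      unfolding sum_z box_integral_of_real box_norm2_eq .
    then have 1: "?I \<le> cmod (\<Sum>k<n. cblinfun_apply (z (int k)) (x k)) + (2 * \<delta>) * (2 * ?R)"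
      using norm_triangle_ineq2[of "of_real ?I" "\<Sum>k<n. cblinfun_apply (z (int k)) (x k)"] box_norm2_nonneg[of i n x]
      by (simp add: norm_minus_commute)
    have "cmod (\<Sum>k<n. cblinfun_apply (z (int k)) (x k)) \<le> (\<Sum>k<n. norm (x k) * norm (z (int k)))"
      by (rule order_trans[OF norm_sum]) (intro sum_mono order_trans[OF norm_cblinfun_apply], simp add: mult.commute)
    also have "\<dots> = (\<Sum>j\<in>int ` {..<n}. norm (x (nat j)) * norm (z j))"
      by (subst sum.reindex) (auto simp: comp_def)
    also have "\<dots> \<le> K * (\<Sum>j\<in>int ` {..<n}. norm (x (nat j)) powr p) powr (1 / p) * (\<Sum>k\<in>int ` {..<n}. norm (x (nat k)) powr p) powr (1 / p)"
      unfolding z_def by (intro discretely_boundedD[OF bound] \<mu>) auto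
    also have "\<dots> = K * X * X"
      unfolding X_def sum_norm_int_image[of "\<lambda>k. norm (x k) powr p"] ..
    finally show ?thesis using 1 by simp
  qed
  have lim: "((\<lambda>\<delta>. K * X * X + (2 * \<delta>) * (2 * ?R)) \<longlongrightarrow> K * X * X) (at_right 0)"
    by (auto intro!: tendsto_eq_intros)
  have "?I \<le> K * X * X"
    by (rule le_of_tendsto_at_right[OF lim le])
  then have "sqrt ?I \<le> sqrt (K * (X * X))" by (simp add: mult.assoc)
  also have "\<dots> = sqrt K * X" using X0 by (simp add: real_sqrt_mult)
  finally show ?thesis by (simp add: X_def)
qed

text \<open>The multiplier restores the direction of the character sum to a scalar polynomial that
  approximates its norm, so the outputs approximate the vectors \<open>y k\<close>. The weights
  \<open>norm (y k) powr (q - 1)\<close> are extremal for the duality of ell^q; their norm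
  \<open>Y powr (1 / q')\<close> is divided out at the end.\<close>

lemma sum_powr_le_box_norm2:
  fixes i :: "'d::finite" and y :: "nat \<Rightarrow> 'y::complex_banach"
  assumes q: "q > 1" "q' > 1" "1 / q + 1 / q' = 1"
    and bound: "discretely_bounded i TYPE(complex \<times> 'y) 2 q' K"
  shows "(\<Sum>k<n. norm (y k) powr q) powr (1 / q) \<le> K * sqrt (box_norm2 i n y)"
proof -
  have K: "K \<ge> 0" using bound by (simp add: discretely_bounded_def)
  define Y where "Y = (\<Sum>k<n. norm (y k) powr q)"
  let ?F = "char_sum i n y"
  let ?N = "\<lambda>\<xi>. norm (?F \<xi>)" and ?R = "\<Sum>k<n. norm (y k)" and ?I = "box_norm2 i n y"
  let ?b = "\<lambda>k. norm (y k) powr (q - 1)"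
  have Y0: "Y \<ge> 0" by (simp add: Y_def sum_nonneg)
  have qq: "(q - 1) * q' = q" using q by (simp add: field_simps)
  have le: "Y \<le> K * Y powr (1 / q') * sqrt (?I + \<delta> * (2 * ?R + \<delta>)) + (\<Sum>k<n. ?b k) * (3 * \<delta>)" if \<delta>: "\<delta> > 0" for \<delta>
  proof -
    obtain J c where J: "finite J"
      and P: "\<And>\<xi>. norm ((\<Sum>j\<in>J. c j * torus_char i j \<xi>) - of_real (?N \<xi>)) \<le> \<delta>"
      by (rule trig_poly_approx_norm[OF \<delta>, where i = i and n = n and x = y]) (rule that)
    obtain S where S: "simple_function lborel S" "\<And>\<xi>. norm (?F \<xi> - S \<xi>) \<le> \<delta>"
      by (rule simple_approx_char_sum[OF \<delta>, where i = i and n = n and x = y]) (rule that)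
    let ?P = "\<lambda>\<xi>. \<Sum>j\<in>J. c j * torus_char i j \<xi>"
    \<comment> \<open>The identity viewed as a functional, so that \<open>rank_one\<close> describes
      multiplication of a fixed vector by a scalar.\<close>
    obtain \<iota> :: "(complex, complex) cblinfun" where \<iota>: "norm \<iota> \<le> 1" "\<And>z. cblinfun_apply \<iota> z = z"
      using norm_CBlinfun_le[of "\<lambda>z::complex. z" 1] cblinfun_apply_CBlinfun[of "\<lambda>z::complex. z"]
      by (auto simp: bounded_linear_ident)
    define \<mu> where "\<mu> \<xi> = rank_one \<iota> (sgn (S \<xi>))" for \<xi>
    have \<mu>_apply: "cblinfun_apply (\<mu> \<xi>) z = z *\<^sub>C sgn (S \<xi>)" for \<xi> z
      by (simp add: \<mu>_def rank_one_apply \<iota>)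
    have \<mu>: "simple_function lborel \<mu>" "\<And>\<xi>. norm (\<mu> \<xi>) \<le> 1"
    proof -
      show "simple_function lborel \<mu>" unfolding \<mu>_def by (rule simple_function_compose1[OF S(1)])
      show "norm (\<mu> \<xi>) \<le> 1" for \<xi>
      proof -
        have "norm (\<mu> \<xi>) \<le> norm \<iota> * norm (sgn (S \<xi>))" unfolding \<mu>_def by (rule norm_rank_one)
        also have "\<dots> \<le> 1 * 1" using \<iota>(1) by (intro mult_mono) (auto simp: norm_sgn)
        finally show ?thesis by simp
      qed
    qed
    \<comment> \<open>The scalar factor is off by \<open>2 * \<delta>\<close> from
      \<open>norm (S \<xi>)\<close>, and \<open>S \<xi>\<close> is off by \<delta> from the
      character sum. Where \<open>S \<xi> = 0\<close>, \<open>sgn\<close> makes the operator zero,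
      which fits the same bound.\<close>
    have approx: "norm (cblinfun_apply (\<mu> \<xi>) (?P \<xi>) - ?F \<xi>) \<le> 3 * \<delta>" for \<xi>
    proof -
      have "S \<xi> = norm (S \<xi>) *\<^sub>R sgn (S \<xi>)" by (cases "S \<xi> = 0") (auto simp: sgn_div_norm)
      then have S_eq: "S \<xi> = complex_of_real (norm (S \<xi>)) *\<^sub>C sgn (S \<xi>)" by (simp only: scaleC_of_real)
      have "cblinfun_apply (\<mu> \<xi>) (?P \<xi>) - ?F \<xi> = (?P \<xi> - of_real (norm (S \<xi>))) *\<^sub>C sgn (S \<xi>) - (?F \<xi> - S \<xi>)"
        unfolding \<mu>_apply scaleC.diff_left S_eq[symmetric] by simp
      also have "norm \<dots> \<le> cmod (?P \<xi> - of_real (norm (S \<xi>))) * 1 + \<delta>"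
        using S(2)[of \<xi>] by (intro order_trans[OF norm_triangle_ineq4 add_mono]) (auto simp: norm_scaleC norm_sgn)
      also have "cmod (?P \<xi> - of_real (norm (S \<xi>))) \<le> 2 * \<delta>"
      proof -
        have "?P \<xi> - of_real (norm (S \<xi>)) = (?P \<xi> - of_real (?N \<xi>)) + of_real (?N \<xi> - norm (S \<xi>))" by simp
        also have "cmod \<dots> \<le> \<delta> + \<bar>?N \<xi> - norm (S \<xi>)\<bar>"
          using P[of \<xi>] by (intro order_trans[OF norm_triangle_ineq add_mono]) (auto simp only: norm_of_real)
        also have "\<bar>?N \<xi> - norm (S \<xi>)\<bar> \<le> \<delta>" using S(2)[of \<xi>] norm_triangle_ineq3 order_trans by blast
        finally show ?thesis by simp
      qed
      finally show ?thesis by simp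
    qed
    \<comment> \<open>The index \<open>- int k\<close> selects the coefficient of
      \<open>torus_char i (int k)\<close>, which for the exact character sum is
      \<open>y k\<close>.\<close>
    define z where "z k = discrete_multiplier i \<mu> J c (- int k)" for k
    have z: "norm (z k - y k) \<le> 3 * \<delta>" if k: "k < n" for k
    proof -
      have sm: "strongly_measurable lborel \<mu>" by (rule strongly_measurable_simple[OF \<mu>(1)])
      let ?f = "\<lambda>\<xi>. indicat_real freq_box \<xi> *\<^sub>R (torus_char i (- int k) \<xi> *\<^sub>C cblinfun_apply (\<mu> \<xi>) (?P \<xi>))"
      let ?g = "\<lambda>\<xi>. indicat_real freq_box \<xi> *\<^sub>R (torus_char i (- int k) \<xi> *\<^sub>C ?F \<xi>)"
      have f: "multiplier_integrand i \<mu> J c (- int k) = ?f"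
        by (simp add: fun_eq_iff multiplier_integrand_def scaleC_complex_def mult.commute)
      obtain I where I: "has_Bochner_integral lborel ?f I"
        using has_Bochner_integral_exists[OF strongly_measurable_multiplier_integrand[OF sm \<mu>(2)]
            nn_integral_multiplier_integrand_finite[OF sm \<mu>(2)]] unfolding f[symmetric] by blast
      have I_eq: "I = z k"
        using Bochner_integral_eq[OF I] unfolding z_def discrete_multiplier_def f by simp
      have "has_Bochner_integral lborel (\<lambda>\<xi>. \<Sum>l<n. (indicat_real freq_box \<xi> *\<^sub>R torus_char i (int l - int k) \<xi>) *\<^sub>C y l)
          (\<Sum>l<n. (if int l - int k = 0 then 1 else 0) *\<^sub>C y l)"
      proof (rule has_Bochner_integral_sum)
        fix l
        have "has_Bochner_integral lborel (\<lambda>\<xi> :: real ^ 'd. indicat_real freq_box \<xi> *\<^sub>R torus_char i (int l - int k) \<xi>)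
            (if int l - int k = 0 then 1 else 0)"
          using has_Bochner_integral_lebesgue[OF integrable_box_char[of i "int l - int k"]] by (simp only: integral_box_char)
        then show "has_Bochner_integral lborel (\<lambda>\<xi>. (indicat_real freq_box \<xi> *\<^sub>R torus_char i (int l - int k) \<xi>) *\<^sub>C y l)
            ((if int l - int k = 0 then 1 else 0) *\<^sub>C y l)"
          by (rule has_Bochner_integral_bounded_linear[OF scaleC.bounded_linear_left])
      qed
      also have "(\<lambda>\<xi>. \<Sum>l<n. (indicat_real freq_box \<xi> *\<^sub>R torus_char i (int l - int k) \<xi>) *\<^sub>C y l) = ?g"
        unfolding char_sum_def diff_conv_add_uminus add.commute[of "int _"] torus_char_mult[symmetric]
        by (simp add: scaleC.sum_right scaleR_sum_right scaleC.scaleR_left scaleC_scaleC)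
      also have "(\<Sum>l<n. (if int l - int k = 0 then 1 else 0) *\<^sub>C y l) = (\<Sum>l<n. if l = k then y l else 0)"
        by (intro sum.cong refl) (simp add: scaleC_one scaleC_zero_left)
      also have "\<dots> = y k" using k by simp
      finally have "has_Bochner_integral lborel ?g (y k)" .
      from has_Bochner_integral_bounded_linear[OF bounded_linear_scaleR_right[of "-1"] this]
      have "has_Bochner_integral lborel (\<lambda>\<xi>. (-1) *\<^sub>R ?g \<xi>) ((-1) *\<^sub>R y k)" .
      from has_Bochner_integral_add[OF I this]
      have "has_Bochner_integral lborel (\<lambda>\<xi>. ?f \<xi> + (-1) *\<^sub>R ?g \<xi>) (z k - y k)" by (simp add: I_eq)
      then have "ennreal (norm (z k - y k)) \<le> (\<integral>\<^sup>+\<xi>. norm (?f \<xi> + (-1) *\<^sub>R ?g \<xi>) \<partial>lborel)"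
        by (rule has_Bochner_integral_norm_bound)
      also have "\<dots> \<le> (\<integral>\<^sup>+\<xi>. ennreal (3 * \<delta>) * indicator (freq_box :: (real ^ 'd) set) \<xi> \<partial>lborel)"
      proof (rule nn_integral_mono)
        fix \<xi> :: "real ^ 'd"
        have "?f \<xi> + (-1) *\<^sub>R ?g \<xi> = indicat_real freq_box \<xi> *\<^sub>R (torus_char i (- int k) \<xi> *\<^sub>C (cblinfun_apply (\<mu> \<xi>) (?P \<xi>) - ?F \<xi>))"
          by (simp add: scaleC.diff_right scaleR_diff_right)
        then show "ennreal (norm (?f \<xi> + (-1) *\<^sub>R ?g \<xi>)) \<le> ennreal (3 * \<delta>) * indicator freq_box \<xi>"
          using approx[of \<xi>] by (auto simp: norm_scaleC indicator_def intro: ennreal_leI)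
      qed
      also have "\<dots> = ennreal (3 * \<delta>)"
        by (simp add: nn_integral_cmult_indicator emeasure_freq_box)
      finally show ?thesis using \<delta> by simp
    qed
    have "Y = (\<Sum>k<n. ?b k * norm (y k))"
      unfolding Y_def
    proof (rule sum.cong[OF refl])
      fix k show "norm (y k) powr q = ?b k * norm (y k)"
        by (cases "y k = 0") (auto simp: powr_diff)
    qed
    also have "\<dots> \<le> (\<Sum>k<n. ?b k * (norm (z k) + 3 * \<delta>))"
    proof (intro sum_mono mult_left_mono)
      fix k assume "k \<in> {..<n}"
      then show "norm (y k) \<le> norm (z k) + 3 * \<delta>"
        using z[of k] norm_triangle_ineq2[of "y k" "z k"] by (simp add: norm_minus_commute)
    qed simp
    also have "\<dots> = (\<Sum>k<n. ?b k * norm (z k)) + (\<Sum>k<n. ?b k) * (3 * \<delta>)"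
      by (simp add: distrib_left sum.distrib sum_distrib_right)
    also have "(\<Sum>k<n. ?b k * norm (z k)) \<le> K * Y powr (1 / q') * sqrt (?I + \<delta> * (2 * ?R + \<delta>))"
    proof -
      have inj: "inj_on (\<lambda>k. - int k) {..<n}" by (auto simp: inj_on_def)
      have "(\<Sum>k<n. ?b k * norm (z k)) = (\<Sum>j\<in>(\<lambda>k. - int k) ` {..<n}. ?b (nat (- j)) * norm (discrete_multiplier i \<mu> J c j))"
        by (subst sum.reindex[OF inj]) (simp add: z_def)
      also have "\<dots> \<le> K * (\<Sum>j\<in>(\<lambda>k. - int k) ` {..<n}. ?b (nat (- j)) powr q') powr (1 / q') * (\<Sum>k\<in>J. norm (c k) powr 2) powr (1 / 2)"
        by (intro discretely_boundedD[OF bound] \<mu> J) auto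
      also have "(\<Sum>j\<in>(\<lambda>k. - int k) ` {..<n}. ?b (nat (- j)) powr q') = Y"
        by (subst sum.reindex[OF inj]) (simp add: Y_def powr_powr qq)
      also have "(\<Sum>k\<in>J. norm (c k) powr 2) powr (1 / 2) = sqrt (\<Sum>k\<in>J. (cmod (c k))\<^sup>2)"
        by (simp add: powr_half_sqrt sum_nonneg)
      also have "K * Y powr (1 / q') * sqrt (\<Sum>k\<in>J. (cmod (c k))\<^sup>2) \<le> K * Y powr (1 / q') * sqrt (?I + \<delta> * (2 * ?R + \<delta>))"
        using K by (intro mult_left_mono real_sqrt_le_mono sum_squares_trig_poly_approx[OF J \<delta> P]) auto
      finally show ?thesis .
    qed
    finally show ?thesis by simp
  qed
  have lim: "((\<lambda>\<delta>. K * Y powr (1 / q') * sqrt (?I + \<delta> * (2 * ?R + \<delta>)) + (\<Sum>k<n. ?b k) * (3 * \<delta>)) \<longlongrightarrow> K * Y powr (1 / q') * sqrt ?I) (at_right 0)"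
    by (auto intro!: tendsto_eq_intros)
  have *: "Y \<le> K * Y powr (1 / q') * sqrt ?I"
    by (rule le_of_tendsto_at_right[OF lim le])
  have "Y powr (1 / q) \<le> K * sqrt ?I"
  proof (cases "Y = 0")
    case True
    then show ?thesis using K by (simp add: box_norm2_nonneg)
  next
    case False
    then have Y: "Y > 0" using Y0 by simp
    have "1 / q = 1 - 1 / q'" using q by simp
    then have "Y powr (1 / q) * Y powr (1 / q') = Y" using Y by (simp flip: powr_add)
    then have "Y powr (1 / q) * Y powr (1 / q') \<le> (K * sqrt ?I) * Y powr (1 / q')" using * by (simp add: mult_ac)
    then show ?thesis using Y by simp
  qed
  then show ?thesis by (simp add: Y_def)
qed

theorem proposition3p27:
  fixes p q :: real and r :: ereal
  assumes "\<exists>x :: 'x::complex_banach. x \<noteq> 0"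
    and "\<exists>y :: 'y::complex_banach. y \<noteq> 0"
    and "1 < p" "p \<le> 2" "2 \<le> q" "1 < r" "1 / r = ereal (1 / p - 1 / q)"
  shows
    "((\<forall>m :: real ^ 'd::finite \<Rightarrow> ('x, complex) cblinfun.
          X_strongly_measurable m \<and>
          gamma_bounded (range (\<lambda>\<xi>. rpow (norm \<xi>) (real_of_ereal (ereal (real CARD('d)) / r)) *\<^sub>R m \<xi>)) \<longrightarrow>
          multiplier_bounded p q m) \<longrightarrow>
        has_cotype TYPE('x) 2 \<longrightarrow> q = 2 \<longrightarrow> has_type TYPE('x) p) \<and>
     ((\<forall>m :: real ^ 'd::finite \<Rightarrow> (complex, 'y) cblinfun.
          X_strongly_measurable m \<and>
          gamma_bounded (range (\<lambda>\<xi>. rpow (norm \<xi>) (real_of_ereal (ereal (real CARD('d)) / r)) *\<^sub>R m \<xi>)) \<longrightarrow>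
          multiplier_bounded p q m) \<longrightarrow>
        has_type TYPE('y) 2 \<longrightarrow> p = 2 \<longrightarrow> has_cotype TYPE('y) q) \<and>
     ((\<forall>m :: real ^ 'd::finite \<Rightarrow> ('x, ('x, complex) cblinfun) cblinfun.
          X_strongly_measurable m \<and>
          gamma_bounded (range (\<lambda>\<xi>. rpow (norm \<xi>) (real_of_ereal (ereal (real CARD('d)) / r)) *\<^sub>R m \<xi>)) \<longrightarrow>
          multiplier_bounded p q m) \<longrightarrow>
        has_type TYPE(('x, complex) cblinfun) 2 \<longrightarrow> 1 / p + 1 / q = 1 \<longrightarrow> has_type TYPE('x) p)"
proof (intro conjI impI)
  \<comment> \<open>Any coordinate may carry the characters; \<open>undefined\<close> names
    one.\<close>
  let ?e = "real_of_ereal (ereal (real CARD('d)) / r)" and ?i = "undefined :: 'd"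
  note p = \<open>1 < p\<close> \<open>p \<le> 2\<close> and q = \<open>2 \<le> q\<close>
  {
    assume "\<forall>m :: real ^ 'd \<Rightarrow> ('x, complex) cblinfun. X_strongly_measurable m \<and>
        gamma_bounded (range (\<lambda>\<xi>. rpow (norm \<xi>) ?e *\<^sub>R m \<xi>)) \<longrightarrow> multiplier_bounded p q m"
      and cotype: "has_cotype TYPE('x) 2" and q2: "q = 2"
    then have H: "all_multipliers_bounded TYPE('d) TYPE('x \<times> complex) p 2 ?e"
      unfolding all_multipliers_bounded_def by simp
    \<comment> \<open>For the target exponent 2 the dual exponent is again 2.\<close>
    obtain K where K: "discretely_bounded ?i TYPE('x \<times> complex) p 2 K"
      using exists_discrete_bound[OF H cotype has_type_2_complex, of 2 ?i] p by auto
    have "K \<ge> 0" using K by (simp add: discretely_bounded_def)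
    then show "has_type TYPE('x) p"
      by (rule has_type_of_box_norm2[OF _ p(2) _ box_norm2_le_scalar_target[OF K], rotated]) (use p in auto)
  next
    assume "\<forall>m :: real ^ 'd \<Rightarrow> (complex, 'y) cblinfun. X_strongly_measurable m \<and>
        gamma_bounded (range (\<lambda>\<xi>. rpow (norm \<xi>) ?e *\<^sub>R m \<xi>)) \<longrightarrow> multiplier_bounded p q m"
      and type: "has_type TYPE('y) 2" and p2: "p = 2"
    then have H: "all_multipliers_bounded TYPE('d) TYPE(complex \<times> 'y) 2 q ?e"
      unfolding all_multipliers_bounded_def by simp
    define q' where "q' = q / (q - 1)"
    have q': "q > 1" "q' > 1" "1 / q + 1 / q' = 1" using q by (auto simp: q'_def field_simps)
    obtain K where K: "discretely_bounded ?i TYPE(complex \<times> 'y) 2 q' K"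
      using exists_discrete_bound[OF H has_cotype_2_complex type _ q', of ?i] by auto
    have "K \<ge> 0" using K by (simp add: discretely_bounded_def)
    then show "has_cotype TYPE('y) q"
      by (rule has_cotype_of_box_norm2[OF q _ sum_powr_le_box_norm2[OF q' K]])
  next
    assume "\<forall>m :: real ^ 'd \<Rightarrow> ('x, ('x, complex) cblinfun) cblinfun. X_strongly_measurable m \<and>
        gamma_bounded (range (\<lambda>\<xi>. rpow (norm \<xi>) ?e *\<^sub>R m \<xi>)) \<longrightarrow> multiplier_bounded p q m"
      and type: "has_type TYPE(('x, complex) cblinfun) 2" and pq: "1 / p + 1 / q = 1"
    then have H: "all_multipliers_bounded TYPE('d) TYPE('x \<times> ('x, complex) cblinfun) p q ?e"
      unfolding all_multipliers_bounded_def by simp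
    \<comment> \<open>Here \<open>p\<close> is the exponent dual to \<open>q\<close>, so input and
      test sequences are measured in the same norm.\<close>
    obtain K where K: "discretely_bounded ?i TYPE('x \<times> ('x, complex) cblinfun) p p K"
      using exists_discrete_bound[OF H has_cotype_2_of_dual[OF type] type, of p ?i] p q pq by auto
    have "sqrt K \<ge> 0" using K by (simp add: discretely_bounded_def)
    then show "has_type TYPE('x) p"
      by (rule has_type_of_box_norm2[OF _ p(2) _ box_norm2_le_dual_target[OF K], rotated]) (use p in auto)
  }
qed

end
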